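(* If $H$ and $T$ are fixed graphs such that $T$ is $2$-balanced and that $m_2(H) > m_2(T)$, then w.h.p.\ \[ \mathrm{ex}\big( G(n,p),T,H \big) = \begin{cases} \left( \mathcal{N}_T(K_n) + o\big(n^{v_T}\big)\right) p^{e_T} & \text{if } n^{-v_T/e_T} \ll p\ll n^{ -1/m_2(H)},\\ \left( \mathrm{ex}\big(n,T,H\big) + o\big(n^{v_T}\big)\right) p^{e_T} & \text{if } p\gg n^{ -1/m_2(H)}. \end{cases} \]
   Context: $G(n,p)$ is the binomial random graph on $n$ vertices; w.h.p.\ means with probability tending to one as $n\to\infty$. For graphs $T,H$, $\mathrm{ex}(n,T,H)$ is the maximum number of copies of $T$ in an $H$-free subgraph of $K_n$, and $\mathrm{ex}(G(n,p),T,H)$ is the random variable counting the maximum number of copies of $T$ in an $H$-free subgraph of $G(n,p)$. $\mathcal{N}_T(G)$ denotes the number of copies of $T$ in a graph $G$. $v_T,e_T$ are the numbers of vertices and edges of $T$. The 2-density is $m_2(H)=\max\{(e_{H'}-1)/(v_{H'}-2): H'\subseteq H,\ e_{H'}\ge 2\}$, and $T$ is $2$-balanced if $m_2(T)=(e_T-1)/(v_T-2)$. *)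

theory Defs
  imports "HOL-Probability.Probability" "HOL-Library.Landau_Symbols"
begin

type_synonym 'a ugraph = "'a set \<times> 'a set set"

abbreviation verts :: "'a ugraph \<Rightarrow> 'a set" where
  "verts G \<equiv> fst G"

abbreviation edges :: "'a ugraph \<Rightarrow> 'a set set" where
  "edges G \<equiv> snd G"

definition all_pairs :: "'a set \<Rightarrow> 'a set set" where
  "all_pairs V = {e. e \<subseteq> V \<and> card e = 2}"

definition simple_graph :: "'a ugraph \<Rightarrow> bool" where
  "simple_graph G \<longleftrightarrow> finite (verts G) \<and> edges G \<subseteq> all_pairs (verts G)"

text \<open>Subgraphs are neither required to be induced nor to be spanning.\<close>

definition subgraph :: "'a ugraph \<Rightarrow> 'a ugraph \<Rightarrow> bool" where
  "subgraph F G \<longleftrightarrow> simple_graph F \<and> verts F \<subseteq> verts G \<and> edges F \<subseteq> edges G"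

definition isomorphic :: "'a ugraph \<Rightarrow> 'b ugraph \<Rightarrow> bool" where
  "isomorphic F G \<longleftrightarrow>
     (\<exists>f. bij_betw f (verts F) (verts G) \<and> edges G = (\<lambda>e. f ` e) ` edges F)"

text \<open>Copies are unlabelled: a copy of \<open>T\<close> in \<open>G\<close> is a subgraph of \<open>G\<close>, not an embedding.\<close>

definition copies :: "'b ugraph \<Rightarrow> 'a ugraph \<Rightarrow> 'a ugraph set" where
  "copies T G = {S. subgraph S G \<and> isomorphic S T}"

definition num_copies :: "'b ugraph \<Rightarrow> 'a ugraph \<Rightarrow> nat" where
  "num_copies T G = card (copies T G)"

definition free_of :: "'c ugraph \<Rightarrow> 'a ugraph \<Rightarrow> bool" where
  "free_of H G \<longleftrightarrow> copies H G = {}"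

definition complete_ugraph :: "nat \<Rightarrow> nat ugraph" where
  "complete_ugraph n = ({..<n}, all_pairs {..<n})"

text \<open>
  The maximum is over a finite set, which is nonempty as soon as \<open>H\<close> has an edge.
\<close>

definition ex_in :: "'a ugraph \<Rightarrow> 'b ugraph \<Rightarrow> 'c ugraph \<Rightarrow> nat" where
  "ex_in G T H = Max {num_copies T F |F. subgraph F G \<and> free_of H F}"

definition ex_num :: "nat \<Rightarrow> 'b ugraph \<Rightarrow> 'c ugraph \<Rightarrow> nat" where
  "ex_num n T H = ex_in (complete_ugraph n) T H"

text \<open>
  The 2-density is only meaningful for graphs with at least two edges; such graphs have at least
  three vertices, so that no denominator below is zero.
\<close>

definition m2 :: "'a ugraph \<Rightarrow> real" where
  "m2 H = Max {(real (card (edges F)) - 1) / (real (card (verts F)) - 2) |F.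
                 subgraph F H \<and> card (edges F) \<ge> 2}"

definition two_balanced :: "'a ugraph \<Rightarrow> bool" where
  "two_balanced T \<longleftrightarrow>
     m2 T = (real (card (edges T)) - 1) / (real (card (verts T)) - 2)"

definition binomial_random_graph :: "nat \<Rightarrow> real \<Rightarrow> nat ugraph pmf" where
  "binomial_random_graph n p =
     map_pmf (\<lambda>b. ({..<n}, {e \<in> all_pairs {..<n}. b e}))
       (Pi_pmf (all_pairs {..<n}) False (\<lambda>_. bernoulli_pmf p))"

definition whp :: "(nat \<Rightarrow> 'a pmf) \<Rightarrow> (nat \<Rightarrow> 'a \<Rightarrow> bool) \<Rightarrow> bool" where
  "whp M P \<longleftrightarrow> (\<lambda>n. measure_pmf.prob (M n) {x. P n x}) \<longlonglongrightarrow> 1"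

end

theory Submission
  imports Defs
begin

text \<open>
  Copies are counted as embeddings, which multiplies all counts by the number of automorphisms
  of \<open>T\<close>. Since \<open>T\<close> is 2-balanced it is balanced, so above \<open>n powr (- v / e)\<close> the number of copies
  of \<open>T\<close> in a fixed graph that survive in \<open>G(n,p)\<close> is concentrated, by Chebyshev's inequality.

  Below \<open>n powr (-1 / m2 H)\<close>, let \<open>H'\<close> be a subgraph of \<open>H\<close> attaining the 2-density. As
  \<open>m2 T < m2 H\<close>, the expected number of pairs of copies of \<open>T\<close> and of \<open>H'\<close> sharing an edge is
  negligible, so deleting all copies of \<open>H'\<close> destroys few copies of \<open>T\<close>.

  Above it, the lower bound intersects an extremal graph with \<open>G(n,p)\<close>. For the upper bound, every
  \<open>H\<close>-free \<open>F\<close> is contained in \<open>C \<union> S\<close>, where the fingerprint \<open>S \<subseteq> F\<close> has \<open>o(n\<^sup>2 p)\<close> edges and the container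
  \<open>C\<close>, a function of \<open>S\<close>, has few copies of \<open>H\<close>, hence by supersaturation at most
  \<open>ex(n,T,H) + o(n\<^sup>v)\<close> copies of \<open>T\<close>. The upper tail of the number of copies of \<open>T\<close> inside \<open>C\<close> is too heavy
  for a union bound over \<open>S\<close>. One instead bounds the lower tail of the number of copies not inside \<open>C\<close>
  by Janson's inequality, with error \<open>exp (- c n\<^sup>2 p)\<close> because \<open>p\<close> exceeds \<open>n powr (-1 / m2 T)\<close>, and subtracts from
  the total, which is concentrated.
\<close>

section \<open>Random subsets, Harris inequality and lower tails\<close>

text \<open>The fingerprints may have only \<open>O(n powr (2 - 1 / m2 H))\<close> edges, without a
  logarithmic factor, because \<open>p\<close> exceeds \<open>n powr (- 1 / m2 H)\<close> by a
  factor that may diverge arbitrarily slowly. The hard-core model delivers this. When no marginal at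
  a few activities is noticeably reduced, the partition function of the container is almost as large
  as without constraints, so a random subset of the container, at density q of order
  \<open>n powr (- 1 / m2 H)\<close>, is \<open>H\<close>-free with probability at least exp(- b n^2
  q) for a prescribed small b. Janson's inequality contradicts this if the container holds many
  copies of \<open>H\<close>. Janson thus serves twice, for \<open>H\<close> and for
  \<open>T\<close>, each time because from \<open>n powr (- 1 / m2)\<close> on no subgraph is rarer
  in expectation than a single edge.

  In the union bound a fingerprint S costs p^|S| and not 1: once the copies of \<open>T\<close>
  meeting S are discarded, which are few, the lower-tail event is independent of S being drawn. The
  sum of p^|S| over all sets with o(n^2 p) edges is exp(o(n^2 p)).\<close>

definition pexp :: "real \<Rightarrow> 'a set \<Rightarrow> ('a set \<Rightarrow> real) \<Rightarrow> real" where
  "pexp p V f = (\<Sum>R\<in>Pow V. p ^ card R * (1 - p) ^ card (V - R) * f R)"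

lemma pexp_empty [simp]: "pexp p {} f = f {}"
  by (simp add: pexp_def)

text \<open>Conditioning on whether \<open>v\<close> is drawn. This recursion turns independence,
  Harris' inequality and the link to the product measure into inductions on
  \<open>V\<close>.\<close>

lemma pexp_insert:
  assumes "finite V" "v \<notin> V"
  shows "pexp p (insert v V) f = (1 - p) * pexp p V f + p * pexp p V (\<lambda>R. f (insert v R))"
proof -
  have inj: "inj_on (insert v) (Pow V)"
    using assms(2) by (auto simp: inj_on_def)
  have disj: "Pow V \<inter> insert v ` Pow V = {}"
    using assms(2) by auto
  have fin: "finite (Pow V)" using assms(1) by simp
  have c1: "card (insert v V - R) = Suc (card (V - R))" if "R \<in> Pow V" for R
  proof -
    have "insert v V - R = insert v (V - R)" using that assms(2) by auto
    then show ?thesis using assms by simp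
  qed
  have c2: "card (insert v R) = Suc (card R)" "insert v V - insert v R = V - R" if "R \<in> Pow V" for R
    using that assms finite_subset[of R V] by (auto intro!: card_insert_disjoint)
  let ?w = "\<lambda>R. p ^ card R * (1 - p) ^ card (insert v V - R) * f R"
  have "pexp p (insert v V) f = (\<Sum>R\<in>Pow V. ?w R) + (\<Sum>R\<in>Pow V. ?w (insert v R))"
    unfolding pexp_def Pow_insert using fin disj
    by (subst sum.union_disjoint) (simp_all add: sum.reindex[OF inj])
  also have "(\<Sum>R\<in>Pow V. ?w R) = (1 - p) * pexp p V f"
    unfolding pexp_def sum_distrib_left by (intro sum.cong refl) (simp add: c1)
  also have "(\<Sum>R\<in>Pow V. ?w (insert v R)) = p * pexp p V (\<lambda>R. f (insert v R))"
    unfolding pexp_def sum_distrib_left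
    by (intro sum.cong refl) (simp only: c2, simp)
  finally show ?thesis .
qed

lemma pexp_const: "finite V \<Longrightarrow> pexp p V (\<lambda>R. c) = c"
  by (induction V rule: finite_induct) (simp_all add: pexp_insert algebra_simps)

lemma pexp_cmult: "pexp p V (\<lambda>R. c * f R) = c * pexp p V f"
  by (simp add: pexp_def sum_distrib_left mult_ac)

lemma pexp_add: "pexp p V (\<lambda>R. f R + g R) = pexp p V f + pexp p V g"
  by (simp add: pexp_def sum.distrib algebra_simps)

lemma pexp_diff: "pexp p V (\<lambda>R. f R - g R) = pexp p V f - pexp p V g"
  by (simp add: pexp_def sum_subtractf algebra_simps)

lemma pexp_sum: "pexp p V (\<lambda>R. \<Sum>i\<in>I. f i R) = (\<Sum>i\<in>I. pexp p V (f i))"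
  unfolding pexp_def by (subst sum.swap) (simp add: sum_distrib_left)

lemma pexp_mono:
  assumes "0 \<le> p" "p \<le> 1" "\<And>R. R \<subseteq> V \<Longrightarrow> f R \<le> g R"
  shows "pexp p V f \<le> pexp p V g"
  unfolding pexp_def using assms by (intro sum_mono mult_left_mono) auto

lemma pexp_cong: "(\<And>R. R \<subseteq> V \<Longrightarrow> f R = g R) \<Longrightarrow> pexp p V f = pexp p V g"
  unfolding pexp_def by (intro sum.cong) auto

lemma pexp_nonneg:
  assumes "0 \<le> p" "p \<le> 1" "\<And>R. R \<subseteq> V \<Longrightarrow> 0 \<le> f R"
  shows "0 \<le> pexp p V f"
  unfolding pexp_def using assms by (intro sum_nonneg mult_nonneg_nonneg) auto

text \<open>Conditioning on A \<subseteq> R without dividing by its probability: the elements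
  outside \<open>A\<close> stay independent, those of \<open>A\<close> are simply added.\<close>

lemma pexp_superset:
  assumes "finite V" "A \<subseteq> V"
  shows "pexp p V (\<lambda>R. of_bool (A \<subseteq> R) * f R) = p ^ card A * pexp p V (\<lambda>R. f (R \<union> A))"
  using assms
proof (induction V arbitrary: A f rule: finite_induct)
  case empty
  then show ?case by simp
next
  case (insert v V)
  show ?case
  proof (cases "v \<in> A")
    case True
    define B where "B = A - {v}"
    have A: "A = insert v B" "v \<notin> B" "B \<subseteq> V" using True insert.prems by (auto simp: B_def)
    have finB: "finite B" using A insert.hyps finite_subset by blast
    have 1: "pexp p V (\<lambda>R. of_bool (A \<subseteq> R) * f R) = pexp p V (\<lambda>R. 0)"
      using A insert.hyps by (intro pexp_cong) auto
    have 2: "pexp p V (\<lambda>R. of_bool (A \<subseteq> insert v R) * f (insert v R))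
        = pexp p V (\<lambda>R. of_bool (B \<subseteq> R) * f (insert v R))"
      using A by (intro pexp_cong) (auto simp: of_bool_def)
    have 3: "pexp p V (\<lambda>R. f (R \<union> A)) = pexp p V (\<lambda>R. f (insert v (R \<union> B)))"
      using A by (intro pexp_cong) auto
    have 4: "pexp p V (\<lambda>R. f (insert v R \<union> A)) = pexp p V (\<lambda>R. f (insert v (R \<union> B)))"
      using A by (intro pexp_cong) (auto intro!: arg_cong[where f=f])
    show ?thesis
      unfolding pexp_insert[OF insert.hyps] 1 2 3 4
      using insert.IH[OF A(3), of "\<lambda>R. f (insert v R)"] insert.hyps A finB
      by (simp add: pexp_const algebra_simps)
  next
    case False
    then have AV: "A \<subseteq> V" using insert.prems by auto
    have 2: "pexp p V (\<lambda>R. of_bool (A \<subseteq> insert v R) * f (insert v R))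
        = pexp p V (\<lambda>R. of_bool (A \<subseteq> R) * f (insert v R))"
      using False by (intro pexp_cong) (auto simp: of_bool_def)
    show ?thesis
      unfolding pexp_insert[OF insert.hyps] 2
      using insert.IH[OF AV, of f] insert.IH[OF AV, of "\<lambda>R. f (insert v R)"] 
      by (simp add: algebra_simps)
  qed
qed

lemma pexp_superset_prob:
  assumes "finite V" "A \<subseteq> V"
  shows "pexp p V (\<lambda>R. of_bool (A \<subseteq> R)) = p ^ card A"
  using pexp_superset[OF assms, of p "\<lambda>_. 1"] assms by (simp add: pexp_const)

text \<open>Conditioning on one element leaves a comparison of two points, where the covariance is
  \<open>p * (1 - p) * ((a - b) * (c - d))\<close>, non-negative because both functions
  decrease.\<close>

lemma harris:
  assumes "finite V" "0 \<le> p" "p \<le> 1"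
    and "\<And>R R'. R \<subseteq> R' \<Longrightarrow> R' \<subseteq> V \<Longrightarrow> f R' \<le> f R"
    and "\<And>R R'. R \<subseteq> R' \<Longrightarrow> R' \<subseteq> V \<Longrightarrow> g R' \<le> g R"
  shows "pexp p V f * pexp p V g \<le> pexp p V (\<lambda>R. f R * g R)"
  using assms(1,4,5)
proof (induction V arbitrary: f g rule: finite_induct)
  case empty
  then show ?case by simp
next
  case (insert v V)
  let ?f = "\<lambda>R. f (insert v R)" and ?g = "\<lambda>R. g (insert v R)"
  define a b c d where "a = pexp p V f" "b = pexp p V ?f" "c = pexp p V g" "d = pexp p V ?g"
  note defs = this
  have ba: "b \<le> a" unfolding defs
    using assms(2,3) by (intro pexp_mono insert.prems(1)) auto
  have dc: "d \<le> c" unfolding defs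
    using assms(2,3) by (intro pexp_mono insert.prems(2)) auto
  have 1: "a * c \<le> pexp p V (\<lambda>R. f R * g R)"
    unfolding defs by (intro insert.IH insert.prems) auto
  have 2: "b * d \<le> pexp p V (\<lambda>R. ?f R * ?g R)"
    unfolding defs by (intro insert.IH insert.prems) auto
  have "((1 - p) * a + p * b) * ((1 - p) * c + p * d)
      = (1 - p) * (a * c) + p * (b * d) - p * (1 - p) * ((a - b) * (c - d))"
    by (simp add: algebra_simps)
  also have "\<dots> \<le> (1 - p) * (a * c) + p * (b * d)"
    using assms(2,3) ba dc by simp
  also have "\<dots> \<le> (1 - p) * pexp p V (\<lambda>R. f R * g R) + p * pexp p V (\<lambda>R. ?f R * ?g R)"
    using 1 2 assms(2,3) by (intro add_mono mult_left_mono) auto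
  finally show ?case
    unfolding pexp_insert[OF insert.hyps] defs .
qed

section \<open>Janson's lower tail and Chebyshev's inequality\<close>

definition count_in :: "'i set \<Rightarrow> ('i \<Rightarrow> 'a set) \<Rightarrow> 'a set \<Rightarrow> real" where
  "count_in I A R = (\<Sum>i\<in>I. of_bool (A i \<subseteq> R))"

text \<open>For two equal families this is the Delta of Janson's inequality, over ordered pairs and
  with the diagonal, so that it bounds the variance as well. Two different families are used for
  copies of \<open>T\<close> that share an edge with copies of a subgraph of
  \<open>H\<close>.\<close>

definition overlap :: "real \<Rightarrow> 'i set \<Rightarrow> ('i \<Rightarrow> 'a set) \<Rightarrow> 'j set \<Rightarrow> ('j \<Rightarrow> 'a set) \<Rightarrow> real" where
  "overlap p I A J B = (\<Sum>i\<in>I. \<Sum>j\<in>J. of_bool (A i \<inter> B j \<noteq> {}) * p ^ card (A i \<union> B j))"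

lemma count_in_mono: "finite I \<Longrightarrow> R \<subseteq> R' \<Longrightarrow> count_in I A R \<le> count_in I A R'"
  unfolding count_in_def by (intro sum_mono) (auto simp: of_bool_def)

lemma count_in_nonneg: "0 \<le> count_in I A R"
  unfolding count_in_def by (intro sum_nonneg) auto

lemma count_in_card: "finite I \<Longrightarrow> count_in I A R = card {i \<in> I. A i \<subseteq> R}"
  unfolding count_in_def by (simp add: of_bool_def sum.If_cases Int_def)

lemma overlap_mono:
  assumes "finite I'" "finite J'" "I \<subseteq> I'" "J \<subseteq> J'" "0 \<le> p"
  shows "overlap p I A J B \<le> overlap p I' A J' B"
proof -
  have "overlap p I A J B \<le> (\<Sum>i\<in>I. \<Sum>j\<in>J'. of_bool (A i \<inter> B j \<noteq> {}) * p ^ card (A i \<union> B j))"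
    unfolding overlap_def using assms by (intro sum_mono sum_mono2) auto
  also have "\<dots> \<le> overlap p I' A J' B"
    unfolding overlap_def using assms by (intro sum_mono2) (auto intro!: sum_nonneg)
  finally show ?thesis .
qed

locale set_family =
  fixes V :: "'a set" and I :: "'i set" and A :: "'i \<Rightarrow> 'a set" and p :: real
  assumes finite_V: "finite V" and finite_I: "finite I" and A_sub: "\<And>i. i \<in> I \<Longrightarrow> A i \<subseteq> V"
    and p0: "0 \<le> p" and p1: "p \<le> 1"
begin

definition "mu = (\<Sum>i\<in>I. p ^ card (A i))"
abbreviation "X \<equiv> count_in I A"
abbreviation "D \<equiv> overlap p I A I A"

lemma finite_A: "i \<in> I \<Longrightarrow> finite (A i)"
  using A_sub finite_V finite_subset by blast

lemma pexp_X: "pexp p V X = mu"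
  unfolding count_in_def mu_def
  by (simp add: pexp_sum pexp_superset_prob[OF finite_V A_sub])

text \<open>Given A i \<subseteq> R, split \<open>X\<close> into the members \<open>K\<close>
  meeting \<open>A i\<close> and the members \<open>L\<close> disjoint from it. Harris separates the
  two exponentials; the one for \<open>K\<close> is at least 1 - s times its mean, and the one for
  \<open>L\<close> is at least the exponential of the whole \<open>X\<close>.\<close>

lemma janson_term:
  assumes i: "i \<in> I" and s: "0 \<le> s"
  shows "pexp p V (\<lambda>R. of_bool (A i \<subseteq> R) * exp (- s * X R))
     \<ge> (p ^ card (A i) - s * (\<Sum>j\<in>I. of_bool (A i \<inter> A j \<noteq> {}) * p ^ card (A i \<union> A j)))
         * pexp p V (\<lambda>R. exp (- s * X R))"
proof -
  define K where "K = {j \<in> I. A i \<inter> A j \<noteq> {}}"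
  define L where "L = {j \<in> I. A i \<inter> A j = {}}"
  have finKL: "finite K" "finite L" and KI: "K \<subseteq> I" using finite_I by (auto simp: K_def L_def)
  have X_split: "X R = count_in K A R + count_in L A R" for R
  proof -
    have "I = K \<union> L" "K \<inter> L = {}" by (auto simp: K_def L_def)
    then show ?thesis unfolding count_in_def using finKL
      by (simp only: sum.union_disjoint)
  qed
  have L_indep: "count_in L A (R \<union> A i) = count_in L A R" for R
    unfolding count_in_def L_def by (intro sum.cong) (auto simp: of_bool_def)
  let ?E = "pexp p V"
  have mean: "p ^ card (A i) * ?E (\<lambda>R. count_in K A (R \<union> A i))
      = (\<Sum>j\<in>I. of_bool (A i \<inter> A j \<noteq> {}) * p ^ card (A i \<union> A j))"
  proof -
    have "p ^ card (A i) * ?E (\<lambda>R. count_in K A (R \<union> A i))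
       = ?E (\<lambda>R. of_bool (A i \<subseteq> R) * count_in K A R)"
      by (simp add: pexp_superset[OF finite_V A_sub[OF i]])
    also have "\<dots> = ?E (\<lambda>R. \<Sum>j\<in>K. of_bool (A i \<union> A j \<subseteq> R))"
      unfolding count_in_def sum_distrib_left by (intro pexp_cong sum.cong) auto
    also have "\<dots> = (\<Sum>j\<in>K. p ^ card (A i \<union> A j))"
      unfolding pexp_sum using A_sub i KI
      by (intro sum.cong refl pexp_superset_prob finite_V) auto
    also have "\<dots> = (\<Sum>j\<in>I. of_bool (A i \<inter> A j \<noteq> {}) * p ^ card (A i \<union> A j))"
      unfolding K_def using finite_I by (simp add: sum.inter_filter of_bool_def if_distrib cong: if_cong)
         (intro sum.cong, auto)
    finally show ?thesis .
  qed
  have "1 - s * ?E (\<lambda>R. count_in K A (R \<union> A i)) = ?E (\<lambda>R. 1 + (- s) * count_in K A (R \<union> A i))"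
    by (simp only: pexp_add pexp_cmult pexp_const[OF finite_V])
  also have "\<dots> \<le> ?E (\<lambda>R. exp (- s * count_in K A (R \<union> A i)))"
    by (intro pexp_mono p0 p1 exp_ge_add_one_self)
  finally have e1: "1 - s * ?E (\<lambda>R. count_in K A (R \<union> A i)) \<le> ?E (\<lambda>R. exp (- s * count_in K A (R \<union> A i)))" .
  have Epos: "0 \<le> ?E (\<lambda>R. exp (- s * X R))" by (intro pexp_nonneg p0 p1) auto
  have e2: "?E (\<lambda>R. exp (- s * X R)) \<le> ?E (\<lambda>R. exp (- s * count_in L A R))"
    using s by (intro pexp_mono p0 p1) (simp add: X_split count_in_nonneg mult_left_mono)
  have har: "?E (\<lambda>R. exp (- s * count_in K A (R \<union> A i))) * ?E (\<lambda>R. exp (- s * count_in L A R))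
      \<le> ?E (\<lambda>R. exp (- s * count_in K A (R \<union> A i)) * exp (- s * count_in L A R))"
    using s finKL
    by (intro harris finite_V p0 p1) (auto intro!: mult_left_mono count_in_mono)
  have "?E (\<lambda>R. of_bool (A i \<subseteq> R) * exp (- s * X R))
     = p ^ card (A i) * ?E (\<lambda>R. exp (- s * X (R \<union> A i)))"
    by (rule pexp_superset[OF finite_V A_sub[OF i]])
  also have "?E (\<lambda>R. exp (- s * X (R \<union> A i)))
      = ?E (\<lambda>R. exp (- s * count_in K A (R \<union> A i)) * exp (- s * count_in L A R))"
    by (simp only: X_split L_indep distrib_left exp_add)
  finally have eq: "?E (\<lambda>R. of_bool (A i \<subseteq> R) * exp (- s * X R)) = p ^ card (A i) *
     ?E (\<lambda>R. exp (- s * count_in K A (R \<union> A i)) * exp (- s * count_in L A R))" .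
  \<comment> \<open>The factor \<open>1 - s * ?E ...\<close> may be negative, so it is first
    replaced by the expectation above it; only then is the second factor enlarged.\<close>
  have "(1 - s * ?E (\<lambda>R. count_in K A (R \<union> A i))) * ?E (\<lambda>R. exp (- s * X R))
     \<le> ?E (\<lambda>R. exp (- s * count_in K A (R \<union> A i))) * ?E (\<lambda>R. exp (- s * X R))"
    using e1 Epos by (rule mult_right_mono)
  also have "\<dots> \<le> ?E (\<lambda>R. exp (- s * count_in K A (R \<union> A i))) * ?E (\<lambda>R. exp (- s * count_in L A R))"
    by (intro mult_left_mono e2 pexp_nonneg p0 p1) auto
  also note har
  finally have "p ^ card (A i) * ((1 - s * ?E (\<lambda>R. count_in K A (R \<union> A i))) * ?E (\<lambda>R. exp (- s * X R)))
     \<le> ?E (\<lambda>R. of_bool (A i \<subseteq> R) * exp (- s * X R))"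
    unfolding eq using p0 by (intro mult_left_mono) auto
  then show ?thesis unfolding mean[symmetric] by (simp add: algebra_simps)
qed

text \<open>
  The Laplace transform \<open>f\<close> satisfies \<open>f' s \<le> - (mu - s * D) * f s\<close> by Harris' inequality; integrate this.
\<close>

lemma janson_mgf:
  assumes s: "0 \<le> s"
  shows "pexp p V (\<lambda>R. exp (- s * X R)) \<le> exp (- s * mu + s\<^sup>2 * D / 2)"
proof -
  define f where "f = (\<lambda>s. pexp p V (\<lambda>R. exp (- s * X R)))"
  define g where "g = (\<lambda>s. f s * exp (s * mu - s\<^sup>2 * D / 2))"
  define f' where "f' = (\<lambda>s. - pexp p V (\<lambda>R. X R * exp (- s * X R)))"
  have f_deriv: "(f has_real_derivative f' s) (at s)" for s
    unfolding f_def f'_def pexp_def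
    by (auto intro!: derivative_eq_intros simp: sum_negf[symmetric] mult_ac intro!: sum.cong)
  have f'_le: "f' u \<le> - (mu - u * D) * f u" if "0 \<le> u" for u
  proof -
    have "(mu - u * D) * f u = (\<Sum>i\<in>I. (p ^ card (A i) - u * (\<Sum>j\<in>I. of_bool (A i \<inter> A j \<noteq> {}) * p ^ card (A i \<union> A j)))
         * pexp p V (\<lambda>R. exp (- u * X R)))"
      unfolding mu_def overlap_def f_def
      by (simp add: sum_distrib_left sum_distrib_right sum_subtractf left_diff_distrib)
    also have "\<dots> \<le> (\<Sum>i\<in>I. pexp p V (\<lambda>R. of_bool (A i \<subseteq> R) * exp (- u * X R)))"
      by (intro sum_mono janson_term that)
    also have "\<dots> = pexp p V (\<lambda>R. X R * exp (- u * X R))"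
      unfolding pexp_sum[symmetric] by (simp add: count_in_def sum_distrib_right)
    finally show ?thesis unfolding f'_def by (simp add: algebra_simps)
  qed
  have "g s \<le> g 0"
  proof (rule DERIV_nonpos_imp_nonincreasing[OF s])
    fix u assume u: "0 \<le> u" "u \<le> s"
    have "(g has_real_derivative (f' u + (mu - u * D) * f u) * exp (u * mu - u\<^sup>2 * D / 2)) (at u)"
      unfolding g_def
      by (auto intro!: derivative_eq_intros f_deriv simp: algebra_simps)
    moreover have "(f' u + (mu - u * D) * f u) * exp (u * mu - u\<^sup>2 * D / 2) \<le> 0"
      using f'_le[OF u(1)] by (intro mult_nonpos_nonneg) (auto simp: algebra_simps)
    ultimately show "\<exists>y. (g has_real_derivative y) (at u) \<and> y \<le> 0" by blast
  qed
  moreover have "g 0 = 1" by (simp add: g_def f_def pexp_const finite_V)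
  ultimately have "f s * exp (s * mu - s\<^sup>2 * D / 2) \<le> 1" by (simp add: g_def)
  then have "f s \<le> inverse (exp (s * mu - s\<^sup>2 * D / 2))"
    by (simp add: field_simps)
  then show ?thesis by (simp add: f_def exp_minus[symmetric])
qed

text \<open>Exponential Markov inequality at \<open>s = t / D'\<close>, the minimiser of
  \<open>- s * t + s\<^sup>2 * D' / 2\<close>. Callers supply a positive estimate \<open>D'\<close>,
  as the overlap itself may vanish.\<close>

lemma janson:
  assumes t: "0 \<le> t" and D: "0 < D'" "D \<le> D'"
  shows "pexp p V (\<lambda>R. of_bool (X R \<le> mu - t)) \<le> exp (- (t\<^sup>2 / (2 * D')))"
proof -
  define s where "s = t / D'"
  have s: "0 \<le> s" using t D by (simp add: s_def)
  have "pexp p V (\<lambda>R. of_bool (X R \<le> mu - t)) \<le> pexp p V (\<lambda>R. exp (s * (mu - t)) * exp (- s * X R))"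
  proof (intro pexp_mono p0 p1)
    fix R assume "R \<subseteq> V"
    show "of_bool (X R \<le> mu - t) \<le> exp (s * (mu - t)) * exp (- s * X R)"
      using s by (auto simp: exp_add[symmetric] right_diff_distrib[symmetric] intro!: mult_nonneg_nonneg)
  qed
  also have "\<dots> = exp (s * (mu - t)) * pexp p V (\<lambda>R. exp (- s * X R))"
    by (rule pexp_cmult)
  also have "\<dots> \<le> exp (s * (mu - t)) * exp (- s * mu + s\<^sup>2 * D / 2)"
    by (intro mult_left_mono janson_mgf s) auto
  also have "\<dots> \<le> exp (s * (mu - t)) * exp (- s * mu + s\<^sup>2 * D' / 2)"
    using D by (auto intro!: mult_left_mono divide_right_mono)
  also have "\<dots> = exp (- (t\<^sup>2 / (2 * D')))"
    unfolding exp_add[symmetric] using D by (simp add: s_def power2_eq_square field_simps)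
  finally show ?thesis .
qed

text \<open>Disjoint sets are independent and their covariance cancels; for the other pairs the
  subtracted product is dropped.\<close>

lemma variance_le: "pexp p V (\<lambda>R. (X R - mu)\<^sup>2) \<le> D"
proof -
  have sq: "pexp p V (\<lambda>R. X R * X R) = (\<Sum>i\<in>I. \<Sum>j\<in>I. p ^ card (A i \<union> A j))"
  proof -
    have "pexp p V (\<lambda>R. X R * X R) = pexp p V (\<lambda>R. \<Sum>i\<in>I. \<Sum>j\<in>I. of_bool (A i \<union> A j \<subseteq> R))"
      unfolding count_in_def sum_product by (intro pexp_cong sum.cong) auto
    also have "\<dots> = (\<Sum>i\<in>I. \<Sum>j\<in>I. p ^ card (A i \<union> A j))"
      unfolding pexp_sum using A_sub
      by (intro sum.cong refl pexp_superset_prob finite_V) auto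
    finally show ?thesis .
  qed
  have "pexp p V (\<lambda>R. (X R - mu)\<^sup>2) = pexp p V (\<lambda>R. X R * X R + ((- 2 * mu) * X R + mu * mu))"
    by (intro pexp_cong) (simp add: power2_eq_square algebra_simps)
  also have "\<dots> = pexp p V (\<lambda>R. X R * X R) - mu * mu"
    by (simp add: pexp_add pexp_cmult[of _ _ "- 2 * mu", simplified] pexp_const[OF finite_V] pexp_X pexp_diff pexp_cmult)
  also have "\<dots> = (\<Sum>i\<in>I. \<Sum>j\<in>I. p ^ card (A i \<union> A j) - p ^ card (A i) * p ^ card (A j))"
    unfolding sq mu_def by (simp add: sum_product sum_subtractf)
  also have "\<dots> \<le> D"
    unfolding overlap_def
  proof (intro sum_mono)
    fix i j assume ij: "i \<in> I" "j \<in> I"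
    show "p ^ card (A i \<union> A j) - p ^ card (A i) * p ^ card (A j)
       \<le> of_bool (A i \<inter> A j \<noteq> {}) * p ^ card (A i \<union> A j)"
    proof (cases "A i \<inter> A j = {}")
      case True
      then show ?thesis using ij by (simp add: card_Un_disjoint finite_A power_add)
    next
      case False
      then show ?thesis using p0 by simp
    qed
  qed
  finally show ?thesis .
qed

lemma chebyshev:
  assumes "0 < t"
  shows "pexp p V (\<lambda>R. of_bool (t \<le> \<bar>X R - mu\<bar>)) \<le> D / t\<^sup>2"
proof -
  have "pexp p V (\<lambda>R. of_bool (t \<le> \<bar>X R - mu\<bar>)) \<le> pexp p V (\<lambda>R. (1 / t\<^sup>2) * (X R - mu)\<^sup>2)"
  proof (intro pexp_mono p0 p1)
    fix R assume "R \<subseteq> V"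
    have "1 \<le> (X R - mu)\<^sup>2 / t\<^sup>2" if "t \<le> \<bar>X R - mu\<bar>"
      using that assms power_mono[of t "\<bar>X R - mu\<bar>" 2] by simp
    then show "of_bool (t \<le> \<bar>X R - mu\<bar>) \<le> (1 / t\<^sup>2) * (X R - mu)\<^sup>2" by auto
  qed
  also have "\<dots> \<le> (1 / t\<^sup>2) * D"
    unfolding pexp_cmult by (intro mult_left_mono variance_le) auto
  finally show ?thesis by simp
qed

end

lemma markov_pexp:
  assumes "finite V" "0 \<le> p" "p \<le> 1" "0 < t" "\<And>R. R \<subseteq> V \<Longrightarrow> 0 \<le> f R"
  shows "pexp p V (\<lambda>R. of_bool (t \<le> f R)) \<le> pexp p V f / t"
proof -
  have "pexp p V (\<lambda>R. of_bool (t \<le> f R)) \<le> pexp p V (\<lambda>R. (1 / t) * f R)"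
    using assms by (intro pexp_mono) auto
  then show ?thesis by (simp add: pexp_cmult[of p V "1/t" f, simplified])
qed

text \<open>The bridge from the random graph to finite sums: afterwards only \<open>pexp\<close>
  over sets of pairs is used.\<close>

lemma prob_binomial_random_graph:
  assumes "0 \<le> p" "p \<le> 1"
  shows "measure_pmf.prob (binomial_random_graph n p) {G. Q G}
     = pexp p (all_pairs {..<n}) (\<lambda>R. of_bool (Q ({..<n}, R)))"
proof -
  define V where "V = all_pairs {..<n}"
  have finV: "finite V"
    unfolding V_def all_pairs_def by (rule finite_subset[of _ "Pow {..<n}"]) auto
  \<comment> \<open>General in \<open>V\<close> and \<open>f\<close>, since removing one pair from
    \<open>V\<close> changes both.\<close>
  have gen: "measure_pmf.expectation (Pi_pmf V False (\<lambda>_. bernoulli_pmf p)) (\<lambda>b. f {e \<in> V. b e})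
      = pexp p V f" if "finite V" for V :: "nat set set" and f :: "nat set set \<Rightarrow> real"
    using that
  proof (induction V arbitrary: f rule: finite_induct)
    case empty
    then show ?case by simp
  next
    case (insert v V)
    have fin: "finite (set_pmf (Pi_pmf V False (\<lambda>_. bernoulli_pmf p)))"
      using insert.hyps by (intro finite_subset[OF set_Pi_pmf_subset'])
        (auto intro!: finite_PiE_dflt)
    have s1: "measure_pmf.expectation (Pi_pmf V False (\<lambda>_. bernoulli_pmf p))
         (\<lambda>b. f {e \<in> insert v V. (b(v := x)) e})
       = pexp p V (\<lambda>R. f (if x then insert v R else R))" for x
    proof -
      have "{e \<in> insert v V. (b(v := x)) e} = (if x then insert v {e\<in>V. b e} else {e\<in>V. b e})" for b
        using insert.hyps by auto
      then show ?thesis using insert.IH[of "\<lambda>R. f (if x then insert v R else R)"] by simp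
    qed
    have "measure_pmf.expectation (Pi_pmf (insert v V) False (\<lambda>_. bernoulli_pmf p)) (\<lambda>b. f {e \<in> insert v V. b e})
      = measure_pmf.expectation (bernoulli_pmf p) (\<lambda>x. measure_pmf.expectation (Pi_pmf V False (\<lambda>_. bernoulli_pmf p))
         (\<lambda>b. f {e \<in> insert v V. (b(v := x)) e}))"
      using insert.hyps fin
      by (simp add: Pi_pmf_insert' pmf_expectation_bind[where A = UNIV] integral_map_pmf map_pmf_def[symmetric]
           integral_measure_pmf[where A = UNIV and M = "bernoulli_pmf p"])
    also have "\<dots> = pexp p (insert v V) f"
      unfolding s1 pexp_insert[OF insert.hyps] using assms by (simp add: algebra_simps)
    finally show ?case .
  qed
  have "measure_pmf.prob (binomial_random_graph n p) {G. Q G}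
    = measure_pmf.prob (Pi_pmf V False (\<lambda>_. bernoulli_pmf p)) {b. Q ({..<n}, {e \<in> V. b e})}"
    unfolding binomial_random_graph_def V_def by (simp add: vimage_def)
  also have "\<dots> = measure_pmf.expectation (Pi_pmf V False (\<lambda>_. bernoulli_pmf p)) (\<lambda>b. of_bool (Q ({..<n}, {e \<in> V. b e})))"
    by (subst Bochner_Integration.integral_cong[OF refl, of _ _ "indicator {b. Q ({..<n}, {e \<in> V. b e})}"])
       (auto simp: indicator_def)
  also have "\<dots> = pexp p V (\<lambda>R. of_bool (Q ({..<n}, R)))"
    by (rule gen[OF finV])
  finally show ?thesis unfolding V_def .
qed

section \<open>Hypergraph containers from the hard-core model\<close>

text \<open>
  The partition function at activity \<open>t\<close> of the sets \<open>J \<subseteq> C\<close> that keep \<open>J \<union> S\<close> independent.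
\<close>

definition hard_core_sum :: "('a set \<Rightarrow> bool) \<Rightarrow> real \<Rightarrow> 'a set \<Rightarrow> 'a set \<Rightarrow> real" where
  "hard_core_sum ind t C S = (\<Sum>J | J \<subseteq> C \<and> ind (J \<union> S). t ^ card J)"

locale down_closed =
  fixes ind :: "'a set \<Rightarrow> bool"
  assumes down: "\<And>I J. ind I \<Longrightarrow> J \<subseteq> I \<Longrightarrow> ind J"
begin

abbreviation "Z \<equiv> hard_core_sum ind"

lemma Z_ge_1:
  assumes "finite C" "ind S" "0 \<le> t"
  shows "1 \<le> Z t C S"
proof -
  have "(\<Sum>J\<in>{{} :: 'a set}. t ^ card J) \<le> Z t C S"
    unfolding hard_core_sum_def using assms by (intro sum_mono2) (auto intro: finite_subset[of _ "Pow C"])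
  then show ?thesis by simp
qed

lemma Z_mono:
  assumes "finite C" "C' \<subseteq> C" "S \<subseteq> S'" "0 \<le> t"
  shows "Z t C' S' \<le> Z t C S"
  unfolding hard_core_sum_def
proof (intro sum_mono2)
  show "{J. J \<subseteq> C' \<and> ind (J \<union> S')} \<subseteq> {J. J \<subseteq> C \<and> ind (J \<union> S)}"
    using assms by (auto intro: down)
qed (use assms in \<open>auto intro: finite_subset[of _ "Pow C"]\<close>)

lemma Z_le_exp:
  assumes "finite C" "0 \<le> t"
  shows "Z t C S \<le> exp (t * card C)"
proof -
  have "Z t C S \<le> (\<Sum>J\<in>Pow C. t ^ card J)"
    unfolding hard_core_sum_def using assms by (intro sum_mono2) auto
  also have "\<dots> = (1 + t) ^ card C"
    using assms(1)
  proof (induction C rule: finite_induct)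
    case (insert v C)
    have "inj_on (insert v) (Pow C)" "Pow C \<inter> insert v ` Pow C = {}"
      using insert.hyps by (auto simp: inj_on_def)
    moreover have tt: "t ^ card (insert v J) = t * t ^ card J" if "J \<in> Pow C" for J
      using that insert.hyps finite_subset[of J C] by (subst card_insert_disjoint) auto
    moreover from tt have "(\<Sum>J\<in>Pow C. t ^ card (insert v J)) = t * (\<Sum>J\<in>Pow C. t ^ card J)"
      unfolding sum_distrib_left by (intro sum.cong) auto
    ultimately show ?case unfolding Pow_insert using insert
      by (subst sum.union_disjoint) (auto simp: sum.reindex algebra_simps)
  qed simp
  also have "\<dots> \<le> exp t ^ card C"
    using assms(2) by (intro power_mono exp_ge_add_one_self) auto
  also have "\<dots> = exp (t * card C)"
    by (simp add: exp_of_nat2_mult)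
  finally show ?thesis .
qed

text \<open>\<open>t * Z t (C - {v}) (insert v S)\<close> is the total weight of the sets containing
  \<open>v\<close>. Summing over \<open>v\<close> counts each set with its size, so both sides equal
  t times the derivative of the partition function in t.\<close>

lemma Z_marginals:
  fixes t :: real
  assumes "finite C"
  shows "(\<Sum>v\<in>C. t * Z t (C - {v}) (insert v S)) = (\<Sum>J | J \<subseteq> C \<and> ind (J \<union> S). real (card J) * t ^ card J)"
proof -
  let ?F = "{J. J \<subseteq> C \<and> ind (J \<union> S)}"
  have fin: "finite ?F" using assms by (auto intro: finite_subset[of _ "Pow C"])
  have 1: "t * Z t (C - {v}) (insert v S) = (\<Sum>J\<in>?F. of_bool (v \<in> J) * t ^ card J)" if v: "v \<in> C" for v
  proof -
    have e1: "J - {v} \<union> insert v S = J \<union> S" if "v \<in> J" for J using that by auto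
    have e2: "insert v J \<union> S = J \<union> insert v S" for J by auto
    have bij: "bij_betw (insert v) {J. J \<subseteq> C - {v} \<and> ind (J \<union> insert v S)} {J \<in> ?F. v \<in> J}"
      by (rule bij_betw_byWitness[where f' = "\<lambda>J. J - {v}"]) (use v e1 e2 in auto)
    have "(\<Sum>J\<in>?F. of_bool (v \<in> J) * t ^ card J) = (\<Sum>J\<in>{J \<in> ?F. v \<in> J}. t ^ card J)"
      by (intro sum.mono_neutral_cong_right) (use fin in auto)
    also have "\<dots> = (\<Sum>J | J \<subseteq> C - {v} \<and> ind (J \<union> insert v S). t ^ card (insert v J))"
      by (rule sum.reindex_bij_betw[OF bij, symmetric])
    also have "\<dots> = (\<Sum>J | J \<subseteq> C - {v} \<and> ind (J \<union> insert v S). t * t ^ card J)"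
    proof (intro sum.cong refl)
      fix J assume "J \<in> {J. J \<subseteq> C - {v} \<and> ind (J \<union> insert v S)}"
      then have "finite J" "v \<notin> J" using assms finite_subset[of J "C - {v}"] by auto
      then show "t ^ card (insert v J) = t * t ^ card J" by simp
    qed
    finally show ?thesis by (simp add: hard_core_sum_def sum_distrib_left)
  qed
  have "(\<Sum>v\<in>C. t * Z t (C - {v}) (insert v S)) = (\<Sum>J\<in>?F. \<Sum>v\<in>C. of_bool (v \<in> J) * t ^ card J)"
    by (simp add: 1 sum.swap[of _ ?F C] cong: sum.cong)
  also have "\<dots> = (\<Sum>J\<in>?F. real (card J) * t ^ card J)"
  proof (intro sum.cong refl)
    fix J assume J: "J \<in> ?F"
    then have "C \<inter> J = J" by auto
    then show "(\<Sum>v\<in>C. of_bool (v \<in> J) * t ^ card J) = real (card J) * t ^ card J"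
      using assms by (simp add: of_bool_def sum_distrib_right[symmetric] sum.If_cases Int_def)
  qed
  finally show ?thesis .
qed

text \<open>
  Convexity of \<open>ln Z\<close> in \<open>ln t\<close>: if all marginals of the hard-core measure at \<open>t\<close> are nearly
  maximal, then \<open>Z\<close> grows nearly as fast as it would without any constraint.
\<close>

lemma Z_growth:
  fixes c d t :: real
  assumes fin: "finite C" and "ind S" and t: "0 < t" and c: "1 < c"
    and marg: "\<And>v. v \<in> C \<Longrightarrow> (1 - d) * Z t C S \<le> Z t (C - {v}) (insert v S)"
  shows "ln (Z t C S) + ln c * ((1 - d) * t * card C) \<le> ln (Z (c * t) C S)"
proof -
  let ?F = "{J. J \<subseteq> C \<and> ind (J \<union> S)}"
  have finF: "finite ?F" using fin by (auto intro: finite_subset[of _ "Pow C"])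
  have Z1: "1 \<le> Z t C S" using fin assms(2) t by (intro Z_ge_1) auto
  define a where "a = (\<Sum>J\<in>?F. real (card J) * t ^ card J) / Z t C S"
  have "(\<Sum>v\<in>C. t * ((1 - d) * Z t C S)) \<le> (\<Sum>v\<in>C. t * Z t (C - {v}) (insert v S))"
    using t marg by (intro sum_mono mult_left_mono) auto
  then have "(1 - d) * t * card C * Z t C S \<le> (\<Sum>J\<in>?F. real (card J) * t ^ card J)"
    using Z_marginals[OF fin, of t S] by (simp add: mult_ac)
  then have a: "(1 - d) * t * card C \<le> a"
    using Z1 by (simp add: a_def field_simps)
  \<comment> \<open>Jensen's inequality for the hard-core measure at \<open>t\<close>, under which
    \<open>a\<close> is the mean of |J|: the mean of c^|J| is at least c^a. It is obtained from the
    tangent of the exponential at \<open>a\<close>, whose linear term averages to zero.\<close>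
  have "exp (ln c * a) * Z t C S = (\<Sum>J\<in>?F. t ^ card J * (exp (ln c * a) * (1 + ln c * (card J - a))))"
  proof -
    have "(\<Sum>J\<in>?F. t ^ card J * (exp (ln c * a) * (1 + ln c * (card J - a))))
       = exp (ln c * a) * (\<Sum>J\<in>?F. (1 - ln c * a) * t ^ card J + ln c * (real (card J) * t ^ card J))"
      by (simp add: sum_distrib_left algebra_simps)
    also have "\<dots> = exp (ln c * a) * ((1 - ln c * a) * Z t C S + ln c * (a * Z t C S))"
      using Z1 by (simp add: sum.distrib sum_distrib_left[symmetric] hard_core_sum_def a_def)
    finally show ?thesis by (simp add: algebra_simps)
  qed
  also have "\<dots> \<le> (\<Sum>J\<in>?F. (c * t) ^ card J)"
  proof (intro sum_mono)
    fix J
    have "exp (ln c * a) * (1 + ln c * (card J - a)) \<le> exp (ln c * a) * exp (ln c * (card J - a))"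
      by (intro mult_left_mono exp_ge_add_one_self) auto
    also have "\<dots> = exp (ln c * card J)" by (simp add: exp_add[symmetric] algebra_simps)
    also have "\<dots> = c ^ card J" using c by (simp add: exp_of_nat2_mult)
    finally show "t ^ card J * (exp (ln c * a) * (1 + ln c * (card J - a))) \<le> (c * t) ^ card J"
      using t by (simp add: power_mult_distrib mult.commute mult_left_mono)
  qed
  finally have "exp (ln c * a) * Z t C S \<le> Z (c * t) C S" by (simp add: hard_core_sum_def)
  moreover have "0 < exp (ln c * a) * Z t C S" using Z1 by simp
  ultimately have "ln (exp (ln c * a) * Z t C S) \<le> ln (Z (c * t) C S)" by simp
  then have "ln c * a + ln (Z t C S) \<le> ln (Z (c * t) C S)" using Z1 by (subst (asm) ln_mult) auto
  moreover have "ln c * ((1 - d) * t * card C) \<le> ln c * a" using a c by (intro mult_left_mono) auto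
  ultimately show ?thesis by simp
qed

text \<open>Telescoping \<open>Z_growth\<close> along the activities \<open>lam / c ^ k\<close>. The
  geometric sum replaces an integral over all activities up to \<open>lam\<close>, so control of
  finitely many marginals suffices, and the constant approaches 1 as c tends to 1, M grows and d
  tends to 0.\<close>

lemma Z_lower:
  fixes lam c d :: real
  assumes fin: "finite C" and S: "ind S" and lam: "0 < lam" and c: "1 < c" and d: "d \<le> 1"
    and marg: "\<And>v k. v \<in> C \<Longrightarrow> k \<in> {1..M} \<Longrightarrow>
        (1 - d) * Z (lam / c ^ k) C S \<le> Z (lam / c ^ k) (C - {v}) (insert v S)"
  shows "(1 - d) * (ln c / (c - 1)) * (1 - 1 / c ^ M) * (lam * card C) \<le> ln (Z lam C S)"
proof -
  have tel: "ln c * (1 - d) * card C * (\<Sum>k=1..m. lam / c ^ k) \<le> ln (Z lam C S) - ln (Z (lam / c ^ m) C S)"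
    if "m \<le> M" for m
    using that
  proof (induction m)
    case (Suc m)
    have "ln (Z (lam / c ^ Suc m) C S) + ln c * ((1 - d) * (lam / c ^ Suc m) * card C)
       \<le> ln (Z (c * (lam / c ^ Suc m)) C S)"
      using Suc.prems lam c by (intro Z_growth[OF fin S] marg) auto
    moreover have "c * (lam / c ^ Suc m) = lam / c ^ m" using c by simp
    moreover have "ln c * (1 - d) * card C * (\<Sum>k=1..Suc m. lam / c ^ k)
      = ln c * (1 - d) * card C * (\<Sum>k=1..m. lam / c ^ k) + ln c * ((1 - d) * (lam / c ^ Suc m) * card C)"
      by (simp add: distrib_left)
    ultimately show ?case using Suc.IH Suc.prems by simp
  qed simp
  have geo: "(\<Sum>k=1..m. lam / c ^ k) = lam * (1 - 1 / c ^ m) / (c - 1)" for m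
  proof (induction m)
    case (Suc m)
    have "(\<Sum>k=1..Suc m. lam / c ^ k) = lam * (1 - 1 / c ^ m) / (c - 1) + lam / c ^ Suc m"
      using Suc.IH by simp
    also have "\<dots> = lam * (1 - 1 / c ^ Suc m) / (c - 1)"
      using c by (simp add: field_simps)
    finally show ?case .
  qed simp
  have "0 \<le> ln (Z (lam / c ^ M) C S)"
    using lam c by (intro ln_ge_zero Z_ge_1 fin S) auto
  then show ?thesis using tel[of M] unfolding geo by (simp add: mult_ac)
qed

text \<open>
  As long as some \<open>v \<in> C\<close> has a small marginal at one of the activities \<open>t k\<close>, ask whether
  \<open>v \<in> I\<close>; a positive answer moves \<open>v\<close> to the fingerprint and decreases the potential
  \<open>\<Sum>k\<in>K. ln (Z (t k) C S)\<close> by at least \<open>d\<close>, a negative one deletes \<open>v\<close> from \<open>C\<close>.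
\<close>

lemma container_algorithm:
  fixes d :: real and t :: "'k \<Rightarrow> real"
  assumes "finite C" and K: "finite K" and d: "0 < d" "d < 1" and tpos: "\<And>k. k \<in> K \<Longrightarrow> 0 \<le> t k"
  shows "\<exists>f. \<forall>I. ind I \<and> S \<subseteq> I \<and> I \<subseteq> C \<union> S \<longrightarrow>
     (\<exists>S'. S \<subseteq> S' \<and> S' \<subseteq> I \<and> I \<subseteq> f S' \<union> S' \<and> f S' \<subseteq> C \<and>
        d * card (S' - S) \<le> (\<Sum>k\<in>K. ln (Z (t k) C S)) \<and>
        (\<forall>v\<in>f S'. \<forall>k\<in>K. (1 - d) * Z (t k) (f S') S' \<le> Z (t k) (f S' - {v}) (insert v S')))"
  using assms(1)
proof (induction "card C" arbitrary: C S rule: less_induct)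
  case less
  note finC = less.prems
  show ?case
  proof (cases "\<forall>v\<in>C. \<forall>k\<in>K. (1 - d) * Z (t k) C S \<le> Z (t k) (C - {v}) (insert v S)")
    case True
    show ?thesis
    proof (intro exI[of _ "\<lambda>_. C"] allI impI, elim conjE)
      fix I assume I: "ind I" "S \<subseteq> I" "I \<subseteq> C \<union> S"
      then have "ind S" using down by blast
      then have "0 \<le> (\<Sum>k\<in>K. ln (Z (t k) C S))"
        using tpos finC by (intro sum_nonneg ln_ge_zero Z_ge_1) auto
      then show "\<exists>S'. S \<subseteq> S' \<and> S' \<subseteq> I \<and> I \<subseteq> C \<union> S' \<and> C \<subseteq> C \<and>
        d * card (S' - S) \<le> (\<Sum>k\<in>K. ln (Z (t k) C S)) \<and>
        (\<forall>v\<in>C. \<forall>k\<in>K. (1 - d) * Z (t k) C S' \<le> Z (t k) (C - {v}) (insert v S'))"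
        using I True by (intro exI[of _ S]) auto
    qed
  next
    case False
    then obtain v k where v: "v \<in> C" and k: "k \<in> K"
      and drop: "Z (t k) (C - {v}) (insert v S) < (1 - d) * Z (t k) C S" by force
    have smaller: "card (C - {v}) < card C" using v finC by (intro card_Diff1_less)
    have finC': "finite (C - {v})" using finC by simp
    from less.hyps[OF smaller finC', of "insert v S"]
    obtain f1 where f1: "\<forall>I. ind I \<and> insert v S \<subseteq> I \<and> I \<subseteq> (C - {v}) \<union> insert v S \<longrightarrow>
     (\<exists>S'. insert v S \<subseteq> S' \<and> S' \<subseteq> I \<and> I \<subseteq> f1 S' \<union> S' \<and> f1 S' \<subseteq> C - {v} \<and>
        d * card (S' - insert v S) \<le> (\<Sum>k\<in>K. ln (Z (t k) (C - {v}) (insert v S))) \<and>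
        (\<forall>w\<in>f1 S'. \<forall>k\<in>K. (1 - d) * Z (t k) (f1 S') S' \<le> Z (t k) (f1 S' - {w}) (insert w S')))"
      ..
    from less.hyps[OF smaller finC', of S]
    obtain f2 where f2: "\<forall>I. ind I \<and> S \<subseteq> I \<and> I \<subseteq> (C - {v}) \<union> S \<longrightarrow>
     (\<exists>S'. S \<subseteq> S' \<and> S' \<subseteq> I \<and> I \<subseteq> f2 S' \<union> S' \<and> f2 S' \<subseteq> C - {v} \<and>
        d * card (S' - S) \<le> (\<Sum>k\<in>K. ln (Z (t k) (C - {v}) S)) \<and>
        (\<forall>w\<in>f2 S'. \<forall>k\<in>K. (1 - d) * Z (t k) (f2 S') S' \<le> Z (t k) (f2 S' - {w}) (insert w S')))"
      ..
    show ?thesis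
    \<comment> \<open>The fingerprint alone reproduces the answer about \<open>v\<close>: a positive
      one puts \<open>v\<close> into \<open>S'\<close>, and after a negative one \<open>v\<close>
      never enters, because S' \<subseteq> I.\<close>
    proof (intro exI[of _ "\<lambda>S'. if v \<in> S' then f1 S' else f2 S'"] allI impI, elim conjE)
      fix I assume I: "ind I" "S \<subseteq> I" "I \<subseteq> C \<union> S"
      have Zpos: "1 \<le> Z (t l) C' S'" if "l \<in> K" "S' \<subseteq> I" "C' \<subseteq> C" for l C' S'
        using that tpos finC I down finite_subset by (intro Z_ge_1) auto
      show "\<exists>S'. S \<subseteq> S' \<and> S' \<subseteq> I \<and> I \<subseteq> (if v \<in> S' then f1 S' else f2 S') \<union> S' \<and>
        (if v \<in> S' then f1 S' else f2 S') \<subseteq> C \<and>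
        d * card (S' - S) \<le> (\<Sum>k\<in>K. ln (Z (t k) C S)) \<and>
        (\<forall>w\<in>if v \<in> S' then f1 S' else f2 S'. \<forall>k\<in>K.
           (1 - d) * Z (t k) (if v \<in> S' then f1 S' else f2 S') S'
             \<le> Z (t k) ((if v \<in> S' then f1 S' else f2 S') - {w}) (insert w S'))"
      proof (cases "v \<in> I")
        case True
        have pre: "ind I \<and> insert v S \<subseteq> I \<and> I \<subseteq> (C - {v}) \<union> insert v S"
          using I True by auto
        from f1[rule_format, OF pre] obtain S' where S': "insert v S \<subseteq> S'" "S' \<subseteq> I" "I \<subseteq> f1 S' \<union> S'" "f1 S' \<subseteq> C - {v}"
          "d * card (S' - insert v S) \<le> (\<Sum>k\<in>K. ln (Z (t k) (C - {v}) (insert v S)))"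
          "\<forall>w\<in>f1 S'. \<forall>k\<in>K. (1 - d) * Z (t k) (f1 S') S' \<le> Z (t k) (f1 S' - {w}) (insert w S')"
          by (elim exE conjE)
        have "S' - S \<subseteq> C" using S' I by auto
        then have finS: "finite (S' - S)" using finC finite_subset by blast
        have "S' - S \<subseteq> insert v (S' - insert v S)" by auto
        then have "card (S' - S) \<le> card (insert v (S' - insert v S))"
          using finS by (intro card_mono) (auto intro: finite_subset[of _ "S' - S"])
        also have "\<dots> \<le> Suc (card (S' - insert v S))" by (rule card_insert_le_m1) auto
        finally have card: "real (card (S' - S)) \<le> 1 + card (S' - insert v S)" by simp
        have "(\<Sum>l\<in>K. ln (Z (t l) (C - {v}) (insert v S)))
            \<le> (\<Sum>l\<in>K. ln (Z (t l) C S) - (if l = k then d else 0))"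
        proof (intro sum_mono)
          fix l assume l: "l \<in> K"
          have pos: "1 \<le> Z (t l) (C - {v}) (insert v S)" "1 \<le> Z (t l) C S"
            using S' I l by (auto intro!: Zpos)
          show "ln (Z (t l) (C - {v}) (insert v S)) \<le> ln (Z (t l) C S) - (if l = k then d else 0)"
          proof (cases "l = k")
            case True
            have "ln (Z (t k) (C - {v}) (insert v S)) \<le> ln ((1 - d) * Z (t k) C S)"
              using drop pos True d by (intro ln_mono) auto
            also have "\<dots> = ln (1 - d) + ln (Z (t k) C S)"
              using d pos True by (intro ln_mult_pos) auto
            also have "ln (1 - d) \<le> - d"
              using ln_le_minus_one[of "1 - d"] d by simp
            finally show ?thesis using True by simp
          next
            case False
            have "Z (t l) (C - {v}) (insert v S) \<le> Z (t l) C S"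
              using finC l tpos by (intro Z_mono) auto
            then show ?thesis using False pos by (simp add: ln_mono)
          qed
        qed
        also have "\<dots> = (\<Sum>l\<in>K. ln (Z (t l) C S)) - d"
          using K k by (simp add: sum_subtractf)
        finally have "d * card (S' - S) \<le> (\<Sum>k\<in>K. ln (Z (t k) C S))"
          using S'(5) mult_left_mono[OF card, of d] d by (simp add: algebra_simps)
        then show ?thesis using S' by (intro exI[of _ S']) auto
      next
        case False
        have pre: "ind I \<and> S \<subseteq> I \<and> I \<subseteq> (C - {v}) \<union> S"
          using I False by auto
        from f2[rule_format, OF pre] obtain S' where S': "S \<subseteq> S'" "S' \<subseteq> I" "I \<subseteq> f2 S' \<union> S'" "f2 S' \<subseteq> C - {v}"
          "d * card (S' - S) \<le> (\<Sum>k\<in>K. ln (Z (t k) (C - {v}) S))"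
          "\<forall>w\<in>f2 S'. \<forall>k\<in>K. (1 - d) * Z (t k) (f2 S') S' \<le> Z (t k) (f2 S' - {w}) (insert w S')"
          by (elim exE conjE)
        have "(\<Sum>k\<in>K. ln (Z (t k) (C - {v}) S)) \<le> (\<Sum>k\<in>K. ln (Z (t k) C S))"
        proof (intro sum_mono ln_mono)
          fix l assume l: "l \<in> K"
          show "Z (t l) (C - {v}) S \<le> Z (t l) C S" using finC l tpos by (intro Z_mono) auto
          show "0 < Z (t l) (C - {v}) S" using Zpos[OF l, of S "C - {v}"] I by auto
        qed
        moreover have "v \<notin> S'" using False S' by auto
        ultimately show ?thesis using S' by (intro exI[of _ S']) auto
      qed
    qed
  qed
qed

text \<open>\<open>lam\<close> is the odds of the inclusion probability
  \<open>lam / (1 + lam)\<close>. After normalisation the partition function is the probability that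
  a binomial subset is independent, a quantity that Janson's inequality bounds from above.\<close>

lemma Z_eq_prob:
  assumes "finite C" "0 \<le> lam"
  shows "Z lam C {} = (1 + lam) ^ card C * pexp (lam / (1 + lam)) C (\<lambda>R. of_bool (ind R))"
proof -
  have "(1 + lam) ^ card C * pexp (lam / (1 + lam)) C (\<lambda>R. of_bool (ind R))
     = (\<Sum>R\<in>Pow C. (if ind R then lam ^ card R else 0))"
    unfolding pexp_def sum_distrib_left
  proof (intro sum.cong refl)
    fix R assume "R \<in> Pow C"
    then have R: "card C = card R + card (C - R)"
      using assms(1) card_mono[of C R] finite_subset[of R C] by (simp add: card_Diff_subset)
    have "1 - lam / (1 + lam) = 1 / (1 + lam)" using assms by (simp add: field_simps)
    then show "(1 + lam) ^ card C * ((lam / (1 + lam)) ^ card R * (1 - lam / (1 + lam)) ^ card (C - R) * of_bool (ind R))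
       = (if ind R then lam ^ card R else 0)"
      using assms unfolding R by (simp add: power_add power_divide)
  qed
  also have "\<dots> = Z lam C {}"
    unfolding hard_core_sum_def using assms
    by (subst sum.inter_filter[symmetric]) (auto intro!: sum.cong)
  finally show ?thesis by simp
qed

end

section \<open>The container lemma\<close>

lemma container_parameters:
  fixes b :: real
  assumes "0 < b"
  shows "\<exists>c d M. 1 < c \<and> 0 < d \<and> d < 1 \<and> 1 - b \<le> (1 - d) * (ln c / (c - 1)) * (1 - 1 / c ^ M)"
proof -
  \<comment> \<open>With \<open>c = 1 + b'\<close>, \<open>d = b'\<close> and \<open>M\<close>
    large, each of the three factors is at least \<open>1 - b'\<close>, and their product at least
    \<open>1 - 3 * b'\<close>, hence at least \<open>1 - b\<close>.\<close>
  define b' where "b' = min (b / 3) (1 / 3)"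
  have b': "0 < b'" "b' < 1" "3 * b' \<le> b" using assms by (auto simp: b'_def)
  define c where "c = 1 + b'"
  have c: "1 < c" using b' by (simp add: c_def)
  have l1: "1 - b' \<le> ln c / (c - 1)"
  proof -
    have "ln (1 / c) \<le> 1 / c - 1" using c by (intro ln_le_minus_one) auto
    then have "1 - 1 / c \<le> ln c" using c by (simp add: ln_div)
    moreover have "(1 - b') * b' \<le> 1 - 1 / c" using b' by (simp add: c_def field_simps)
    ultimately have "(1 - b') * b' \<le> ln c" by linarith
    then show ?thesis using b' by (simp add: c_def pos_le_divide_eq)
  qed
  obtain M where M: "1 / b' < c ^ M" using real_arch_pow[OF c] by blast
  have l2: "1 - b' \<le> 1 - 1 / c ^ M" using M b' c by (simp add: field_simps)
  have "1 - 3 * b' \<le> (1 - b') * (1 - b') * (1 - b')"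
  proof -
    have "(1 - b') * (1 - b') * (1 - b') - (1 - 3 * b') = b' * b' * (3 - b')" by (simp add: algebra_simps)
    moreover have "0 \<le> b' * b' * (3 - b')" using b' by simp
    ultimately show ?thesis by linarith
  qed
  also have "\<dots> \<le> (1 - b') * (ln c / (c - 1)) * (1 - 1 / c ^ M)"
    using l1 l2 b' c by (intro mult_mono) (auto intro!: divide_nonneg_nonneg mult_nonneg_nonneg)
  finally show ?thesis using b' c by (intro exI[of _ c] exI[of _ b'] exI[of _ M]) auto
qed

text \<open>When the algorithm stops, the partition function on the container is at least exp((1 -
  b) lam |f S|), whereas the normalising constant is at most exp(lam |f S|). Their quotient bounds
  the probability of independence from below. \<open>K\<close> depends on \<open>b\<close> only,
  which keeps the fingerprints free of logarithms.\<close>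

lemma container_lemma:
  fixes b :: real
  assumes "0 < b"
  shows "\<exists>K::real. 0 < K \<and> (\<forall>(ind :: 'a set \<Rightarrow> bool) V (lam :: real). (\<forall>I J. ind I \<longrightarrow> J \<subseteq> I \<longrightarrow> ind J) \<and> finite V \<and> 0 < lam \<longrightarrow>
     (\<exists>f. \<forall>I. ind I \<and> I \<subseteq> V \<longrightarrow>
       (\<exists>S. S \<subseteq> I \<and> I \<subseteq> f S \<union> S \<and> f S \<subseteq> V \<and> card S \<le> K * lam * card V \<and>
          exp (- b * lam * card V) \<le> pexp (lam / (1 + lam)) (f S) (\<lambda>R. of_bool (ind R)))))"
proof -
  obtain c d M where cdM: "1 < c" "0 < d" "d < 1" "1 - b \<le> (1 - d) * (ln c / (c - 1)) * (1 - 1 / c ^ M)"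
    using container_parameters[OF assms] by blast
  \<comment> \<open>The potential starts at no more than M lam |V| and every fingerprint element
    costs \<open>d\<close>; the summand 1 keeps \<open>K\<close> positive even for
    \<open>M = 0\<close>.\<close>
  define K where "K = M / d + 1"
  have K: "0 < K" using cdM by (simp add: K_def add_pos_nonneg add_nonneg_pos)
  show ?thesis
  proof (intro exI[of _ K] conjI allI impI K, elim conjE)
    fix ind :: "'a set \<Rightarrow> bool" and V :: "'a set" and lam :: real
    assume dc: "\<forall>I J. ind I \<longrightarrow> J \<subseteq> I \<longrightarrow> ind J" and V: "finite V" and lam: "0 < (lam :: real)"
    interpret down_closed ind by unfold_locales (use dc in blast)
    have tpos: "0 \<le> lam / c ^ k" for k using lam cdM(1) by simp
    from container_algorithm[OF V finite_atLeastAtMost[of 1 M] cdM(2,3) tpos, of "{}" "\<lambda>k. k"]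
    obtain f where f: "\<forall>I. ind I \<and> {} \<subseteq> I \<and> I \<subseteq> V \<union> {} \<longrightarrow>
     (\<exists>S'. {} \<subseteq> S' \<and> S' \<subseteq> I \<and> I \<subseteq> f S' \<union> S' \<and> f S' \<subseteq> V \<and>
        d * card (S' - {}) \<le> (\<Sum>k\<in>{1..M}. ln (Z (lam / c ^ k) V {})) \<and>
        (\<forall>v\<in>f S'. \<forall>k\<in>{1..M}. (1 - d) * Z (lam / c ^ k) (f S') S' \<le> Z (lam / c ^ k) (f S' - {v}) (insert v S')))"
      ..
    show "\<exists>f. \<forall>I. ind I \<and> I \<subseteq> V \<longrightarrow>
       (\<exists>S. S \<subseteq> I \<and> I \<subseteq> f S \<union> S \<and> f S \<subseteq> V \<and> card S \<le> K * lam * card V \<and>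
          exp (- b * lam * card V) \<le> pexp (lam / (1 + lam)) (f S) (\<lambda>R. of_bool (ind R)))"
    proof (intro exI[of _ f] allI impI, elim conjE)
      fix I assume I: "ind I" "I \<subseteq> V"
      obtain S where S: "S \<subseteq> I" "I \<subseteq> f S \<union> S" "f S \<subseteq> V"
        "d * card S \<le> (\<Sum>k\<in>{1..M}. ln (Z (lam / c ^ k) V {}))"
        "\<And>v k. v\<in>f S \<Longrightarrow> k\<in>{1..M} \<Longrightarrow> (1 - d) * Z (lam / c ^ k) (f S) S \<le> Z (lam / c ^ k) (f S - {v}) (insert v S)"
        using f[rule_format, of I] I by auto
      have indS: "ind S" "ind {}" using S(1) I(1) down by blast+
      have finC: "finite (f S)" using S(3) V finite_subset by blast
      have "(\<Sum>k\<in>{1..M}. ln (Z (lam / c ^ k) V {})) \<le> (\<Sum>k\<in>{1..M}. lam * card V)"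
      proof (intro sum_mono)
        fix k
        have t0: "0 \<le> lam / c ^ k" using lam cdM by simp
        have 1: "ln (Z (lam / c ^ k) V {}) \<le> ln (exp (lam / c ^ k * card V))"
          using Z_le_exp[OF V t0, of "{}"] Z_ge_1[OF V indS(2) t0] by (intro ln_mono) auto
        have le: "lam / c ^ k \<le> lam"
          using lam cdM(1) one_le_power[of c k] by (simp add: divide_le_eq)
        have "ln (exp (lam / c ^ k * card V)) \<le> lam * card V"
          unfolding ln_exp by (intro mult_right_mono le) auto
        with 1 show "ln (Z (lam / c ^ k) V {}) \<le> lam * card V" by linarith
      qed
      then have "d * card S \<le> M * (lam * card V)" using S(4) by simp
      then have "card S \<le> M / d * (lam * card V)" using cdM by (simp add: field_simps)
      also have "\<dots> \<le> K * (lam * card V)"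
        using lam by (intro mult_right_mono) (auto simp: K_def)
      finally have size: "card S \<le> K * lam * card V" by (simp add: mult_ac)
      have "(1 - b) * (lam * card (f S)) \<le> (1 - d) * (ln c / (c - 1)) * (1 - 1 / c ^ M) * (lam * card (f S))"
        using lam cdM(4) by (intro mult_right_mono) auto
      also have "\<dots> \<le> ln (Z lam (f S) S)"
        using cdM lam S(5) by (intro Z_lower finC indS) auto
      \<comment> \<open>Forgetting the fingerprint enlarges the sum: independence of J \<union> S
        implies that of J.\<close>
      also have "\<dots> \<le> ln (Z lam (f S) {})"
        using Z_ge_1[OF finC indS(1), of lam] lam by (intro ln_mono Z_mono finC) auto
      finally have "exp ((1 - b) * (lam * card (f S))) \<le> exp (ln (Z lam (f S) {}))" by simp
      also have "\<dots> = Z lam (f S) {}"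
        using Z_ge_1[OF finC indS(2), of lam] lam by simp
      also have "\<dots> = (1 + lam) ^ card (f S) * pexp (lam / (1 + lam)) (f S) (\<lambda>R. of_bool (ind R))"
        using lam by (intro Z_eq_prob finC) auto
      also have "\<dots> \<le> exp (lam * card (f S)) * pexp (lam / (1 + lam)) (f S) (\<lambda>R. of_bool (ind R))"
      proof (intro mult_right_mono pexp_nonneg)
        have "(1 + lam) ^ card (f S) \<le> exp lam ^ card (f S)"
          using lam by (intro power_mono exp_ge_add_one_self) auto
        then show "(1 + lam) ^ card (f S) \<le> exp (lam * card (f S))" by (simp add: exp_of_nat2_mult)
      qed (use lam in auto)
      finally have "exp ((1 - b) * (lam * card (f S)) - lam * card (f S))
          \<le> pexp (lam / (1 + lam)) (f S) (\<lambda>R. of_bool (ind R))"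
        unfolding exp_diff by (simp add: pos_divide_le_eq mult.commute)
      moreover have "exp (- b * lam * card V) \<le> exp ((1 - b) * (lam * card (f S)) - lam * card (f S))"
        using card_mono[OF V S(3)] lam assms by (simp add: algebra_simps)
      ultimately have "exp (- b * lam * card V) \<le> pexp (lam / (1 + lam)) (f S) (\<lambda>R. of_bool (ind R))" by linarith
      then show "\<exists>S. S \<subseteq> I \<and> I \<subseteq> f S \<union> S \<and> f S \<subseteq> V \<and> card S \<le> K * lam * card V \<and>
          exp (- b * lam * card V) \<le> pexp (lam / (1 + lam)) (f S) (\<lambda>R. of_bool (ind R))"
        using S size by blast
    qed
  qed
qed

section \<open>Labelled copies\<close>

text \<open>Extensional functions, so that embeddings agreeing on \<open>verts T\<close> are equal
  and can be counted.\<close>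

definition emb :: "'b ugraph \<Rightarrow> 'a ugraph \<Rightarrow> ('b \<Rightarrow> 'a) set" where
  "emb T G = {\<phi> \<in> verts T \<rightarrow>\<^sub>E verts G. inj_on \<phi> (verts T) \<and> (\<forall>e\<in>edges T. \<phi> ` e \<in> edges G)}"

definition edge_image :: "'b ugraph \<Rightarrow> ('b \<Rightarrow> 'a) \<Rightarrow> 'a set set" where
  "edge_image T \<phi> = (\<lambda>e. \<phi> ` e) ` edges T"

definition auts :: "'b ugraph \<Rightarrow> ('b \<Rightarrow> 'b) set" where
  "auts T = {\<alpha> \<in> verts T \<rightarrow>\<^sub>E verts T. bij_betw \<alpha> (verts T) (verts T) \<and> edge_image T \<alpha> = edges T}"

lemma finite_all_pairs [simp]: "finite V \<Longrightarrow> finite (all_pairs V)"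
  unfolding all_pairs_def by (rule finite_subset[of _ "Pow V"]) auto

lemma simple_graphD:
  assumes "simple_graph G"
  shows "finite (verts G)" "finite (edges G)" "\<And>e. e \<in> edges G \<Longrightarrow> e \<subseteq> verts G"
    "\<And>e. e \<in> edges G \<Longrightarrow> card e = 2" "\<And>e. e \<in> edges G \<Longrightarrow> finite e"
    "edges G \<subseteq> Pow (verts G)"
proof -
  show 1: "finite (verts G)" and 2: "\<And>e. e \<in> edges G \<Longrightarrow> e \<subseteq> verts G"
    and 3: "\<And>e. e \<in> edges G \<Longrightarrow> card e = 2"
    using assms by (auto simp: simple_graph_def all_pairs_def)
  show "finite (edges G)"
    using 1 assms finite_all_pairs finite_subset by (auto simp: simple_graph_def)
  show "\<And>e. e \<in> edges G \<Longrightarrow> finite e" using 1 2 finite_subset by blast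
  show "edges G \<subseteq> Pow (verts G)" using 2 by blast
qed

lemma simple_complete [simp]: "simple_graph (complete_ugraph n)"
  by (simp add: simple_graph_def complete_ugraph_def)

lemma simple_spanning: "R \<subseteq> all_pairs {..<n::nat} \<Longrightarrow> simple_graph ({..<n}, R)"
  by (simp add: simple_graph_def)

lemma card_image_edge: "inj_on \<phi> V \<Longrightarrow> e \<subseteq> V \<Longrightarrow> card (\<phi> ` e) = card e"
  by (meson card_image inj_on_subset)

lemma embI:
  assumes "\<phi> \<in> extensional (verts T)" "inj_on \<phi> (verts T)" "\<phi> ` verts T \<subseteq> verts G" "edge_image T \<phi> \<subseteq> edges G"
  shows "\<phi> \<in> emb T G"
  using assms unfolding emb_def edge_image_def by (auto simp: PiE_iff)

lemma finite_emb: "simple_graph T \<Longrightarrow> finite (verts G) \<Longrightarrow> finite (emb T G)"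
  unfolding emb_def by (rule finite_subset[of _ "verts T \<rightarrow>\<^sub>E verts G"])
    (auto intro!: finite_PiE simp: simple_graphD(1))

lemma emb_mono: "verts G \<subseteq> verts G' \<Longrightarrow> edges G \<subseteq> edges G' \<Longrightarrow> emb T G \<subseteq> emb T G'"
  unfolding emb_def by (auto simp: PiE_iff)

lemma card_emb_le:
  assumes "simple_graph T" "finite (verts G)"
  shows "card (emb T G) \<le> card (verts G) ^ card (verts T)"
proof -
  have "card (emb T G) \<le> card (verts T \<rightarrow>\<^sub>E verts G)"
    unfolding emb_def using assms
    by (intro card_mono) (auto intro!: finite_PiE simp: simple_graphD(1))
  then show ?thesis using assms by (simp add: card_funcsetE simple_graphD(1))
qed

lemma inj_on_image_edges:
  assumes "simple_graph T" "inj_on \<phi> (verts T)"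
  shows "inj_on (\<lambda>e. \<phi> ` e) (edges T)"
  using assms simple_graphD(3)[OF assms(1)] by (intro inj_onI) (metis inj_on_image_eq_iff)

lemma card_edge_image:
  assumes "simple_graph T" "inj_on \<phi> (verts T)"
  shows "card (edge_image T \<phi>) = card (edges T)"
  unfolding edge_image_def by (rule card_image[OF inj_on_image_edges[OF assms]])

lemma edge_image_sub_pairs:
  assumes "simple_graph T" "\<phi> \<in> emb T (complete_ugraph n)"
  shows "edge_image T \<phi> \<subseteq> all_pairs {..<n}"
  using assms by (auto simp: edge_image_def emb_def complete_ugraph_def)

lemma emb_complete:
  assumes "simple_graph T"
  shows "emb T (complete_ugraph n) = {\<phi> \<in> verts T \<rightarrow>\<^sub>E {..<n}. inj_on \<phi> (verts T)}"
proof -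
  have "\<phi> ` e \<in> all_pairs {..<n}"
    if "\<phi> \<in> verts T \<rightarrow>\<^sub>E {..<n}" "inj_on \<phi> (verts T)" "e \<in> edges T" for \<phi> :: "'a \<Rightarrow> nat" and e
    using that simple_graphD[OF assms] card_image_edge[of \<phi> "verts T" e]
    by (fastforce simp: all_pairs_def PiE_iff)
  then show ?thesis by (auto simp: emb_def complete_ugraph_def)
qed

text \<open>Identifies the abstract count with the embeddings into a fixed graph intersected with
  \<open>R\<close>. The vertex set \<open>V\<close> is a parameter because an extremal graph need
  not be spanning.\<close>

lemma count_in_emb:
  assumes "simple_graph T" "G \<subseteq> all_pairs {..<n::nat}" "V \<subseteq> {..<n}"
  shows "count_in (emb T (V, G)) (edge_image T) R = card (emb T (V, G \<inter> R))"
proof -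
  have "finite (emb T (V, G))"
    using assms finite_subset by (intro finite_emb) auto
  moreover have "{\<phi> \<in> emb T (V, G). edge_image T \<phi> \<subseteq> R} = emb T (V, G \<inter> R)"
    by (auto simp: emb_def edge_image_def)
  ultimately show ?thesis by (simp add: count_in_card)
qed

section \<open>Copies as orbits of embeddings under automorphisms\<close>

lemma card_auts_pos:
  assumes "simple_graph T"
  shows "0 < card (auts T)"
proof -
  have "restrict id (verts T) \<in> auts T"
  proof -
    have "edge_image T (restrict id (verts T)) = (\<lambda>e. e) ` edges T"
      unfolding edge_image_def using simple_graphD(3)[OF assms]
      by (intro image_cong refl) (auto simp: image_restrict_eq)
    then show ?thesis by (auto simp: auts_def bij_betw_def inj_on_def)
  qed
  moreover have "finite (auts T)"
    unfolding auts_def using simple_graphD[OF assms] by (intro finite_Collect_conjI) (auto intro: finite_PiE)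
  ultimately show ?thesis by (auto simp: card_gt_0_iff)
qed

lemma copy_of_emb:
  assumes T: "simple_graph T" and "simple_graph G" and \<phi>: "\<phi> \<in> emb T G"
  shows "(\<phi> ` verts T, edge_image T \<phi>) \<in> copies T G"
proof -
  note sT = simple_graphD[OF T]
  have inj: "inj_on \<phi> (verts T)" using \<phi> by (simp add: emb_def)
  have sub: "subgraph (\<phi> ` verts T, edge_image T \<phi>) G"
    using \<phi> sT card_image_edge[OF inj]
    by (auto simp: subgraph_def simple_graph_def emb_def edge_image_def all_pairs_def PiE_iff)
  let ?g = "inv_into (verts T) \<phi>"
  have "bij_betw ?g (\<phi> ` verts T) (verts T)"
    using inj by (simp add: bij_betw_inv_into bij_betw_imageI)
  moreover have "edges T = (\<lambda>e. ?g ` e) ` edge_image T \<phi>"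
  proof -
    have "?g ` \<phi> ` e = e" if "e \<in> edges T" for e
      using inv_into_image_cancel[OF inj] sT(3)[OF that] by blast
    then show ?thesis by (auto simp: edge_image_def image_image)
  qed
  ultimately have "isomorphic (\<phi> ` verts T, edge_image T \<phi>) T"
    unfolding isomorphic_def by auto
  then show ?thesis using sub by (simp add: copies_def)
qed

lemma emb_of_copy:
  assumes T: "simple_graph T" and S: "S \<in> copies T G"
  obtains \<phi> where "\<phi> \<in> emb T G" "\<phi> ` verts T = verts S" "edge_image T \<phi> = edges S"
proof -
  from S have sub: "subgraph S G" and "isomorphic S T" by (auto simp: copies_def)
  then obtain f where f: "bij_betw f (verts S) (verts T)" "edges T = (\<lambda>e. f ` e) ` edges S"
    by (auto simp: isomorphic_def)
  have inj: "inj_on f (verts S)" and im: "f ` verts S = verts T" using f(1) by (auto simp: bij_betw_def)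
  have sS: "simple_graph S" using sub by (simp add: subgraph_def)
  define \<phi> where "\<phi> = restrict (inv_into (verts S) f) (verts T)"
  have b: "bij_betw \<phi> (verts T) (verts S)"
    unfolding \<phi>_def using bij_betw_inv_into[OF f(1)] by (simp cong: bij_betw_cong)
  have e: "\<phi> ` f ` e = e" if "e \<in> edges S" for e
  proof -
    have "f ` e \<subseteq> verts T" using simple_graphD(3)[OF sS that] im by auto
    then have "\<phi> ` f ` e = inv_into (verts S) f ` f ` e"
      by (intro image_cong refl) (auto simp: \<phi>_def)
    also have "\<dots> = e" using inv_into_image_cancel[OF inj simple_graphD(3)[OF sS that]] .
    finally show ?thesis .
  qed
  have ei: "edge_image T \<phi> = edges S"
    unfolding edge_image_def f(2) using e by (auto simp: image_image)
  have "\<phi> \<in> emb T G"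
    using b ei sub unfolding emb_def edge_image_def subgraph_def
    by (auto simp: PiE_iff bij_betw_def \<phi>_def extensional_def)
  with b ei show ?thesis by (intro that[of \<phi>]) (auto simp: bij_betw_def)
qed

text \<open>Two embeddings with the same image differ by an automorphism of \<open>T\<close> applied
  first: composing with \<open>f\<close>, and with its inverse, gives the bijection.\<close>

lemma emb_fibre_card:
  assumes T: "simple_graph T" and f: "f \<in> emb T G"
  shows "card {\<phi> \<in> emb T G. \<phi> ` verts T = f ` verts T \<and> edge_image T \<phi> = edge_image T f} = card (auts T)"
proof -
  let ?V = "verts T" and ?F = "{\<phi> \<in> emb T G. \<phi> ` verts T = f ` verts T \<and> edge_image T \<phi> = edge_image T f}"
  let ?g = "inv_into ?V f"
  note sT = simple_graphD[OF T]
  have inj: "inj_on f ?V" using f by (simp add: emb_def)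
  have comp: "edge_image T (restrict (h \<circ> \<alpha>) ?V) = (\<lambda>e. h ` e) ` edge_image T \<alpha>" for h :: "'d \<Rightarrow> 'e" and \<alpha>
  proof -
    have "restrict (h \<circ> \<alpha>) ?V ` e = h ` \<alpha> ` e" if "e \<in> edges T" for e
      using sT(3)[OF that] by (auto simp: image_image subset_iff)
    then show ?thesis by (auto simp: edge_image_def image_image)
  qed
  have "bij_betw (\<lambda>\<alpha>. restrict (f \<circ> \<alpha>) ?V) (auts T) ?F"
  proof (rule bij_betw_byWitness[where f' = "\<lambda>\<phi>. restrict (?g \<circ> \<phi>) ?V"])
    show "\<forall>\<alpha>\<in>auts T. restrict (?g \<circ> restrict (f \<circ> \<alpha>) ?V) ?V = \<alpha>"
    proof
      fix \<alpha> assume "\<alpha> \<in> auts T"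
      then have "\<alpha> \<in> ?V \<rightarrow>\<^sub>E ?V" by (simp add: auts_def)
      then show "restrict (?g \<circ> restrict (f \<circ> \<alpha>) ?V) ?V = \<alpha>"
        using inj by (auto simp: fun_eq_iff PiE_iff extensional_def restrict_def)
    qed
    show "\<forall>\<phi>\<in>?F. restrict (f \<circ> restrict (?g \<circ> \<phi>) ?V) ?V = \<phi>"
    proof
      fix \<phi> assume "\<phi> \<in> ?F"
      then have "\<phi> ` ?V = f ` ?V" "\<phi> \<in> extensional ?V" by (auto simp: emb_def PiE_iff)
      then show "restrict (f \<circ> restrict (?g \<circ> \<phi>) ?V) ?V = \<phi>"
        by (auto simp: fun_eq_iff extensional_def restrict_def intro!: f_inv_into_f)
    qed
    show "(\<lambda>\<alpha>. restrict (f \<circ> \<alpha>) ?V) ` auts T \<subseteq> ?F"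
    proof (intro image_subsetI CollectI conjI)
      fix \<alpha> assume \<alpha>: "\<alpha> \<in> auts T"
      then have b: "\<alpha> ` ?V = ?V" "inj_on \<alpha> ?V" and e: "edge_image T \<alpha> = edges T"
        by (auto simp: auts_def bij_betw_def)
      show v: "restrict (f \<circ> \<alpha>) ?V ` ?V = f ` ?V" 
      proof -
        have "restrict (f \<circ> \<alpha>) ?V ` ?V = f ` \<alpha> ` ?V" by auto
        then show ?thesis using b by simp
      qed
      show e': "edge_image T (restrict (f \<circ> \<alpha>) ?V) = edge_image T f"
        unfolding comp e by (simp add: edge_image_def)
      have "inj_on (restrict (f \<circ> \<alpha>) ?V) ?V"
        using b inj by (auto simp: inj_on_restrict_eq intro: comp_inj_on)
      moreover have "f ` ?V \<subseteq> verts G" "edge_image T f \<subseteq> edges G"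
        using f by (auto simp: emb_def edge_image_def)
      ultimately show "restrict (f \<circ> \<alpha>) ?V \<in> emb T G"
        by (intro embI) (simp_all only: v e' restrict_extensional)
    qed
    show "(\<lambda>\<phi>. restrict (?g \<circ> \<phi>) ?V) ` ?F \<subseteq> auts T"
    proof (intro image_subsetI)
      fix \<phi> assume \<phi>: "\<phi> \<in> ?F"
      have v: "?g ` \<phi> ` ?V = ?V" using \<phi> inj by simp
      have i: "inj_on \<phi> ?V" using \<phi> by (auto simp: emb_def)
      have "inj_on (?g \<circ> \<phi>) ?V"
        using \<phi> i by (intro comp_inj_on) (auto intro: inj_on_inv_into)
      then have "bij_betw (restrict (?g \<circ> \<phi>) ?V) ?V ?V"
        using v by (simp add: bij_betw_def image_comp)
      moreover have "edge_image T (restrict (?g \<circ> \<phi>) ?V) = edges T"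
      proof -
        have "edge_image T (restrict (?g \<circ> \<phi>) ?V) = (\<lambda>e. ?g ` e) ` edge_image T f"
          unfolding comp using \<phi> by simp
        also have "\<dots> = (\<lambda>e. e) ` edges T"
          unfolding edge_image_def image_image
          by (intro image_cong refl) (simp only: image_image[symmetric] inv_into_image_cancel[OF inj sT(3)])
        finally show ?thesis by simp
      qed
      ultimately show "restrict (?g \<circ> \<phi>) ?V \<in> auts T"
        unfolding auts_def by (intro CollectI conjI) (auto simp: bij_betw_def)
    qed
  qed
  from bij_betw_same_card[OF this] show ?thesis by simp
qed

lemma card_emb:
  assumes T: "simple_graph T" and G: "simple_graph G"
  shows "card (emb T G) = card (auts T) * num_copies T G"
proof -
  let ?img = "\<lambda>\<phi>. (\<phi> ` verts T, edge_image T \<phi>)"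
  have img: "?img ` emb T G = copies T G"
  proof
    show "?img ` emb T G \<subseteq> copies T G" using copy_of_emb[OF T G] by auto
    show "copies T G \<subseteq> ?img ` emb T G"
    proof
      fix S assume "S \<in> copies T G"
      from emb_of_copy[OF T this] obtain f
        where f: "f \<in> emb T G" "f ` verts T = verts S" "edge_image T f = edges S" .
      then show "S \<in> ?img ` emb T G" by (intro image_eqI[of _ _ f]) (simp_all add: prod_eq_iff)
    qed
  qed
  have fin: "finite (emb T G)" using T G by (intro finite_emb) (auto simp: simple_graphD(1))
  have "card (emb T G) = (\<Sum>\<phi>\<in>emb T G. 1)" by simp
  also have "\<dots> = (\<Sum>S\<in>copies T G. \<Sum>\<phi> | \<phi> \<in> emb T G \<and> ?img \<phi> = S. 1)"
    using sum.image_gen[OF fin, of "\<lambda>_. 1::nat" ?img] unfolding img .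
  also have "\<dots> = (\<Sum>S\<in>copies T G. card (auts T))"
  proof (intro sum.cong refl)
    fix S assume "S \<in> copies T G"
    from emb_of_copy[OF T this] obtain f where f: "f \<in> emb T G" "f ` verts T = verts S" "edge_image T f = edges S" .
    then have "{\<phi>. \<phi> \<in> emb T G \<and> ?img \<phi> = S}
       = {\<phi> \<in> emb T G. \<phi> ` verts T = f ` verts T \<and> edge_image T \<phi> = edge_image T f}" by auto
    then show "(\<Sum>\<phi> | \<phi> \<in> emb T G \<and> ?img \<phi> = S. 1) = card (auts T)"
      using emb_fibre_card[OF T f(1)] by simp
  qed
  finally show ?thesis by (simp add: num_copies_def)
qed

section \<open>Freeness and extremal numbers through embeddings\<close>

lemma free_of_iff:
  assumes "simple_graph H" "simple_graph G"
  shows "free_of H G \<longleftrightarrow> emb H G = {}"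
proof
  assume "free_of H G"
  then show "emb H G = {}" using copy_of_emb[OF assms] unfolding free_of_def by blast
next
  assume e: "emb H G = {}"
  have "S \<notin> copies H G" for S
  proof
    assume "S \<in> copies H G"
    from emb_of_copy[OF assms(1) this] obtain f where "f \<in> emb H G" .
    then show False using e by simp
  qed
  then show "free_of H G" unfolding free_of_def by blast
qed

lemma finite_ex_set:
  assumes "simple_graph G"
  shows "finite {num_copies T F |F. subgraph F G \<and> free_of H F}"
proof -
  have "{F. subgraph F G} \<subseteq> Pow (verts G) \<times> Pow (edges G)" by (auto simp: subgraph_def)
  moreover have "finite (Pow (verts G) \<times> Pow (edges G))" using simple_graphD[OF assms] by simp
  ultimately have "finite {F. subgraph F G}" by (rule finite_subset)
  then have "finite (num_copies T ` {F. subgraph F G})" by simp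
  then show ?thesis by (rule finite_subset[rotated]) auto
qed

lemma ex_in_ge:
  assumes "simple_graph G" "subgraph F G" "free_of H F"
  shows "num_copies T F \<le> ex_in G T H"
  unfolding ex_in_def by (intro Max_ge finite_ex_set) (use assms in blast)+

lemma ex_in_attained:
  assumes G: "simple_graph G" and H: "simple_graph H" "edges H \<noteq> {}"
  obtains F where "subgraph F G" "free_of H F" "num_copies T F = ex_in G T H"
proof -
  have "subgraph (verts G, {}) G" using G by (auto simp: subgraph_def simple_graph_def)
  moreover have "free_of H (verts G, {})"
    using G H by (subst free_of_iff) (auto simp: simple_graph_def emb_def)
  ultimately have "{num_copies T F |F. subgraph F G \<and> free_of H F} \<noteq> {}" by blast
  from Max_in[OF finite_ex_set[OF G] this] obtain F
    where "ex_in G T H = num_copies T F" "subgraph F G" "free_of H F"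
    unfolding ex_in_def by blast
  then show ?thesis using that by simp
qed

text \<open>If a copy of \<open>T\<close> and a copy of \<open>H\<close> have the vertices W and the
  edges F of \<open>T\<close> in common, the pair survives with probability p^(e_T + e_H - |F|), and
  there are of order n^(v_T + v_H - |W|) such pairs. Each type of intersection thus contributes the
  product of the two first moments divided by n^|W| p^|F|, which is at least
  \<open>D\<close>.\<close>

lemma overlap_emb_le:
  assumes T: "simple_graph T" and H: "simple_graph H" "verts H \<noteq> {}"
    and p: "0 < p" "p \<le> 1" and D: "0 < D" and n: "0 < n"
    and dens: "\<And>W F. W \<subseteq> verts T \<Longrightarrow> F \<subseteq> edges T \<Longrightarrow> F \<noteq> {} \<Longrightarrow> \<Union>F \<subseteq> W \<Longrightarrow> card W \<le> card (verts H)
       \<Longrightarrow> card F \<le> card (edges H) \<Longrightarrow> D \<le> real n ^ card W * p ^ card F"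
  shows "overlap p (emb T (complete_ugraph n)) (edge_image T) (emb H (complete_ugraph n)) (edge_image H)
    \<le> real (2 ^ card (verts T) * card (verts H) ^ card (verts T)) *
        (real n ^ (card (verts T) + card (verts H)) * p ^ (card (edges T) + card (edges H))) / D"
proof -
  let ?VT = "verts T" and ?VH = "verts H"
  let ?I = "emb T (complete_ugraph n)" and ?J = "emb H (complete_ugraph n)"
  define pe where "pe = p ^ (card (edges T) + card (edges H))"
  have pe: "0 < pe" using p by (simp add: pe_def)
  note sT = simple_graphD[OF T] and sH = simple_graphD[OF H(1)]
  have h1: "1 \<le> card ?VH" using H sH(1) by (simp add: Suc_le_eq card_gt_0_iff)
  have finI: "finite ?I" "finite ?J" using T H by (auto intro!: finite_emb simp: complete_ugraph_def)
  define W where "W = (\<lambda>(\<phi> :: 'a \<Rightarrow> nat) (\<psi> :: 'b \<Rightarrow> nat). {x \<in> ?VT. \<phi> x \<in> \<psi> ` ?VH})"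
  have pair_term: "of_bool (edge_image T \<phi> \<inter> edge_image H \<psi> \<noteq> {}) * p ^ card (edge_image T \<phi> \<union> edge_image H \<psi>)
      \<le> pe / D * real n ^ card (W \<phi> \<psi>)" if \<phi>: "\<phi> \<in> ?I" and \<psi>: "\<psi> \<in> ?J" for \<phi> \<psi>
  proof (cases "edge_image T \<phi> \<inter> edge_image H \<psi> = {}")
    case True
    then show ?thesis using pe D by simp
  next
    case False
    have inj: "inj_on \<phi> ?VT" "inj_on \<psi> ?VH" using \<phi> \<psi> by (auto simp: emb_def)
    define F where "F = {e \<in> edges T. \<phi> ` e \<in> edge_image H \<psi>}"
    have Fim: "edge_image T \<phi> \<inter> edge_image H \<psi> = (\<lambda>e. \<phi> ` e) ` F"
      by (auto simp: F_def edge_image_def)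
    have cF: "card (edge_image T \<phi> \<inter> edge_image H \<psi>) = card F"
      unfolding Fim using inj_on_image_edges[OF T inj(1)] by (intro card_image) (auto simp: F_def intro: inj_on_subset)
    have fin: "finite (edge_image T \<phi>)" "finite (edge_image H \<psi>)"
      using sT sH by (auto simp: edge_image_def)
    have cU: "card (edge_image T \<phi> \<union> edge_image H \<psi>) + card F = card (edges T) + card (edges H)"
      using card_Un_Int[OF fin] cF card_edge_image[OF T inj(1)] card_edge_image[OF H(1) inj(2)] by simp
    have FH: "card F \<le> card (edges H)"
      using card_mono[OF fin(2), of "edge_image T \<phi> \<inter> edge_image H \<psi>"] cF card_edge_image[OF H(1) inj(2)] by simp
    have WH: "card (W \<phi> \<psi>) \<le> card ?VH"
    proof -
      have "card (W \<phi> \<psi>) = card (\<phi> ` W \<phi> \<psi>)"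
        using inj(1) by (intro card_image[symmetric]) (auto simp: W_def intro: inj_on_subset)
      also have "\<dots> \<le> card (\<psi> ` ?VH)"
        using sH(1) by (intro card_mono) (auto simp: W_def)
      also have "\<dots> \<le> card ?VH" using sH(1) by (intro card_image_le)
      finally show ?thesis .
    qed
    have FW: "\<Union>F \<subseteq> W \<phi> \<psi>"
    proof
      fix x assume "x \<in> \<Union>F"
      then obtain e where e: "e \<in> F" "x \<in> e" by blast
      then have eT: "e \<in> edges T" "\<phi> ` e \<in> edge_image H \<psi>" by (auto simp: F_def)
      then obtain e' where "e' \<in> edges H" "\<phi> ` e = \<psi> ` e'" by (auto simp: edge_image_def)
      then have "\<phi> x \<in> \<psi> ` ?VH" using e sH(3) by blast
      then show "x \<in> W \<phi> \<psi>" using sT(3)[OF eT(1)] e by (auto simp: W_def)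
    qed
    have "D \<le> real n ^ card (W \<phi> \<psi>) * p ^ card F"
      using False Fim FW WH FH by (intro dens) (auto simp: W_def F_def)
    then have "p ^ card (edge_image T \<phi> \<union> edge_image H \<psi>) * D
       \<le> p ^ card (edge_image T \<phi> \<union> edge_image H \<psi>) * (real n ^ card (W \<phi> \<psi>) * p ^ card F)"
      using p by (intro mult_left_mono) auto
    also have "\<dots> = pe * real n ^ card (W \<phi> \<psi>)"
      unfolding pe_def cU[symmetric] by (simp add: power_add)
    finally show ?thesis using D False by (simp add: field_simps)
  qed
  have cnt: "(\<Sum>\<phi>\<in>?I. real n ^ card (W \<phi> \<psi>)) \<le> 2 ^ card ?VT * (card ?VH ^ card ?VT * real n ^ card ?VT)"
    if \<psi>: "\<psi> \<in> ?J" for \<psi>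
  proof -
    have "(\<Sum>\<phi>\<in>?I. real n ^ card (W \<phi> \<psi>)) = (\<Sum>U\<in>Pow ?VT. \<Sum>\<phi> | \<phi> \<in> ?I \<and> W \<phi> \<psi> = U. real n ^ card (W \<phi> \<psi>))"
      using finI sT(1) by (intro sum.group[symmetric]) (auto simp: W_def)
    also have "\<dots> \<le> (\<Sum>U\<in>Pow ?VT. card ?VH ^ card ?VT * real n ^ card ?VT)"
    proof (intro sum_mono)
      fix U assume U: "U \<in> Pow ?VT"
      then have finU: "finite U" using sT(1) finite_subset by blast
      \<comment> \<open>Vertices in \<open>U\<close> are confined to the image of \<psi>, the others
        are free. The resulting power of n is cancelled by the weight n^|U|, so all \<open>U\<close>
        obey the same bound.\<close>
      let ?P = "PiE ?VT (\<lambda>x. if x \<in> U then \<psi> ` ?VH else {..<n})"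
      have finP: "finite ?P" using sT(1) sH(1) by (intro finite_PiE) auto
      have "card {\<phi>. \<phi> \<in> ?I \<and> W \<phi> \<psi> = U} \<le> card ?P"
        using finP by (intro card_mono) (auto simp: W_def emb_def complete_ugraph_def PiE_iff extensional_def)
      also have "\<dots> = (\<Prod>x\<in>?VT. if x \<in> U then card (\<psi> ` ?VH) else n)"
        using sT(1) by (subst card_PiE) (auto intro!: prod.cong)
      also have "\<dots> = card (\<psi> ` ?VH) ^ card U * n ^ card (?VT - U)"
        using sT(1) U by (simp add: prod.If_cases Int_absorb1 Diff_eq)
      also have "\<dots> \<le> card ?VH ^ card U * n ^ card (?VT - U)"
        using sH(1) by (intro mult_right_mono power_mono card_image_le) auto
      also have "\<dots> \<le> card ?VH ^ card ?VT * n ^ card (?VT - U)"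
        using h1 U sT(1) by (intro mult_right_mono power_increasing card_mono) auto
      finally have "real (card {\<phi>. \<phi> \<in> ?I \<and> W \<phi> \<psi> = U}) \<le> real (card ?VH ^ card ?VT * n ^ card (?VT - U))"
        by (rule of_nat_mono)
      then have c: "real (card {\<phi>. \<phi> \<in> ?I \<and> W \<phi> \<psi> = U}) \<le> card ?VH ^ card ?VT * real n ^ card (?VT - U)"
        by simp
      have "(\<Sum>\<phi> | \<phi> \<in> ?I \<and> W \<phi> \<psi> = U. real n ^ card (W \<phi> \<psi>))
          = real (card {\<phi>. \<phi> \<in> ?I \<and> W \<phi> \<psi> = U}) * real n ^ card U" by simp
      also have "\<dots> \<le> card ?VH ^ card ?VT * real n ^ card (?VT - U) * real n ^ card U"
        using c by (intro mult_right_mono) auto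
      also have "\<dots> = card ?VH ^ card ?VT * real n ^ card ?VT"
        using card_Diff_subset[OF finU] card_mono[OF sT(1), of U] U by (simp add: power_add[symmetric])
      finally show "(\<Sum>\<phi> | \<phi> \<in> ?I \<and> W \<phi> \<psi> = U. real n ^ card (W \<phi> \<psi>)) \<le> card ?VH ^ card ?VT * real n ^ card ?VT" .
    qed
    finally show ?thesis using sT(1) by (simp add: card_Pow)
  qed
  have "overlap p ?I (edge_image T) ?J (edge_image H) \<le> (\<Sum>\<phi>\<in>?I. \<Sum>\<psi>\<in>?J. pe / D * real n ^ card (W \<phi> \<psi>))"
    unfolding overlap_def by (intro sum_mono pair_term)
  also have "\<dots> = pe / D * (\<Sum>\<psi>\<in>?J. \<Sum>\<phi>\<in>?I. real n ^ card (W \<phi> \<psi>))"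
    by (subst sum.swap) (simp add: sum_distrib_left)
  also have "\<dots> \<le> pe / D * (\<Sum>\<psi>\<in>?J. 2 ^ card ?VT * (card ?VH ^ card ?VT * real n ^ card ?VT))"
    using pe D by (intro mult_left_mono sum_mono cnt) auto
  also have "\<dots> = pe / D * (card ?J * (2 ^ card ?VT * (card ?VH ^ card ?VT * real n ^ card ?VT)))"
    by simp
  also have "\<dots> \<le> pe / D * (real n ^ card ?VH * (2 ^ card ?VT * (card ?VH ^ card ?VT * real n ^ card ?VT)))"
  proof -
    have "real (card ?J) \<le> real (n ^ card ?VH)"
      unfolding of_nat_le_iff using card_emb_le[OF H(1), of "complete_ugraph n"] by (simp add: complete_ugraph_def)
    then show ?thesis using pe D by (intro mult_left_mono mult_right_mono) auto
  qed
  finally show ?thesis by (simp add: pe_def power_add mult_ac)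
qed

section \<open>Supersaturation\<close>

definition injs :: "nat \<Rightarrow> nat \<Rightarrow> (nat \<Rightarrow> nat) set" where
  "injs m n = {\<sigma> \<in> {..<m} \<rightarrow>\<^sub>E {..<n}. inj_on \<sigma> {..<m}}"

text \<open>The graph induced on an ordered sample of \<open>m\<close> vertices, relabelled by
  \<open>{..<m}\<close>.\<close>

definition pull :: "nat \<Rightarrow> (nat \<Rightarrow> nat) \<Rightarrow> nat set set \<Rightarrow> nat set set" where
  "pull m \<sigma> E = {e \<in> all_pairs {..<m}. \<sigma> ` e \<in> E}"

definition max_emb :: "nat \<Rightarrow> 'a ugraph \<Rightarrow> 'b ugraph \<Rightarrow> nat" where
  "max_emb n T H = Max {card (emb T ({..<n}, E)) |E. E \<subseteq> all_pairs {..<n} \<and> emb H ({..<n}, E) = {}}"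

lemma card_injections:
  assumes "finite A" "finite B"
  shows "card {f \<in> A \<rightarrow>\<^sub>E B. inj_on f A} = (\<Prod>i = 0..<card A. card B - i)"
  using card_inj_on_subset_funcset[OF assms subset_refl] by simp

lemma card_emb_complete:
  assumes "simple_graph T"
  shows "card (emb T (complete_ugraph n)) = (\<Prod>i = 0..<card (verts T). n - i)"
  using card_injections[OF simple_graphD(1)[OF assms], of "{..<n}"] emb_complete[OF assms, of n] by simp

lemma card_emb_complete_pos:
  assumes "simple_graph T" "card (verts T) \<le> n"
  shows "0 < card (emb T (complete_ugraph n))"
  using assms(2) unfolding card_emb_complete[OF assms(1)] by (intro prod_pos) auto

lemma card_emb_complete_ge:
  assumes "simple_graph T" "2 * card (verts T) \<le> n"
  shows "(real n / 2) ^ card (verts T) \<le> card (emb T (complete_ugraph n))"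
proof -
  have "(real n / 2) ^ card (verts T) = (\<Prod>i = 0..<card (verts T). real n / 2)" by simp
  also have "\<dots> \<le> (\<Prod>i = 0..<card (verts T). real (n - i))"
    using assms(2) by (intro prod_mono) auto
  also have "\<dots> = card (emb T (complete_ugraph n))"
    unfolding card_emb_complete[OF assms(1)] by simp
  finally show ?thesis .
qed

lemma finite_injs: "finite (injs m n)"
  unfolding injs_def by (rule finite_subset[of _ "{..<m} \<rightarrow>\<^sub>E {..<n}"]) (auto intro: finite_PiE)

lemma injs_nonempty: "m \<le> n \<Longrightarrow> injs m n \<noteq> {}"
proof -
  assume "m \<le> n"
  then have "restrict id {..<m} \<in> injs m n" by (auto simp: injs_def inj_on_def)
  then show ?thesis by blast
qed

lemma card_extensions:
  assumes T: "simple_graph T" and \<phi>: "\<phi> \<in> emb T (complete_ugraph m)" and \<psi>: "\<psi> \<in> emb T (complete_ugraph n)"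
  shows "card {\<sigma> \<in> injs m n. \<forall>x\<in>verts T. \<sigma> (\<phi> x) = \<psi> x}
    = (\<Prod>i = 0..<m - card (verts T). n - card (verts T) - i)"
proof -
  let ?V = "verts T"
  define A where "A = \<phi> ` ?V"
  define B where "B = \<psi> ` ?V"
  define g where "g = \<psi> \<circ> inv_into ?V \<phi>"
  have inj: "inj_on \<phi> ?V" "inj_on \<psi> ?V" and A: "A \<subseteq> {..<m}" and B: "B \<subseteq> {..<n}"
    using \<phi> \<psi> by (auto simp: emb_def complete_ugraph_def A_def B_def)
  have cA: "card A = card ?V" "card B = card ?V"
    using inj by (simp_all add: A_def B_def card_image)
  have fin: "finite A" "finite B" using A B finite_subset by blast+
  have g: "g (\<phi> x) = \<psi> x" if "x \<in> ?V" for x using that inj by (simp add: g_def)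
  have gA: "g ` A = B" "inj_on g A"
  proof -
    show "g ` A = B" unfolding A_def B_def image_image using g by simp
    show "inj_on g A" unfolding A_def using g inj by (auto simp: inj_on_def)
  qed
  let ?X = "{\<sigma> \<in> injs m n. \<forall>x\<in>?V. \<sigma> (\<phi> x) = \<psi> x}"
  let ?Y = "{\<tau> \<in> ({..<m} - A) \<rightarrow>\<^sub>E ({..<n} - B). inj_on \<tau> ({..<m} - A)}"
  have X: "\<sigma> \<in> ?X \<longleftrightarrow> \<sigma> \<in> {..<m} \<rightarrow>\<^sub>E {..<n} \<and> inj_on \<sigma> {..<m} \<and> (\<forall>y\<in>A. \<sigma> y = g y)" for \<sigma>
    using g by (auto simp: injs_def A_def)
  have "bij_betw (\<lambda>\<sigma>. restrict \<sigma> ({..<m} - A)) ?X ?Y"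
  proof (rule bij_betw_byWitness[where f' = "\<lambda>\<tau> y. if y \<in> A then g y else \<tau> y"])
    show "\<forall>\<sigma>\<in>?X. (\<lambda>y. if y \<in> A then g y else restrict \<sigma> ({..<m} - A) y) = \<sigma>"
    proof
      fix \<sigma> assume "\<sigma> \<in> ?X"
      then have "\<sigma> \<in> extensional {..<m}" "\<forall>y\<in>A. \<sigma> y = g y" unfolding X by (auto simp: PiE_iff)
      then show "(\<lambda>y. if y \<in> A then g y else restrict \<sigma> ({..<m} - A) y) = \<sigma>"
        by (auto simp: fun_eq_iff restrict_def extensional_def)
    qed
    show "\<forall>\<tau>\<in>?Y. restrict (\<lambda>y. if y \<in> A then g y else \<tau> y) ({..<m} - A) = \<tau>"
      by (auto simp: fun_eq_iff restrict_def PiE_iff extensional_def)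
    show "(\<lambda>\<sigma>. restrict \<sigma> ({..<m} - A)) ` ?X \<subseteq> ?Y"
    proof (intro image_subsetI)
      fix \<sigma> assume "\<sigma> \<in> ?X"
      then have \<sigma>: "\<sigma> \<in> {..<m} \<rightarrow>\<^sub>E {..<n}" "inj_on \<sigma> {..<m}" "\<forall>y\<in>A. \<sigma> y = g y" unfolding X by auto
      have "\<sigma> ` A = B" using \<sigma>(3) gA by auto
      then have "\<sigma> y \<notin> B" if "y \<in> {..<m} - A" for y
        using \<sigma>(2) that A by (auto simp: inj_on_def subset_iff)
      then show "restrict \<sigma> ({..<m} - A) \<in> ?Y"
        using \<sigma> by (auto simp: PiE_iff inj_on_def)
    qed
    show "(\<lambda>\<tau> y. if y \<in> A then g y else \<tau> y) ` ?Y \<subseteq> ?X"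
    proof (intro image_subsetI)
      fix \<tau> assume \<tau>: "\<tau> \<in> ?Y"
      let ?s = "\<lambda>y. if y \<in> A then g y else \<tau> y"
      have "?s \<in> {..<m} \<rightarrow>\<^sub>E {..<n}"
        using \<tau> gA(1) B A by (auto simp: PiE_iff extensional_def)
      moreover have "inj_on ?s {..<m}"
      proof (rule inj_onI)
        fix x y assume xy: "x \<in> {..<m}" "y \<in> {..<m}" "?s x = ?s y"
        have r: "\<tau> z \<notin> B" if "z \<in> {..<m}" "z \<notin> A" for z using \<tau> that by (auto simp: PiE_iff)
        have l: "g z \<in> B" if "z \<in> A" for z using gA that by blast
        have i: "inj_on \<tau> ({..<m} - A)" using \<tau> by simp
        show "x = y"
        proof (cases "x \<in> A")
          case True
          then have "y \<in> A" using xy r[of y] l[of x] by (cases "y \<in> A") auto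
          then show ?thesis using True xy(3) inj_onD[OF gA(2)] by simp
        next
          case False
          then have "y \<notin> A" using xy r[of x] l[of y] by (cases "y \<in> A") auto
          then show ?thesis using False xy inj_onD[OF i] by simp
        qed
      qed
      ultimately show "?s \<in> ?X" unfolding X by auto
    qed
  qed
  then have "card ?X = card ?Y" by (rule bij_betw_same_card)
  also have "\<dots> = (\<Prod>i = 0..<card ({..<m} - A). card ({..<n} - B) - i)"
    by (intro card_injections) auto
  finally have "card ?X = (\<Prod>i = 0..<card ({..<m} - A). card ({..<n} - B) - i)" .
  moreover have "card ({..<m} - A) = m - card ?V" "card ({..<n} - B) = n - card ?V"
    using A B fin cA by (simp_all add: card_Diff_subset)
  ultimately show ?thesis by simp
qed

text \<open>Double count of the triples in which \<sigma> carries an embedding \<phi> into the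
  complete graph on \<open>m\<close> vertices to an embedding \<psi> into \<open>E\<close>.\<close>

lemma sum_pull:
  assumes T: "simple_graph T" and E: "E \<subseteq> all_pairs {..<n}"
  shows "(\<Sum>\<sigma>\<in>injs m n. card (emb T ({..<m}, pull m \<sigma> E))) =
    card (emb T (complete_ugraph m)) * (\<Prod>i = 0..<m - card (verts T). n - card (verts T) - i)
      * card (emb T ({..<n}, E))"
proof -
  let ?V = "verts T" and ?M = "emb T (complete_ugraph m)" and ?N = "emb T ({..<n}, E)"
  have N_sub: "?N \<subseteq> emb T (complete_ugraph n)"
    using E by (intro emb_mono) (auto simp: complete_ugraph_def)
  have fin: "finite ?M" "finite ?N" using T by (auto intro!: finite_emb simp: complete_ugraph_def)
  have one: "of_bool (\<phi> \<in> emb T ({..<m}, pull m \<sigma> E)) = (\<Sum>\<psi>\<in>?N. of_bool (\<forall>x\<in>?V. \<sigma> (\<phi> x) = \<psi> x) :: nat)"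
    if \<phi>: "\<phi> \<in> ?M" and \<sigma>: "\<sigma> \<in> injs m n" for \<phi> \<sigma>
  proof -
    let ?c = "restrict (\<sigma> \<circ> \<phi>) ?V"
    have ce: "?c ` e = \<sigma> ` \<phi> ` e" if "e \<in> edges T" for e
      using simple_graphD(3)[OF T that] by (auto simp: image_image subset_iff)
    have c: "?c \<in> ?V \<rightarrow>\<^sub>E {..<n}" "inj_on ?c ?V"
    proof -
      have r: "\<phi> ` ?V \<subseteq> {..<m}" "inj_on \<phi> ?V" using \<phi> by (auto simp: emb_def complete_ugraph_def)
      then show "?c \<in> ?V \<rightarrow>\<^sub>E {..<n}" using \<sigma> by (auto simp: injs_def PiE_iff)
      have "inj_on (\<sigma> \<circ> \<phi>) ?V"
        using r \<sigma> by (intro comp_inj_on) (auto simp: injs_def intro: inj_on_subset)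
      then show "inj_on ?c ?V" by (simp add: inj_on_restrict_eq)
    qed
    have iff: "\<phi> \<in> emb T ({..<m}, pull m \<sigma> E) \<longleftrightarrow> ?c \<in> ?N"
      using \<phi> c ce by (auto simp: emb_def pull_def complete_ugraph_def)
    have eq: "(\<forall>x\<in>?V. \<sigma> (\<phi> x) = \<psi> x) \<longleftrightarrow> \<psi> = ?c" if "\<psi> \<in> ?N" for \<psi>
    proof -
      have "\<psi> \<in> extensional ?V" using that by (auto simp: emb_def PiE_iff)
      then show ?thesis by (auto simp: fun_eq_iff extensional_def restrict_def)
    qed
    have "(\<Sum>\<psi>\<in>?N. of_bool (\<forall>x\<in>?V. \<sigma> (\<phi> x) = \<psi> x)) = (\<Sum>\<psi>\<in>?N. if \<psi> = ?c then 1 else 0 :: nat)"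
      by (intro sum.cong refl) (simp only: eq of_bool_def)
    also have "\<dots> = of_bool (?c \<in> ?N)" using fin(2) by simp
    finally show ?thesis using iff by simp
  qed
  have emb_card: "card (emb T ({..<m}, pull m \<sigma> E)) = (\<Sum>\<phi>\<in>?M. of_bool (\<phi> \<in> emb T ({..<m}, pull m \<sigma> E)))" for \<sigma>
  proof -
    have "emb T ({..<m}, pull m \<sigma> E) \<subseteq> ?M"
      by (intro emb_mono) (auto simp: complete_ugraph_def pull_def)
    then show ?thesis using fin(1) by (simp add: Int_absorb1 Int_commute)
  qed
  have "(\<Sum>\<sigma>\<in>injs m n. card (emb T ({..<m}, pull m \<sigma> E)))
    = (\<Sum>\<sigma>\<in>injs m n. \<Sum>\<phi>\<in>?M. \<Sum>\<psi>\<in>?N. of_bool (\<forall>x\<in>?V. \<sigma> (\<phi> x) = \<psi> x))"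
    unfolding emb_card by (intro sum.cong refl one)
  also have "\<dots> = (\<Sum>\<phi>\<in>?M. \<Sum>\<psi>\<in>?N. \<Sum>\<sigma>\<in>injs m n. of_bool (\<forall>x\<in>?V. \<sigma> (\<phi> x) = \<psi> x))"
    by (subst sum.swap) (intro sum.cong refl sum.swap)
  also have "\<dots> = (\<Sum>\<phi>\<in>?M. \<Sum>\<psi>\<in>?N. card {\<sigma> \<in> injs m n. \<forall>x\<in>?V. \<sigma> (\<phi> x) = \<psi> x})"
    using finite_injs by (intro sum.cong refl) (simp add: Int_def)
  also have "\<dots> = (\<Sum>\<phi>\<in>?M. \<Sum>\<psi>\<in>?N. (\<Prod>i = 0..<m - card ?V. n - card ?V - i))"
    using N_sub by (intro sum.cong refl card_extensions T) auto
  finally show ?thesis by (simp add: mult_ac)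
qed

lemma pull_all_pairs:
  assumes "\<sigma> \<in> injs m n"
  shows "pull m \<sigma> (all_pairs {..<n}) = all_pairs {..<m}"
  using assms card_image_edge[of \<sigma> "{..<m}"]
  by (fastforce simp: pull_def injs_def all_pairs_def PiE_iff)

text \<open>\<open>sum_pull\<close> for \<open>E\<close> and for the complete graph share the same
  product, which is eliminated: the mean density of \<open>T\<close> in a random sample equals its
  density in \<open>E\<close>.\<close>

lemma average_pull:
  assumes T: "simple_graph T" and E: "E \<subseteq> all_pairs {..<n}"
  shows "(\<Sum>\<sigma>\<in>injs m n. card (emb T ({..<m}, pull m \<sigma> E))) * card (emb T (complete_ugraph n)) =
    card (emb T (complete_ugraph m)) * card (injs m n) * card (emb T ({..<n}, E))"
proof -
  have "card (injs m n) * card (emb T (complete_ugraph m))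
     = (\<Sum>\<sigma>\<in>injs m n. card (emb T ({..<m}, pull m \<sigma> (all_pairs {..<n}))))"
    by (simp add: pull_all_pairs complete_ugraph_def cong: sum.cong)
  also have "\<dots> = card (emb T (complete_ugraph m)) * (\<Prod>i = 0..<m - card (verts T). n - card (verts T) - i)
      * card (emb T (complete_ugraph n))"
    using sum_pull[OF T subset_refl, of m n] by (simp add: complete_ugraph_def)
  finally have c: "card (injs m n) * card (emb T (complete_ugraph m)) = \<dots>" .
  show ?thesis unfolding sum_pull[OF T E] mult.commute[of "card (emb T (complete_ugraph m))" "card (injs m n)"] c
    by (simp only: mult_ac)
qed

lemma finite_max_emb: "finite {card (emb T ({..<n::nat}, E)) |E. E \<subseteq> all_pairs {..<n} \<and> emb H ({..<n}, E) = {}}"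
proof -
  have "finite ((\<lambda>E. card (emb T ({..<n}, E))) ` Pow (all_pairs {..<n}))" by simp
  then show ?thesis by (rule finite_subset[rotated]) auto
qed

lemma max_emb_ge:
  "E \<subseteq> all_pairs {..<n} \<Longrightarrow> emb H ({..<n}, E) = {} \<Longrightarrow> card (emb T ({..<n}, E)) \<le> max_emb n T H"
  unfolding max_emb_def by (intro Max_ge finite_max_emb) blast

lemma max_emb_attained:
  assumes "edges H \<noteq> {}"
  obtains E where "E \<subseteq> all_pairs {..<n}" "emb H ({..<n}, E) = {}" "card (emb T ({..<n}, E)) = max_emb n T H"
proof -
  have "emb H ({..<n}, {}) = {}" using assms by (auto simp: emb_def)
  then have "{card (emb T ({..<n}, E)) |E. E \<subseteq> all_pairs {..<n} \<and> emb H ({..<n}, E) = {}} \<noteq> {}" by blast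
  from Max_in[OF finite_max_emb this] obtain E
    where "max_emb n T H = card (emb T ({..<n}, E))" "E \<subseteq> all_pairs {..<n}" "emb H ({..<n}, E) = {}"
    unfolding max_emb_def by blast
  then show ?thesis using that by simp
qed

lemma pull_free:
  assumes "emb H ({..<n}, E) = {}" "\<sigma> \<in> injs m n" and H: "simple_graph H"
  shows "emb H ({..<m}, pull m \<sigma> E) = {}"
proof (rule ccontr)
  assume "emb H ({..<m}, pull m \<sigma> E) \<noteq> {}"
  then obtain \<phi> where \<phi>: "\<phi> \<in> emb H ({..<m}, pull m \<sigma> E)" by blast
  have r: "\<phi> ` verts H \<subseteq> {..<m}" "inj_on \<phi> (verts H)" using \<phi> by (auto simp: emb_def)
  let ?c = "restrict (\<sigma> \<circ> \<phi>) (verts H)"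
  have "inj_on (\<sigma> \<circ> \<phi>) (verts H)"
    using r assms(2) by (intro comp_inj_on) (auto simp: injs_def intro: inj_on_subset)
  then have "inj_on ?c (verts H)" by (simp add: inj_on_restrict_eq)
  moreover have "?c ` e \<in> E" if "e \<in> edges H" for e
  proof -
    have "?c ` e = \<sigma> ` \<phi> ` e"
      using simple_graphD(3)[OF H that] by (auto simp: image_image subset_iff)
    then show ?thesis using \<phi> that by (auto simp: emb_def pull_def)
  qed
  ultimately have "?c \<in> emb H ({..<n}, E)"
    using r assms(2) by (auto simp: emb_def injs_def PiE_iff)
  then show False using assms(1) by simp
qed

definition dens :: "'a ugraph \<Rightarrow> 'b ugraph \<Rightarrow> nat \<Rightarrow> real" where
  "dens T H n = real (max_emb n T H) / card (emb T (complete_ugraph n))"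

text \<open>The averaging argument of Katona, Nemetz and Simonovits: all samples of an extremal
  graph are \<open>H\<close>-free, hence so is one at least as dense as the average.\<close>

lemma dens_antimono:
  assumes T: "simple_graph T" and H: "simple_graph H" "edges H \<noteq> {}"
    and mn: "card (verts T) \<le> m" "m \<le> n"
  shows "dens T H n \<le> dens T H m"
proof -
  obtain E where E: "E \<subseteq> all_pairs {..<n}" "emb H ({..<n}, E) = {}" "card (emb T ({..<n}, E)) = max_emb n T H"
    using max_emb_attained[OF H(2)] by metis
  let ?am = "card (emb T (complete_ugraph m))" and ?an = "card (emb T (complete_ugraph n))"
  have pos: "0 < ?am" "0 < ?an" using mn by (auto intro!: card_emb_complete_pos T)
  have J: "0 < card (injs m n)" using mn injs_nonempty finite_injs by (simp add: card_gt_0_iff)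
  have "(\<Sum>\<sigma>\<in>injs m n. card (emb T ({..<m}, pull m \<sigma> E))) \<le> (\<Sum>\<sigma>\<in>injs m n. max_emb m T H)"
    by (intro sum_mono max_emb_ge pull_free[OF E(2)] H) (auto simp: pull_def)
  from mult_le_mono1[OF this, of ?an]
  have "?am * card (injs m n) * max_emb n T H \<le> card (injs m n) * max_emb m T H * ?an"
    unfolding average_pull[OF T E(1), of m] E(3) by simp
  then have "card (injs m n) * (?am * max_emb n T H) \<le> card (injs m n) * (max_emb m T H * ?an)"
    by (simp only: mult_ac)
  then have "?am * max_emb n T H \<le> max_emb m T H * ?an" using J by simp
  then have "real ?am * max_emb n T H \<le> max_emb m T H * real ?an"
    by (metis of_nat_le_iff of_nat_mult)
  then show ?thesis unfolding dens_def using pos by (simp add: field_simps)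
qed

lemma dens_almost_limit:
  assumes T: "simple_graph T" and H: "simple_graph H" "edges H \<noteq> {}" and e: "0 < e"
  shows "\<exists>m\<ge>N. \<forall>n\<ge>m. dens T H m \<le> dens T H n + e"
proof -
  let ?v = "card (verts T)"
  \<comment> \<open>Shifted by the number of vertices of \<open>T\<close>, since monotonicity starts
    there.\<close>
  define x where "x = (\<lambda>k. dens T H (k + ?v))"
  have "decseq x" unfolding decseq_def x_def using dens_antimono[OF T H] by simp
  moreover have "0 \<le> x k" for k by (simp add: x_def dens_def)
  ultimately obtain L where L: "x \<longlonglongrightarrow> L" "\<And>k. L \<le> x k"
    using decseq_convergent[of x 0] by auto
  from L(1) e have "\<forall>\<^sub>F k in sequentially. x k < L + e"
    by (intro order_tendstoD) auto
  then obtain k0 where k0: "\<And>k. k \<ge> k0 \<Longrightarrow> x k < L + e" by (auto simp: eventually_sequentially)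
  define m where "m = max k0 N + ?v"
  have "dens T H m \<le> dens T H n + e" if "m \<le> n" for n
  proof -
    have "dens T H m < L + e" using k0[of "max k0 N"] by (simp add: m_def x_def)
    also have "L \<le> dens T H n" using L(2)[of "n - ?v"] that by (simp add: m_def x_def)
    finally show ?thesis by simp
  qed
  then show ?thesis by (intro exI[of _ m]) (auto simp: m_def)
qed

text \<open>Choose \<open>m\<close> with the extremal density at \<open>m\<close> within e/2 of all
  later ones. Too many copies of \<open>T\<close> push the mean density of the samples of size
  \<open>m\<close> above the extremal one by e/2. Samples without \<open>H\<close> cannot exceed it,
  so a proportion e/2 of all samples contains \<open>H\<close>, and averaging back yields a positive
  density of \<open>H\<close>.\<close>

lemma supersaturation:
  assumes T: "simple_graph T" and H: "simple_graph H" "edges H \<noteq> {}" and e: "0 < (e::real)"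
  shows "\<exists>d>0. \<exists>n0. \<forall>n\<ge>n0. \<forall>E\<subseteq>all_pairs {..<n}.
     card (emb H ({..<n}, E)) < d * real n ^ card (verts H) \<longrightarrow>
     card (emb T ({..<n}, E)) \<le> max_emb n T H + e * real n ^ card (verts T)"
proof -
  let ?v = "card (verts T)" and ?h = "card (verts H)"
  obtain m where m: "m \<ge> ?v + ?h" "\<And>n. n \<ge> m \<Longrightarrow> dens T H m \<le> dens T H n + e / 2"
    using dens_almost_limit[OF T H, of "e/2" "?v + ?h"] e by auto
  let ?aT = "\<lambda>n. real (card (emb T (complete_ugraph n)))" and ?aH = "\<lambda>n. real (card (emb H (complete_ugraph n)))"
  have am: "0 < ?aT m" "0 < ?aH m" using m(1) T H by (auto intro!: card_emb_complete_pos)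
  \<comment> \<open>A proportion e/2 of the samples has at least one of the \<open>?aH m\<close>
    possible embeddings of \<open>H\<close>; the power of 2 comes from the bound (n/2)^h \<le>
    \<open>?aH n\<close>.\<close>
  define d where "d = e / 2 / (?aH m * 2 ^ ?h)"
  have d: "0 < d" using e am by (simp add: d_def)
  have main: "d * real n ^ ?h \<le> card (emb H ({..<n}, E))"
    if n: "n \<ge> m + 2 * ?h" and E: "E \<subseteq> all_pairs {..<n}"
      and big: "card (emb T ({..<n}, E)) > max_emb n T H + e * real n ^ ?v" for n E
  proof -
    let ?J = "real (card (injs m n))"
    have J: "0 < ?J" using n injs_nonempty[of m n] finite_injs by (simp add: card_gt_0_iff)
    have an: "0 < ?aT n" "0 < ?aH n" using m(1) n T H by (auto intro!: card_emb_complete_pos)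
    define bad where "bad = {\<sigma> \<in> injs m n. emb H ({..<m}, pull m \<sigma> E) \<noteq> {}}"
    have finbad: "finite bad" "bad \<subseteq> injs m n" using finite_injs by (auto simp: bad_def)
    let ?S = "\<Sum>\<sigma>\<in>injs m n. real (card (emb T ({..<m}, pull m \<sigma> E)))"
    have S_eq: "?S * ?aT n = ?aT m * ?J * card (emb T ({..<n}, E))"
      using arg_cong[OF average_pull[OF T E, of m], of real] by simp
    have "?aT n \<le> real n ^ ?v"
      using card_emb_le[OF T, of "complete_ugraph n"] by (simp add: complete_ugraph_def flip: of_nat_power)
    then have "e * ?aT n \<le> e * real n ^ ?v" using e by simp
    with big have "dens T H n * ?aT n + e * ?aT n \<le> card (emb T ({..<n}, E))"
      using an by (simp add: dens_def)
    moreover have "(dens T H m + e / 2) * ?aT n \<le> (dens T H n + e) * ?aT n"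
      using m(2)[of n] n by (intro mult_right_mono) auto
    ultimately have "(dens T H m + e / 2) * ?aT n \<le> card (emb T ({..<n}, E))" by (simp add: algebra_simps)
    then have "?aT m * ?J * ((dens T H m + e / 2) * ?aT n) \<le> ?S * ?aT n"
      unfolding S_eq by (intro mult_left_mono) auto
    then have "?aT m * ?J * (dens T H m + e / 2) * ?aT n \<le> ?S * ?aT n" by (simp only: mult.assoc)
    then have low: "?aT m * ?J * (dens T H m + e / 2) \<le> ?S" using an by simp
    have "?S \<le> (\<Sum>\<sigma>\<in>injs m n. max_emb m T H + (if \<sigma> \<in> bad then ?aT m else 0))"
    proof (intro sum_mono)
      fix \<sigma> assume \<sigma>: "\<sigma> \<in> injs m n"
      show "real (card (emb T ({..<m}, pull m \<sigma> E))) \<le> max_emb m T H + (if \<sigma> \<in> bad then ?aT m else 0)"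
      proof (cases "\<sigma> \<in> bad")
        case True
        have "emb T ({..<m}, pull m \<sigma> E) \<subseteq> emb T (complete_ugraph m)"
          by (intro emb_mono) (auto simp: complete_ugraph_def pull_def)
        then have "card (emb T ({..<m}, pull m \<sigma> E)) \<le> card (emb T (complete_ugraph m))"
          using T by (intro card_mono finite_emb) (auto simp: complete_ugraph_def)
        then show ?thesis using True by simp
      next
        case False
        then have "card (emb T ({..<m}, pull m \<sigma> E)) \<le> max_emb m T H"
          using \<sigma> by (intro max_emb_ge) (auto simp: bad_def pull_def)
        then show ?thesis using False by simp
      qed
    qed
    also have "\<dots> = ?J * max_emb m T H + card bad * ?aT m"
      using finbad finite_injs by (simp add: sum.distrib sum.If_cases Int_absorb1)
    also have "?J * max_emb m T H = ?aT m * ?J * dens T H m" using am by (simp add: dens_def)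
    finally have "?aT m * ?J * (dens T H m + e / 2) \<le> ?aT m * ?J * dens T H m + card bad * ?aT m"
      using low by linarith
    then have "?aT m * (?J * (e / 2)) \<le> ?aT m * card bad" by (simp add: algebra_simps)
    then have bad_ge: "?J * (e / 2) \<le> card bad" using am by simp
    have "real (card bad) = (\<Sum>\<sigma>\<in>bad. 1)" by simp
    also have "\<dots> \<le> (\<Sum>\<sigma>\<in>bad. real (card (emb H ({..<m}, pull m \<sigma> E))))"
    proof (intro sum_mono)
      fix \<sigma> assume "\<sigma> \<in> bad"
      moreover have "finite (emb H ({..<m}, pull m \<sigma> E))" using H by (intro finite_emb) auto
      ultimately show "1 \<le> real (card (emb H ({..<m}, pull m \<sigma> E)))"
        by (simp add: bad_def Suc_le_eq card_gt_0_iff)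
    qed
    also have "\<dots> \<le> (\<Sum>\<sigma>\<in>injs m n. real (card (emb H ({..<m}, pull m \<sigma> E))))"
      using finbad finite_injs by (intro sum_mono2) auto
    finally have "?J * (e / 2) \<le> (\<Sum>\<sigma>\<in>injs m n. real (card (emb H ({..<m}, pull m \<sigma> E))))"
      using bad_ge by linarith
    then have "?J * (e / 2) * ?aH n \<le> (\<Sum>\<sigma>\<in>injs m n. real (card (emb H ({..<m}, pull m \<sigma> E)))) * ?aH n"
      by (intro mult_right_mono) auto
    also have "\<dots> = ?aH m * ?J * card (emb H ({..<n}, E))"
      using arg_cong[OF average_pull[OF H(1) E, of m], of real] by simp
    finally have "?J * (e / 2 * ?aH n) \<le> ?J * (?aH m * card (emb H ({..<n}, E)))" by (simp add: mult_ac)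
    then have "e / 2 * ?aH n \<le> ?aH m * card (emb H ({..<n}, E))" using J by simp
    moreover have "(real n / 2) ^ ?h \<le> ?aH n" using n by (intro card_emb_complete_ge H) auto
    then have "e / 2 * (real n / 2) ^ ?h \<le> e / 2 * ?aH n" using e by (intro mult_left_mono) auto
    ultimately have "e / 2 * (real n / 2) ^ ?h \<le> ?aH m * card (emb H ({..<n}, E))" by linarith
    then show ?thesis using am by (simp add: d_def power_divide field_simps)
  qed
  show ?thesis
  proof (intro exI[of _ d] conjI d exI[of _ "m + 2 * ?h"] allI impI)
    fix n E assume a: "m + 2 * ?h \<le> n" "E \<subseteq> all_pairs {..<n}" "card (emb H ({..<n}, E)) < d * real n ^ ?h"
    show "card (emb T ({..<n}, E)) \<le> max_emb n T H + e * real n ^ ?v"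
    proof (rule ccontr)
      assume "\<not> ?thesis"
      then show False using main[OF a(1,2)] a(3) by simp
    qed
  qed
qed

section \<open>Densities and concentration of subgraph counts\<close>

lemma finite_m2_set:
  assumes "simple_graph G"
  shows "finite {(real (card (edges F)) - 1) / (real (card (verts F)) - 2) |F. subgraph F G \<and> card (edges F) \<ge> 2}"
proof -
  have "{F. subgraph F G} \<subseteq> Pow (verts G) \<times> Pow (edges G)" by (auto simp: subgraph_def)
  moreover have "finite (Pow (verts G) \<times> Pow (edges G))" using simple_graphD(1,2)[OF assms] by simp
  ultimately have "finite {F. subgraph F G}" by (rule finite_subset)
  then have "finite ((\<lambda>F. (real (card (edges F)) - 1) / (real (card (verts F)) - 2)) ` {F. subgraph F G})" by simp
  then show ?thesis by (rule finite_subset[rotated]) blast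
qed

lemma card_verts_gt_2:
  assumes "F \<subseteq> all_pairs W" "finite W" "card F \<ge> 2"
  shows "card W \<ge> 3"
proof (rule ccontr)
  assume "\<not> card W \<ge> 3"
  then have W: "card W \<le> 2" by simp
  have "e = W" if "e \<in> F" for e
    using that assms W by (intro card_seteq) (auto simp: all_pairs_def)
  then have "F \<subseteq> {W}" by auto
  then have "card F \<le> card {W}" by (intro card_mono) auto
  then show False using assms(3) by simp
qed

lemma m2_ge:
  assumes "simple_graph G" "subgraph F G" "card (edges F) \<ge> 2"
  shows "(real (card (edges F)) - 1) / (real (card (verts F)) - 2) \<le> m2 G"
  unfolding m2_def by (intro Max_ge finite_m2_set) (use assms in blast)+

lemma m2_attained:
  assumes G: "simple_graph G" "card (edges G) \<ge> 2"
  obtains F where "subgraph F G" "card (edges F) \<ge> 2" "card (verts F) \<ge> 3"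
    "m2 G * (real (card (verts F)) - 2) = real (card (edges F)) - 1"
proof -
  have "subgraph G G" using G by (simp add: subgraph_def)
  then have "{(real (card (edges F)) - 1) / (real (card (verts F)) - 2) |F. subgraph F G \<and> card (edges F) \<ge> 2} \<noteq> {}"
    using G(2) by blast
  from Max_in[OF finite_m2_set[OF G(1)] this] obtain F
    where F: "m2 G = (real (card (edges F)) - 1) / (real (card (verts F)) - 2)" "subgraph F G" "card (edges F) \<ge> 2"
    unfolding m2_def by blast
  have "card (verts F) \<ge> 3"
    using F(2,3) simple_graphD(1)[of F] by (intro card_verts_gt_2[of "edges F"]) (auto simp: subgraph_def simple_graph_def)
  then show ?thesis using F by (intro that[of F]) auto
qed

text \<open>Two edges span at most four vertices. The bound supplies the sign of
  \<open>2 * m - 1\<close> in the comparisons of densities below.\<close>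

lemma m2_ge_half:
  assumes G: "simple_graph G" "card (edges G) \<ge> 2"
  shows "1 / 2 \<le> m2 G"
proof -
  obtain P where "P \<subseteq> edges G" "card P = 2" using G(2) by (meson obtain_subset_with_card_n)
  then obtain e1 e2 where e: "e1 \<in> edges G" "e2 \<in> edges G" "e1 \<noteq> e2" by (auto simp: card_2_iff)
  note s = simple_graphD[OF G(1)]
  let ?F = "(e1 \<union> e2, {e1, e2})"
  have sub: "subgraph ?F G"
    using e s(3,4,5) by (auto simp: subgraph_def simple_graph_def all_pairs_def)
  have "card (e1 \<union> e2) \<le> 4" using card_Un_le[of e1 e2] s(4)[OF e(1)] s(4)[OF e(2)] by simp
  moreover have "card (e1 \<union> e2) \<ge> 3"
    using sub e by (intro card_verts_gt_2[of "{e1, e2}"]) (auto simp: subgraph_def simple_graph_def)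
  ultimately have "1 / 2 \<le> (real (card (edges ?F)) - 1) / (real (card (verts ?F)) - 2)"
    using e(3) by (simp add: field_simps)
  also have "\<dots> \<le> m2 G" using sub e(3) by (intro m2_ge G) auto
  finally show ?thesis .
qed

text \<open>The density bound multiplied out, so that it also covers a single edge, whose left-hand
  side is zero, and vertex sets larger than the span of \<open>F\<close>.\<close>

lemma edges_le_m2:
  assumes G: "simple_graph G" "0 \<le> m2 G" and W: "W \<subseteq> verts G" and F: "F \<subseteq> edges G" "F \<noteq> {}" "\<Union>F \<subseteq> W"
  shows "2 \<le> card W" "1 \<le> card F" "real (card F) - 1 \<le> m2 G * (real (card W) - 2)"
proof -
  note s = simple_graphD[OF G(1)]
  have finW: "finite W" using W s(1) finite_subset by blast
  have finF: "finite F" using F s(2) finite_subset by blast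
  obtain e where e: "e \<in> F" using F by blast
  then have "card e \<le> card W" using F finW by (intro card_mono) auto
  then show w2: "2 \<le> card W" using s(4) F e by auto
  show f1: "1 \<le> card F" using finF F(2) by (simp add: Suc_le_eq card_gt_0_iff)
  show "real (card F) - 1 \<le> m2 G * (real (card W) - 2)"
  proof (cases "card F \<ge> 2")
    case True
    have FW: "F \<subseteq> all_pairs W" using F s(4) by (auto simp: all_pairs_def)
    then have "subgraph (W, F) G" using W F finW by (auto simp: subgraph_def simple_graph_def)
    from m2_ge[OF G(1) this] True have "(real (card F) - 1) / (real (card W) - 2) \<le> m2 G" by simp
    moreover have "card W \<ge> 3" using FW finW True by (rule card_verts_gt_2)
    ultimately show ?thesis by (simp add: divide_le_eq)
  next
    case False
    then have "real (card F) - 1 \<le> 0" by simp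
    also have "0 \<le> m2 G * (real (card W) - 2)" using w2 G by simp
    finally show ?thesis .
  qed
qed

text \<open>With e = 1 + m (v - 2) and f \<le> 1 + m (w - 2), the difference e w - f v is at least
  (v - w)(2 m - 1), non-negative as m \<ge> 1/2.\<close>

lemma balanced_of_two_balanced:
  assumes T: "simple_graph T" "card (edges T) \<ge> 2" "two_balanced T"
    and W: "W \<subseteq> verts T" and F: "F \<subseteq> edges T" "F \<noteq> {}" "\<Union>F \<subseteq> W"
  shows "real (card F) * card (verts T) \<le> card (edges T) * real (card W)"
proof -
  define m v e w f where "m = m2 T" and "v = real (card (verts T))" and "e = real (card (edges T))"
    and "w = real (card W)" and "f = real (card F)"
  have m: "1 / 2 \<le> m" using m2_ge_half[OF T(1,2)] by (simp add: m_def)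
  have "card (verts T) \<ge> 3"
    using T simple_graphD(1)[OF T(1)] by (intro card_verts_gt_2[of "edges T"]) (auto simp: simple_graph_def)
  then have v: "3 \<le> v" by (simp add: v_def)
  have e: "e = 1 + m * (v - 2)"
    using T(3) v by (simp add: two_balanced_def m_def e_def v_def)
  have f: "f \<le> 1 + m * (w - 2)"
    using edges_le_m2(3)[OF T(1) _ W F] m by (simp add: m_def w_def f_def)
  have wv: "w \<le> v" using W simple_graphD(1)[OF T(1)] by (simp add: w_def v_def card_mono)
  have "f * v \<le> (1 + m * (w - 2)) * v" using f v by (intro mult_right_mono) auto
  also have "\<dots> = e * w - (v - w) * (2 * m - 1)" unfolding e by (simp add: algebra_simps)
  also have "\<dots> \<le> e * w" using wv m by simp
  finally show ?thesis by (simp add: v_def w_def e_def f_def)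
qed

text \<open>Here e = m v + 1 - 2 m \<le> m v. Hence the range above
  \<open>n powr (- 1 / m2 H)\<close> lies within the range where the count of \<open>T\<close> is
  concentrated.\<close>

lemma inverse_m2_le_verts_div_edges:
  assumes T: "simple_graph T" "card (edges T) \<ge> 2" "two_balanced T"
  shows "1 / m2 T \<le> card (verts T) / card (edges T)"
proof -
  define m v e where "m = m2 T" and "v = real (card (verts T))" and "e = real (card (edges T))"
  have m: "1 / 2 \<le> m" using m2_ge_half[OF T(1,2)] by (simp add: m_def)
  have "card (verts T) \<ge> 3"
    using T simple_graphD(1)[OF T(1)] by (intro card_verts_gt_2[of "edges T"]) (auto simp: simple_graph_def)
  then have v: "3 \<le> v" by (simp add: v_def)
  have e: "e = 1 + m * (v - 2)"
    using T(3) v by (simp add: two_balanced_def m_def e_def v_def)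
  have "2 \<le> e" using T(2) by (simp add: e_def)
  moreover have "e \<le> m * v" unfolding e using m by (simp add: algebra_simps)
  ultimately have "1 / m \<le> v / e" using m by (simp add: field_simps)
  then show ?thesis by (simp add: m_def v_def e_def)
qed

section \<open>First moments of subgraphs in the three ranges of p\<close>

lemma power_of_powr: "0 < x \<Longrightarrow> (x powr a) ^ k = x powr (a * real k)"
  by (simp add: powr_realpow[symmetric] powr_powr)

text \<open>At p = K n^(-v/e) the exponent w - f v / e of n is non-negative by balancedness, and K^f
  \<ge> K.\<close>

lemma dense_first_moment:
  fixes n v e w f :: nat and K p :: real
  assumes "1 \<le> n" "1 \<le> K" "K * real n powr (- (real v / real e)) \<le> p" "1 \<le> f" "0 < e" "real f * v \<le> real e * w"
  shows "K \<le> real n ^ w * p ^ f"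
proof -
  have n: "1 \<le> real n" using assms(1) by simp
  have "K = K ^ 1 * real n powr 0" using n by simp
  also have "\<dots> \<le> K ^ f * real n powr (real w - real v / real e * real f)"
    using assms n by (intro mult_mono power_increasing powr_mono) (auto simp: field_simps)
  also have "\<dots> = real n ^ w * (K * real n powr (- (real v / real e))) ^ f"
  proof -
    have "(real n powr (- (real v / real e))) ^ f = real n powr (- (real v / real e * real f))"
      using n by (subst power_of_powr) auto
    then show ?thesis
      using n by (simp add: power_mult_distrib powr_diff powr_realpow powr_minus divide_inverse)
  qed
  also have "\<dots> \<le> real n ^ w * p ^ f"
    using assms by (intro mult_left_mono power_mono) auto
  finally show ?thesis .
qed

text \<open>p^(f-1) is at least n^(-(f-1)/m), hence at least n^(-(w-2)): no subgraph is expected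
  less often than a single edge. This is what makes Janson's exponent of order n^2 p.\<close>

lemma dense_two_density:
  fixes n w f :: nat and m p :: real
  assumes "1 \<le> n" "0 < m" "real n powr (- (1 / m)) \<le> p" "1 \<le> f" "2 \<le> w" "real f - 1 \<le> m * (real w - 2)"
  shows "real n ^ 2 * p \<le> real n ^ w * p ^ f"
proof -
  have n: "1 \<le> real n" using assms(1) by simp
  have "0 < real n powr (- (1 / m))" using n by simp
  then have p: "0 < p" using assms(3) by linarith
  have "real n powr (- (real w - 2)) \<le> real n powr (- (1 / m) * real (f - 1))"
    using assms n by (intro powr_mono) (auto simp: field_simps)
  also have "\<dots> = (real n powr (- (1 / m))) ^ (f - 1)"
    using n by (intro power_of_powr[symmetric]) auto
  also have "\<dots> \<le> p ^ (f - 1)" using assms by (intro power_mono) auto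
  finally have "real n powr (- real (w - 2)) \<le> p ^ (f - 1)" using assms by (simp add: of_nat_diff)
  then have 1: "1 \<le> real n ^ (w - 2) * p ^ (f - 1)"
    using n by (simp add: powr_minus powr_realpow field_simps)
  have "real n ^ 2 * p \<le> (real n ^ 2 * p) * (real n ^ (w - 2) * p ^ (f - 1))"
    using 1 p by (intro mult_right_mono[of 1 _ "real n ^ 2 * p", simplified, THEN order_trans]) (auto simp: mult_ac)
  also have "\<dots> = real n ^ (2 + (w - 2)) * p ^ (1 + (f - 1))" by (simp add: power_add mult_ac power2_eq_square)
  also have "2 + (w - 2) = w" using assms by simp
  also have "1 + (f - 1) = f" using assms by simp
  finally show ?thesis .
qed

text \<open>Compares the first moment of a densest subgraph of \<open>H\<close>, with h vertices and
  k edges, with that of a part of \<open>T\<close> it might share. By the two density bounds, k - f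
  is at least mH (h - w) + (mH - mT)(w - 2), so the quotient is at most q^(h-w) p^((mH-mT)(w-2))
  with q = n p^mH, which is small below the threshold.\<close>

lemma sparse_two_density:
  fixes n w f h k :: nat and mT mH p y :: real
  assumes n: "1 \<le> n" and p: "0 < p" "p \<le> y * real n powr (- (1 / mH))" and y: "0 < y" "y \<le> 1"
    and m: "0 < mT" "mT < mH" and w: "2 \<le> w" "w \<le> h" "3 \<le> h" and f: "f \<le> k"
    and T: "real f - 1 \<le> mT * (real w - 2)" and H: "mH * (real h - 2) = real k - 1"
  shows "real n ^ h * p ^ k \<le> y powr (mH - mT) * (real n ^ w * p ^ f)"
proof -
  have n1: "1 \<le> real n" using n by simp
  have "real n powr (- (1 / mH)) \<le> real n powr 0" using n1 m by (intro powr_mono) auto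
  then have le1: "real n powr (- (1 / mH)) \<le> 1" using n1 by simp
  have py: "p \<le> y" using p(2) mult_left_mono[OF le1, of y] y by linarith
  have p1: "p \<le> 1" using py y by simp
  define q where "q = real n * p powr mH"
  have q: "q \<le> y powr mH" "0 < q"
  proof -
    have "p powr mH \<le> (y * real n powr (- (1 / mH))) powr mH" using p m by (intro powr_mono2) auto
    also have "\<dots> = y powr mH * real n powr (- 1)" using y n1 m by (simp add: powr_mult powr_powr)
    also have "\<dots> = y powr mH / real n" using n1 by (simp add: powr_minus divide_inverse)
    finally show "q \<le> y powr mH" using n1 by (simp add: q_def field_simps)
    show "0 < q" using n1 p by (simp add: q_def)
  qed
  have yH: "y powr mH \<le> 1" using y m by (intro powr_le1) auto
  have mono: "y powr mH \<le> y powr (mH - mT)" using y m by (intro powr_mono') auto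
  \<comment> \<open>For w = 2 the second factor is trivial and the gain comes from \<open>q\<close>,
    as h \<ge> 3; for w \<ge> 3 it comes from p \<le> y.\<close>
  have key: "q ^ (h - w) * p powr ((mH - mT) * real (w - 2)) \<le> y powr (mH - mT)"
  proof (cases "w = 2")
    case True
    have "q ^ (h - w) \<le> q ^ 1" using q yH True w by (intro power_decreasing) auto
    then show ?thesis using True q mono p by simp
  next
    case False
    have "q ^ (h - w) \<le> 1" using q yH by (intro power_le_one) auto
    moreover have "p powr ((mH - mT) * real (w - 2)) \<le> p powr (mH - mT)"
      using False w p p1 m by (intro powr_mono') (auto simp: of_nat_diff)
    moreover have "p powr (mH - mT) \<le> y powr (mH - mT)" using p py m by (intro powr_mono2) auto
    ultimately show ?thesis using mult_mono[of "q ^ (h - w)" 1 "p powr ((mH - mT) * real (w - 2))" "y powr (mH - mT)"] q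
      by auto
  qed
  have "mH * real (h - w) + (mH - mT) * real (w - 2) = mH * (real h - 2) - mT * (real w - 2)"
    using w by (simp add: of_nat_diff algebra_simps)
  also have "\<dots> \<le> real (k - f)" using T H f by (simp add: of_nat_diff)
  finally have "p powr real (k - f) \<le> p powr (mH * real (h - w) + (mH - mT) * real (w - 2))"
    using p p1 by (intro powr_mono') auto
  then have "real n ^ (h - w) * p ^ (k - f)
     \<le> real n ^ (h - w) * p powr (mH * real (h - w) + (mH - mT) * real (w - 2))"
    using p by (intro mult_left_mono) (auto simp: powr_realpow)
  also have "\<dots> = q ^ (h - w) * p powr ((mH - mT) * real (w - 2))"
    using p by (simp add: q_def power_mult_distrib powr_add power_of_powr)
  also note key
  finally have "real n ^ (h - w) * p ^ (k - f) * (real n ^ w * p ^ f) \<le> y powr (mH - mT) * (real n ^ w * p ^ f)"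
    using p by (intro mult_right_mono) auto
  moreover have "real n ^ h * p ^ k = real n ^ (h - w) * p ^ (k - f) * (real n ^ w * p ^ f)"
  proof -
    have "real n ^ h = real n ^ (h - w) * real n ^ w" "p ^ k = p ^ (k - f) * p ^ f"
      using w f by (simp_all flip: power_add)
    then show ?thesis by (simp add: mult_ac)
  qed
  ultimately show ?thesis by simp
qed

section \<open>Events of vanishing probability and concentration of subgraph counts\<close>

definition negligible :: "(nat \<Rightarrow> real) \<Rightarrow> (nat \<Rightarrow> nat set set \<Rightarrow> bool) \<Rightarrow> bool" where
  "negligible p B \<longleftrightarrow> (\<lambda>n. pexp (p n) (all_pairs {..<n}) (\<lambda>R. of_bool (B n R))) \<longlonglongrightarrow> 0"

lemma negligibleI:
  assumes "\<And>n. 0 \<le> p n \<and> p n \<le> 1"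
    and "\<And>d. 0 < d \<Longrightarrow> \<forall>\<^sub>F n in sequentially. pexp (p n) (all_pairs {..<n}) (\<lambda>R. of_bool (B n R)) \<le> d"
  shows "negligible p B"
  unfolding negligible_def
proof (rule tendstoI)
  fix d :: real assume "0 < d"
  then have "\<forall>\<^sub>F n in sequentially. pexp (p n) (all_pairs {..<n}) (\<lambda>R. of_bool (B n R)) \<le> d / 2"
    using assms(2)[of "d/2"] by simp
  then show "\<forall>\<^sub>F n in sequentially. dist (pexp (p n) (all_pairs {..<n}) (\<lambda>R. of_bool (B n R))) 0 < d"
  proof (rule eventually_mono)
    fix n assume "pexp (p n) (all_pairs {..<n}) (\<lambda>R. of_bool (B n R)) \<le> d / 2"
    moreover have "0 \<le> pexp (p n) (all_pairs {..<n}) (\<lambda>R. of_bool (B n R))"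
      using assms(1) by (intro pexp_nonneg) auto
    ultimately show "dist (pexp (p n) (all_pairs {..<n}) (\<lambda>R. of_bool (B n R))) 0 < d"
      using \<open>0 < d\<close> by simp
  qed
qed

lemma negligibleD: "negligible p B \<Longrightarrow> 0 < d \<Longrightarrow>
   \<forall>\<^sub>F n in sequentially. pexp (p n) (all_pairs {..<n}) (\<lambda>R. of_bool (B n R)) < d"
  unfolding negligible_def by (rule order_tendstoD)

lemma negligible_disj:
  assumes p: "\<And>n. 0 \<le> p n \<and> p n \<le> 1" and "negligible p A" "negligible p B"
  shows "negligible p (\<lambda>n R. A n R \<or> B n R)"
proof (rule negligibleI[OF p])
  fix d :: real assume "0 < d"
  then have "0 < d / 2" by simp
  from negligibleD[OF assms(2) this] negligibleD[OF assms(3) this]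
  show "\<forall>\<^sub>F n in sequentially. pexp (p n) (all_pairs {..<n}) (\<lambda>R. of_bool (A n R \<or> B n R)) \<le> d"
  proof eventually_elim
    case (elim n)
    have "pexp (p n) (all_pairs {..<n}) (\<lambda>R. of_bool (A n R \<or> B n R))
       \<le> pexp (p n) (all_pairs {..<n}) (\<lambda>R. of_bool (A n R) + of_bool (B n R))"
      using p by (intro pexp_mono) (auto simp: of_bool_def)
    then show ?case using elim by (simp add: pexp_add)
  qed
qed

lemma negligible_mono:
  assumes p: "\<And>n. 0 \<le> p n \<and> p n \<le> 1" and B: "negligible p B"
    and "\<forall>\<^sub>F n in sequentially. \<forall>R\<subseteq>all_pairs {..<n}. A n R \<longrightarrow> B n R"
  shows "negligible p A"
proof (rule negligibleI[OF p])
  fix d :: real assume "0 < d"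
  from negligibleD[OF B this] assms(3)
  show "\<forall>\<^sub>F n in sequentially. pexp (p n) (all_pairs {..<n}) (\<lambda>R. of_bool (A n R)) \<le> d"
  proof eventually_elim
    case (elim n)
    have "pexp (p n) (all_pairs {..<n}) (\<lambda>R. of_bool (A n R))
       \<le> pexp (p n) (all_pairs {..<n}) (\<lambda>R. of_bool (B n R))"
      using p elim(2) by (intro pexp_mono) (auto simp: of_bool_def)
    then show ?case using elim by linarith
  qed
qed

lemma whp_if_negligible:
  assumes p: "\<And>n. 0 \<le> p n \<and> p n \<le> 1" and B: "negligible p (\<lambda>n R. \<not> Q n ({..<n}, R))"
  shows "whp (\<lambda>n. binomial_random_graph n (p n)) Q"
proof -
  have "measure_pmf.prob (binomial_random_graph n (p n)) {x. Q n x}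
     = 1 - pexp (p n) (all_pairs {..<n}) (\<lambda>R. of_bool (\<not> Q n ({..<n}, R)))" for n
  proof -
    have "measure_pmf.prob (binomial_random_graph n (p n)) {x. Q n x}
       = pexp (p n) (all_pairs {..<n}) (\<lambda>R. of_bool (Q n ({..<n}, R)))"
      using p by (intro prob_binomial_random_graph) auto
    also have "\<dots> = pexp (p n) (all_pairs {..<n}) (\<lambda>R. 1 - of_bool (\<not> Q n ({..<n}, R)))"
      by (intro pexp_cong) (auto simp: of_bool_def)
    also have "\<dots> = 1 - pexp (p n) (all_pairs {..<n}) (\<lambda>R. of_bool (\<not> Q n ({..<n}, R)))"
      by (simp only: pexp_diff pexp_const finite_all_pairs finite_lessThan)
    finally show ?thesis .
  qed
  moreover have "(\<lambda>n. 1 - pexp (p n) (all_pairs {..<n}) (\<lambda>R. of_bool (\<not> Q n ({..<n}, R)))) \<longlonglongrightarrow> 1 - 0"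
    using B unfolding negligible_def by (intro tendsto_diff tendsto_const)
  ultimately show ?thesis unfolding whp_def by simp
qed

definition overlap_const :: "'a ugraph \<Rightarrow> 'b ugraph \<Rightarrow> real" where
  "overlap_const T H = real (2 ^ card (verts T) * card (verts H) ^ card (verts T))"

lemma overlap_const_pos:
  assumes "simple_graph H" "verts H \<noteq> {}"
  shows "0 < overlap_const T H"
  using assms by (simp add: overlap_const_def card_gt_0_iff simple_graphD(1))

lemma family_emb:
  fixes p :: real
  assumes T: "simple_graph T" and p: "0 \<le> p" "p \<le> 1" and I: "I \<subseteq> emb T (complete_ugraph n)"
    and V: "finite V" "\<And>\<phi>. \<phi> \<in> I \<Longrightarrow> edge_image T \<phi> \<subseteq> V"
  shows "set_family V I (edge_image T) p" "set_family.mu I (edge_image T) p = card I * p ^ card (edges T)"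
proof -
  have "finite (emb T (complete_ugraph n))"
    by (intro finite_emb T) (simp add: complete_ugraph_def)
  then have finI: "finite I" using I finite_subset by blast
  then show sf: "set_family V I (edge_image T) p" using V p by unfold_locales auto
  have "p ^ card (edge_image T \<phi>) = p ^ card (edges T)" if "\<phi> \<in> I" for \<phi>
    using I that by (subst card_edge_image[OF T]) (auto simp: emb_def)
  then show "set_family.mu I (edge_image T) p = card I * p ^ card (edges T)"
    unfolding set_family.mu_def[OF sf] by simp
qed

text \<open>A subfamily inherits the bound for all embeddings, so a single \<open>D\<close> serves
  all fingerprints at once.\<close>

lemma overlap_family_le:
  fixes p :: real
  assumes T: "simple_graph T" "verts T \<noteq> {}" and p: "0 < p" "p \<le> 1" and D: "0 < D" and n: "0 < n"
    and I: "I \<subseteq> emb T (complete_ugraph n)"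
    and dens: "\<And>W F. W \<subseteq> verts T \<Longrightarrow> F \<subseteq> edges T \<Longrightarrow> F \<noteq> {} \<Longrightarrow> \<Union>F \<subseteq> W \<Longrightarrow> D \<le> real n ^ card W * p ^ card F"
  shows "overlap p I (edge_image T) I (edge_image T)
     \<le> overlap_const T T * (real n ^ card (verts T) * p ^ card (edges T))\<^sup>2 / D"
proof -
  have "finite (emb T (complete_ugraph n))"
    by (intro finite_emb T) (simp add: complete_ugraph_def)
  then have "overlap p I (edge_image T) I (edge_image T)
      \<le> overlap p (emb T (complete_ugraph n)) (edge_image T) (emb T (complete_ugraph n)) (edge_image T)"
    using I p by (intro overlap_mono) auto
  also have "\<dots> \<le> overlap_const T T * (real n ^ (card (verts T) + card (verts T)) * p ^ (card (edges T) + card (edges T))) / D"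
    unfolding overlap_const_def using assms by (intro overlap_emb_le) auto
  finally show ?thesis by (simp add: power2_eq_square power_add mult_ac)
qed

text \<open>The deviation is measured against n^v p^e and not against the mean. This admits any
  deterministic subfamily, in particular the copies inside a fixed \<open>H\<close>-free
  graph.\<close>

lemma concentration:
  fixes T :: "'a ugraph" and p :: "nat \<Rightarrow> real" and e :: real
  assumes T: "simple_graph T" "verts T \<noteq> {}" and p: "\<And>n. 0 \<le> p n \<and> p n \<le> 1"
    and I: "\<And>n. I n \<subseteq> emb T (complete_ugraph n)" and e: "0 < e"
    and dens: "\<And>M. \<forall>\<^sub>F n in sequentially. 0 < p n \<and> (\<forall>W F. W \<subseteq> verts T \<longrightarrow> F \<subseteq> edges T \<longrightarrow> F \<noteq> {} \<longrightarrow> \<Union>F \<subseteq> W \<longrightarrow>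
        M \<le> real n ^ card W * p n ^ card F)"
  shows "negligible p (\<lambda>n R. e * real n ^ card (verts T) * p n ^ card (edges T)
      \<le> \<bar>count_in (I n) (edge_image T) R - card (I n) * p n ^ card (edges T)\<bar>)"
proof (rule negligibleI[OF p])
  fix d :: real assume d: "0 < d"
  define C where "C = overlap_const T T"
  have C: "0 < C" using T by (simp add: C_def overlap_const_pos)
  \<comment> \<open>Chebyshev leaves \<open>C / (M * e\<^sup>2)\<close>, which is \<open>d\<close>
    for this \<open>M\<close>.\<close>
  define M where "M = C / (e\<^sup>2 * d)"
  have M: "0 < M" using C e d by (simp add: M_def)
  show "\<forall>\<^sub>F n in sequentially. pexp (p n) (all_pairs {..<n})
      (\<lambda>R. of_bool (e * real n ^ card (verts T) * p n ^ card (edges T)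
        \<le> \<bar>count_in (I n) (edge_image T) R - card (I n) * p n ^ card (edges T)\<bar>)) \<le> d"
    using dens[of M] eventually_gt_at_top[of 0]
  proof eventually_elim
    case (elim n)
    let ?s = "real n ^ card (verts T) * p n ^ card (edges T)"
    have s: "0 < ?s" using elim by simp
    have V: "edge_image T \<phi> \<subseteq> all_pairs {..<n}" if "\<phi> \<in> I n" for \<phi>
      using I[of n] that edge_image_sub_pairs[OF T(1)] by blast
    have fin: "finite (all_pairs {..<n})" by simp
    have fe: "set_family (all_pairs {..<n}) (I n) (edge_image T) (p n)"
      "set_family.mu (I n) (edge_image T) (p n) = card (I n) * p n ^ card (edges T)"
      using p[of n] I[of n] V by (auto intro: family_emb[OF T(1) _ _ _ fin])
    have "pexp (p n) (all_pairs {..<n}) (\<lambda>R. of_bool (e * ?s \<le> \<bar>count_in (I n) (edge_image T) R - card (I n) * p n ^ card (edges T)\<bar>))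
       \<le> overlap (p n) (I n) (edge_image T) (I n) (edge_image T) / (e * ?s)\<^sup>2"
      using set_family.chebyshev[OF fe(1), of "e * ?s", unfolded fe(2)] e s by simp
    also have "\<dots> \<le> (C * ?s\<^sup>2 / M) / (e * ?s)\<^sup>2"
      unfolding C_def using elim p T M by (intro divide_right_mono overlap_family_le I) auto
    also have "\<dots> = d" using elim e C d by (simp add: M_def power_mult_distrib)
    finally show ?case by (simp add: mult_ac)
  qed
qed

section \<open>Below the threshold\<close>

lemma emb_subgraph_nonempty:
  assumes H: "simple_graph H" "subgraph H' H" and ne: "emb H G \<noteq> {}"
  shows "emb H' G \<noteq> {}"
proof -
  from ne obtain \<phi> where \<phi>: "\<phi> \<in> emb H G" by blast
  have sub: "verts H' \<subseteq> verts H" "edges H' \<subseteq> edges H" "simple_graph H'"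
    using H(2) by (auto simp: subgraph_def)
  let ?r = "restrict \<phi> (verts H')"
  have "?r ` e = \<phi> ` e" if "e \<in> edges H'" for e
    using simple_graphD(3)[OF sub(3) that] by (intro image_cong refl) auto
  then have "?r \<in> emb H' G"
    using \<phi> sub by (auto simp: emb_def PiE_iff inj_on_restrict_eq intro: inj_on_subset)
  then show ?thesis by blast
qed

lemma abs_diff_le_scaled:
  fixes a x y b :: real
  assumes "0 < a" "\<bar>a * x - a * y\<bar> \<le> a * b"
  shows "\<bar>x - y\<bar> \<le> b"
proof -
  have "a * \<bar>x - y\<bar> = \<bar>a * x - a * y\<bar>"
    using assms(1) by (simp add: abs_mult right_diff_distrib[symmetric])
  then show ?thesis using assms by (metis mult_le_cancel_left_pos)
qed

lemma smallo_lower: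
  fixes f p :: "nat \<Rightarrow> real"
  assumes "f \<in> o(p)" "\<And>n. 0 \<le> p n" "\<And>n. 0 \<le> f n" "0 < K"
  shows "\<forall>\<^sub>F n in sequentially. K * f n \<le> p n"
proof -
  from landau_o.smallD[OF assms(1), of "1 / K"] assms(4)
  have "\<forall>\<^sub>F n in sequentially. norm (f n) \<le> 1 / K * norm (p n)" by simp
  then show ?thesis
    by (rule eventually_mono) (use assms in \<open>simp add: field_simps\<close>)
qed

lemma dense_above_threshold:
  fixes T :: "'a ugraph" and p :: "nat \<Rightarrow> real"
  assumes T: "simple_graph T" "card (edges T) \<ge> 2" "two_balanced T"
    and p: "\<And>n. 0 \<le> p n \<and> p n \<le> 1"
    and lo: "(\<lambda>n. real n powr (- (real (card (verts T)) / real (card (edges T))))) \<in> o(p)"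
  shows "\<forall>\<^sub>F n in sequentially. 0 < p n \<and> (\<forall>W F. W \<subseteq> verts T \<longrightarrow> F \<subseteq> edges T \<longrightarrow> F \<noteq> {} \<longrightarrow> \<Union>F \<subseteq> W \<longrightarrow>
        M \<le> real n ^ card W * p n ^ card F)"
proof -
  \<comment> \<open>The maximum with 1 is there because \<open>dense_first_moment\<close> uses K^f
    \<ge> K.\<close>
  have "\<forall>\<^sub>F n in sequentially. max 1 M * real n powr (- (real (card (verts T)) / real (card (edges T)))) \<le> p n"
    using p by (intro smallo_lower[OF lo]) auto
  then show ?thesis using eventually_ge_at_top[of 1]
  proof eventually_elim
    case (elim n)
    have "0 < max 1 M * real n powr (- (real (card (verts T)) / real (card (edges T))))"
      using elim(2) by (intro mult_pos_pos) auto
    then have "0 < p n" using elim(1) by linarith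
    moreover have "M \<le> real n ^ card W * p n ^ card F"
      if WF: "W \<subseteq> verts T" "F \<subseteq> edges T" "F \<noteq> {}" "\<Union>F \<subseteq> W" for W F
    proof -
      have "0 \<le> m2 T" using m2_ge_half[OF T(1,2)] by simp
      then have "1 \<le> card F" using edges_le_m2(2)[OF T(1) _ WF] by simp
      then have "max 1 M \<le> real n ^ card W * p n ^ card F"
        using balanced_of_two_balanced[OF T WF] elim T(2)
        by (intro dense_first_moment[of n "max 1 M" "card (verts T)" "card (edges T)"]) auto
      then show ?thesis by simp
    qed
    ultimately show ?case by blast
  qed
qed

lemma ex_in_below_threshold:
  fixes T :: "'a ugraph" and H :: "'b ugraph" and p :: "nat \<Rightarrow> real"
  assumes T: "simple_graph T" "card (edges T) \<ge> 2" "two_balanced T"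
    and H: "simple_graph H" "card (edges H) \<ge> 2"
    and m: "m2 H > m2 T"
    and p: "\<And>n. 0 \<le> p n \<and> p n \<le> 1"
    and lo: "(\<lambda>n. real n powr (- (real (card (verts T)) / real (card (edges T))))) \<in> o(p)"
    and hi: "p \<in> o(\<lambda>n. real n powr (- (1 / m2 H)))"
    and eps: "0 < \<epsilon>"
  shows "whp (\<lambda>n. binomial_random_graph n (p n))
          (\<lambda>n G. \<bar>real (ex_in G T H) - real (num_copies T (complete_ugraph n)) * p n ^ card (edges T)\<bar>
                  \<le> \<epsilon> * real n ^ card (verts T) * p n ^ card (edges T))"
proof -
  let ?v = "card (verts T)" and ?e = "card (edges T)"
  define a where "a = real (card (auts T))"
  have a: "0 < a" using card_auts_pos[OF T(1)] by (simp add: a_def)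
  \<comment> \<open>The factor \<open>a\<close> passes from copies to embeddings; one half is for
    the concentration of the total, one for the copies destroyed.\<close>
  define e1 where "e1 = \<epsilon> * a / 2"
  have e1: "0 < e1" using a eps by (simp add: e1_def)
  have mT: "1 / 2 \<le> m2 T" using m2_ge_half[OF T(1,2)] .
  have vT: "verts T \<noteq> {}"
    using card_verts_gt_2[of "edges T" "verts T"] T simple_graphD(1)[OF T(1)] by (auto simp: simple_graph_def)
  obtain H' where H': "subgraph H' H" "card (edges H') \<ge> 2" "card (verts H') \<ge> 3"
    "m2 H * (real (card (verts H')) - 2) = real (card (edges H')) - 1"
    using m2_attained[OF H] by metis
  have sH': "simple_graph H'" "verts H' \<noteq> {}" "edges H' \<noteq> {}" using H' by (auto simp: subgraph_def)
  let ?IT = "\<lambda>n. emb T (complete_ugraph n)" and ?IH = "\<lambda>n. emb H' (complete_ugraph n)"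
  \<comment> \<open>Dominates the number of copies of \<open>T\<close> lost when all copies of
    \<open>H'\<close> in \<open>R\<close> are removed.\<close>
  let ?pairs = "\<lambda>n R. \<Sum>\<phi>\<in>?IT n. \<Sum>\<psi>\<in>?IH n.
      of_bool (edge_image T \<phi> \<inter> edge_image H' \<psi> \<noteq> {}) * of_bool (edge_image T \<phi> \<union> edge_image H' \<psi> \<subseteq> R) :: real"
  have finI: "finite (?IT n)" "finite (?IH n)" for n
    using T sH' by (auto intro!: finite_emb simp: complete_ugraph_def)
  have B1: "negligible p (\<lambda>n R. e1 * real n ^ ?v * p n ^ ?e
      \<le> \<bar>count_in (?IT n) (edge_image T) R - card (?IT n) * p n ^ ?e\<bar>)"
    using dense_above_threshold[OF T p lo] by (intro concentration[OF T(1) vT p subset_refl e1])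
  have B2: "negligible p (\<lambda>n R. e1 * real n ^ ?v * p n ^ ?e \<le> ?pairs n R)"
  proof (rule negligibleI[OF p])
    fix d :: real assume d: "0 < d"
    define C where "C = overlap_const T H'"
    have C: "0 < C" using sH' by (simp add: C_def overlap_const_pos)
    \<comment> \<open>The mean of \<open>?pairs\<close> will be at most \<open>C * x\<close> times
      n^v p^e, so Markov's inequality at level \<open>e1\<close> gives exactly \<open>d\<close>.
      Then \<open>y\<close> is the distance below the threshold that produces the factor
      \<open>x\<close> in \<open>sparse_two_density\<close>.\<close>
    define x where "x = e1 * d / C"
    have x: "0 < x" using e1 d C by (simp add: x_def)
    define y where "y = min 1 (x powr (1 / (m2 H - m2 T)))"
    have y: "0 < y" "y \<le> 1" using x by (auto simp: y_def)
    have yx: "y powr (m2 H - m2 T) \<le> x"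
    proof -
      have "y powr (m2 H - m2 T) \<le> (x powr (1 / (m2 H - m2 T))) powr (m2 H - m2 T)"
        using y m by (intro powr_mono2) (auto simp: y_def)
      then show ?thesis using x m by (simp add: powr_powr)
    qed
    have ev: "\<forall>\<^sub>F n in sequentially. norm (p n) \<le> y * norm (real n powr (- (1 / m2 H)))"
      using landau_o.smallD[OF hi y(1)] .
    show "\<forall>\<^sub>F n in sequentially. pexp (p n) (all_pairs {..<n})
        (\<lambda>R. of_bool (e1 * real n ^ ?v * p n ^ ?e \<le> ?pairs n R)) \<le> d"
      using ev dense_above_threshold[OF T p lo, where M = 1] eventually_gt_at_top[of 0]
    proof eventually_elim
      case (elim n)
      have pn: "0 < p n" "p n \<le> 1" using elim p by auto
      have p_le: "p n \<le> y * real n powr (- (1 / m2 H))" using elim pn by simp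
      let ?P = "all_pairs {..<n}"
      \<comment> \<open>Dividing by this \<open>D\<close> cancels the first moment of
        \<open>H'\<close> in the overlap bound and leaves the factor \<open>x\<close>.\<close>
      define D where "D = real n ^ card (verts H') * p n ^ card (edges H') / x"
      have D: "0 < D" using pn elim x by (simp add: D_def)
      have E: "pexp (p n) ?P (?pairs n) = overlap (p n) (?IT n) (edge_image T) (?IH n) (edge_image H')"
      proof -
        have "pexp (p n) ?P (\<lambda>R. of_bool (edge_image T \<phi> \<union> edge_image H' \<psi> \<subseteq> R)) = p n ^ card (edge_image T \<phi> \<union> edge_image H' \<psi>)"
          if "\<phi> \<in> ?IT n" "\<psi> \<in> ?IH n" for \<phi> \<psi>
          using edge_image_sub_pairs[OF T(1) that(1)] edge_image_sub_pairs[OF sH'(1) that(2)]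
          by (intro pexp_superset_prob) auto
        then show ?thesis unfolding overlap_def pexp_sum pexp_cmult by (intro sum.cong refl) simp
      qed
      also have "\<dots> \<le> C * (real n ^ (?v + card (verts H')) * p n ^ (?e + card (edges H'))) / D"
        unfolding C_def overlap_const_def
      proof (intro overlap_emb_le T sH' pn D)
        show "0 < n" using elim by simp
        fix W F assume WF: "W \<subseteq> verts T" "F \<subseteq> edges T" "F \<noteq> {}" "\<Union>F \<subseteq> W"
          and le: "card W \<le> card (verts H')" "card F \<le> card (edges H')"
        have "0 \<le> m2 T" using mT by simp
        note ed = edges_le_m2[OF T(1) this WF]
        have "real n ^ card (verts H') * p n ^ card (edges H')
           \<le> y powr (m2 H - m2 T) * (real n ^ card W * p n ^ card F)"
          using elim pn p_le y mT m ed le H' by (intro sparse_two_density) auto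
        also have "\<dots> \<le> x * (real n ^ card W * p n ^ card F)"
          using yx pn by (intro mult_right_mono) auto
        finally show "D \<le> real n ^ card W * p n ^ card F"
          using x by (simp add: D_def field_simps)
      qed
      also have "\<dots> = C * x * (real n ^ ?v * p n ^ ?e)"
        using pn elim x by (simp add: D_def power_add field_simps)
      also have "\<dots> = d * (e1 * real n ^ ?v * p n ^ ?e)" using C by (simp add: x_def)
      finally have mean: "pexp (p n) ?P (?pairs n) \<le> d * (e1 * real n ^ ?v * p n ^ ?e)" .
      have t: "0 < e1 * real n ^ ?v * p n ^ ?e" using e1 elim pn by simp
      have "pexp (p n) ?P (\<lambda>R. of_bool (e1 * real n ^ ?v * p n ^ ?e \<le> ?pairs n R))
         \<le> pexp (p n) ?P (?pairs n) / (e1 * real n ^ ?v * p n ^ ?e)"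
        using pn t by (intro markov_pexp) (auto intro!: sum_nonneg)
      also have "\<dots> \<le> d" using mean t by (simp add: pos_divide_le_eq)
      finally show ?case .
    qed
  qed
  have "negligible p (\<lambda>n R. \<not> \<bar>real (ex_in ({..<n}, R) T H) - real (num_copies T (complete_ugraph n)) * p n ^ ?e\<bar>
                  \<le> \<epsilon> * real n ^ ?v * p n ^ ?e)"
  proof (rule negligible_mono[OF p negligible_disj[OF p B1 B2]], rule eventually_mono[OF eventually_gt_at_top[of 0]], intro allI impI)
    fix n :: nat and R
    assume n: "0 < n" and R: "R \<subseteq> all_pairs {..<n}"
      and bad: "\<not> \<bar>real (ex_in ({..<n}, R) T H) - real (num_copies T (complete_ugraph n)) * p n ^ ?e\<bar>
                  \<le> \<epsilon> * real n ^ ?v * p n ^ ?e"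
    let ?G = "({..<n}, R)" and ?s = "real n ^ ?v * p n ^ ?e"
    have sG: "simple_graph ?G" using R by (rule simple_spanning)
    have s0: "0 \<le> ?s" using p by simp
    have cnt: "count_in (?IT n) (edge_image T) R = card (emb T ?G)"
      using count_in_emb[OF T(1), of "all_pairs {..<n}" n "{..<n}" R] R
      by (simp add: complete_ugraph_def Int_absorb1)
    have cK: "real (card (?IT n)) = a * num_copies T (complete_ugraph n)"
      using card_emb[OF T(1) simple_complete, of n] by (simp add: a_def)
    show "e1 * real n ^ ?v * p n ^ ?e \<le> \<bar>count_in (?IT n) (edge_image T) R - card (?IT n) * p n ^ ?e\<bar> \<or>
        e1 * real n ^ ?v * p n ^ ?e \<le> ?pairs n R"
    proof (rule ccontr)
      assume "\<not> ?thesis"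
      then have g1: "\<bar>card (emb T ?G) - a * num_copies T (complete_ugraph n) * p n ^ ?e\<bar> < e1 * ?s"
        and g2: "?pairs n R < e1 * ?s" unfolding cnt cK by (auto simp: mult_ac)
      have eH: "edges H \<noteq> {}" using H by auto
      obtain F where F: "subgraph F ?G" "free_of H F" "num_copies T F = ex_in ?G T H"
        using ex_in_attained[OF sG H(1) eH] by metis
      have "card (emb T F) \<le> card (emb T ?G)"
        using F(1) T by (intro card_mono finite_emb emb_mono) (auto simp: subgraph_def)
      then have up: "a * ex_in ?G T H \<le> card (emb T ?G)"
        using card_emb[OF T(1), of F] F by (simp add: a_def subgraph_def flip: of_nat_mult)
      \<comment> \<open>Every edge in a copy of \<open>H'\<close> is deleted. What remains is
        \<open>H'\<close>-free, hence \<open>H\<close>-free, and so competes in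
        \<open>ex_in\<close>.\<close>
      define E' where "E' = R - (\<Union>\<psi>\<in>emb H' ?G. edge_image H' \<psi>)"
      have E'R: "E' \<subseteq> R" by (auto simp: E'_def)
      have E'P: "E' \<subseteq> all_pairs {..<n}" using E'R R by blast
      have sE': "simple_graph ({..<n}, E')" using E'P by (rule simple_spanning)
      have "emb H' ({..<n}, E') = {}"
      proof (rule ccontr)
        assume "emb H' ({..<n}, E') \<noteq> {}"
        then obtain \<psi> where \<psi>: "\<psi> \<in> emb H' ({..<n}, E')" by blast
        then have "\<psi> \<in> emb H' ?G" using emb_mono[of "({..<n}, E')" ?G H'] E'R by auto
        moreover have "edge_image H' \<psi> \<subseteq> E'" using \<psi> by (auto simp: emb_def edge_image_def)
        ultimately have "edge_image H' \<psi> = {}" by (auto simp: E'_def)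
        then show False using sH' by (simp add: edge_image_def)
      qed
      then have "emb H ({..<n}, E') = {}" using emb_subgraph_nonempty[OF H(1) H'(1)] by blast
      then have "num_copies T ({..<n}, E') \<le> ex_in ?G T H"
        using E'R sE' sG H(1) by (intro ex_in_ge) (auto simp: free_of_iff subgraph_def)
      then have low1: "card (emb T ({..<n}, E')) \<le> a * ex_in ?G T H"
        using card_emb[OF T(1) sE'] a by (simp add: a_def)
      have low2: "real (card (emb T ?G)) - card (emb T ({..<n}, E')) \<le> ?pairs n R"
      proof -
        have sub: "emb T ({..<n}, E') \<subseteq> emb T ?G" using E'R by (intro emb_mono) auto
        have finG: "finite (emb T ?G)" using T by (intro finite_emb) auto
        have GI: "emb T ?G \<subseteq> ?IT n" using R by (intro emb_mono) (auto simp: complete_ugraph_def)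
        have HI: "emb H' ?G \<subseteq> ?IH n" using R by (intro emb_mono) (auto simp: complete_ugraph_def)
        have "real (card (emb T ?G)) - card (emb T ({..<n}, E')) = card (emb T ?G - emb T ({..<n}, E'))"
          using sub finG by (simp add: card_Diff_subset finite_subset of_nat_diff card_mono)
        also have "\<dots> = (\<Sum>\<phi>\<in>emb T ?G - emb T ({..<n}, E'). 1)" by simp
        also have "\<dots> \<le> (\<Sum>\<phi>\<in>emb T ?G - emb T ({..<n}, E'). \<Sum>\<psi>\<in>?IH n.
            of_bool (edge_image T \<phi> \<inter> edge_image H' \<psi> \<noteq> {}) * of_bool (edge_image T \<phi> \<union> edge_image H' \<psi> \<subseteq> R))"
        proof (intro sum_mono)
          fix \<phi> assume \<phi>: "\<phi> \<in> emb T ?G - emb T ({..<n}, E')"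
          then have \<phi>R: "edge_image T \<phi> \<subseteq> R" by (auto simp: emb_def edge_image_def)
          have "\<not> edge_image T \<phi> \<subseteq> E'" using \<phi> by (auto simp: emb_def edge_image_def)
          then obtain \<psi> where \<psi>: "\<psi> \<in> emb H' ?G" "edge_image T \<phi> \<inter> edge_image H' \<psi> \<noteq> {}"
            using \<phi>R by (auto simp: E'_def)
          have "edge_image H' \<psi> \<subseteq> R" using \<psi>(1) by (auto simp: emb_def edge_image_def)
          then have "1 = (of_bool (edge_image T \<phi> \<inter> edge_image H' \<psi> \<noteq> {}) * of_bool (edge_image T \<phi> \<union> edge_image H' \<psi> \<subseteq> R) :: real)"
            using \<psi>(2) \<phi>R by simp
          also have "\<dots> \<le> (\<Sum>\<psi>\<in>?IH n. of_bool (edge_image T \<phi> \<inter> edge_image H' \<psi> \<noteq> {}) * of_bool (edge_image T \<phi> \<union> edge_image H' \<psi> \<subseteq> R))"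
            using \<psi>(1) HI finI(2) by (intro member_le_sum) auto
          finally show "1 \<le> (\<Sum>\<psi>\<in>?IH n. of_bool (edge_image T \<phi> \<inter> edge_image H' \<psi> \<noteq> {}) * of_bool (edge_image T \<phi> \<union> edge_image H' \<psi> \<subseteq> R) :: real)" .
        qed
        also have "\<dots> \<le> ?pairs n R"
          using GI finI by (intro sum_mono2) (auto intro!: sum_nonneg)
        finally show ?thesis .
      qed
      have "\<bar>a * ex_in ?G T H - a * num_copies T (complete_ugraph n) * p n ^ ?e\<bar> \<le> 2 * e1 * ?s"
      proof -
        have "real (card (emb T ?G)) - card (emb T ({..<n}, E')) < e1 * ?s" using low2 g2 by linarith
        then show ?thesis using g1 up low1 by linarith
      qed
      then have "\<bar>a * ex_in ?G T H - a * (num_copies T (complete_ugraph n) * p n ^ ?e)\<bar> \<le> a * (\<epsilon> * ?s)"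
        by (simp add: e1_def mult_ac)
      from abs_diff_le_scaled[OF a this] show False using bad by (simp add: mult_ac)
    qed
  qed
  then show ?thesis by (rule whp_if_negligible[OF p])
qed

section \<open>Containers for graphs\<close>

text \<open>
  Isolated vertices of \<open>H\<close> are dropped because an \<open>H\<close>-free subgraph need not be spanning.
\<close>

definition core :: "'a ugraph \<Rightarrow> 'a ugraph" where
  "core H = (\<Union>(edges H), edges H)"

lemma subgraph_core:
  assumes "simple_graph H"
  shows "subgraph (core H) H"
  using simple_graphD[OF assms] finite_subset[of "\<Union>(edges H)" "verts H"]
  by (auto simp: subgraph_def core_def simple_graph_def all_pairs_def)

text \<open>The isolated vertices of \<open>H\<close> are placed injectively outside the image of
  the core, where the cardinality hypothesis leaves room.\<close>

lemma emb_core_extend: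
  assumes H: "simple_graph H" and G: "finite (verts G)" "card (verts H) \<le> card (verts G)"
    and ne: "emb (core H) G \<noteq> {}"
  shows "emb H G \<noteq> {}"
proof -
  define U where "U = \<Union>(edges H)"
  obtain \<phi> where \<phi>: "\<phi> \<in> emb (core H) G" using ne by blast
  have U: "U \<subseteq> verts H" "finite U"
    using simple_graphD(1,3)[OF H] finite_subset unfolding U_def by (blast, metis Sup_least finite_subset)
  have inj: "inj_on \<phi> U" and im: "\<phi> ` U \<subseteq> verts G" and e: "\<And>e. e \<in> edges H \<Longrightarrow> \<phi> ` e \<in> edges G"
    using \<phi> by (auto simp: emb_def core_def U_def)
  have "card (verts H - U) = card (verts H) - card (\<phi> ` U)"
    using U inj by (simp add: card_Diff_subset card_image)
  also have "\<dots> \<le> card (verts G) - card (\<phi> ` U)" using G by simp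
  also have "\<dots> = card (verts G - \<phi> ` U)" using U im by (simp add: card_Diff_subset)
  finally obtain g where g: "g ` (verts H - U) \<subseteq> verts G - \<phi> ` U" "inj_on g (verts H - U)"
    using card_le_inj[of "verts H - U" "verts G - \<phi> ` U"] simple_graphD(1)[OF H] G by auto
  define \<theta> where "\<theta> = (\<lambda>x. if x \<in> U then \<phi> x else if x \<in> verts H then g x else undefined)"
  have "\<theta> \<in> emb H G"
  proof (rule embI)
    show "\<theta> \<in> extensional (verts H)" using U by (auto simp: \<theta>_def extensional_def)
    show "\<theta> ` verts H \<subseteq> verts G" using im g(1) by (auto simp: \<theta>_def)
    show "inj_on \<theta> (verts H)"
    proof (rule inj_onI)
      fix x y assume xy: "x \<in> verts H" "y \<in> verts H" "\<theta> x = \<theta> y"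
      have g': "g z \<noteq> \<phi> w" if "z \<in> verts H" "z \<notin> U" "w \<in> U" for z w using g(1) that by blast
      show "x = y"
      proof (cases "x \<in> U")
        case True
        then have "y \<in> U" using xy g'[of y x] by (auto simp: \<theta>_def split: if_splits)
        then show ?thesis using True xy inj_onD[OF inj] by (simp add: \<theta>_def)
      next
        case False
        then have "y \<notin> U" using xy g'[of x y] by (auto simp: \<theta>_def split: if_splits)
        then show ?thesis using False xy inj_onD[OF g(2)] by (simp add: \<theta>_def)
      qed
    qed
    have "\<theta> ` e = \<phi> ` e" if "e \<in> edges H" for e
      using that by (intro image_cong refl) (auto simp: \<theta>_def U_def)
    then show "edge_image H \<theta> \<subseteq> edges G" using e by (auto simp: edge_image_def)
  qed
  then show ?thesis by blast
qed

lemma card_all_pairs_less: "0 < n \<Longrightarrow> card (all_pairs {..<n::nat}) < n\<^sup>2"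
proof -
  assume n: "0 < n"
  have "card (all_pairs {..<n}) = n choose 2"
    unfolding all_pairs_def by (subst n_subsets) auto
  also have "\<dots> \<le> n * (n - 1)" by (simp add: choose_two)
  also have "\<dots> < n\<^sup>2" using n by (simp add: power2_eq_square)
  finally show ?thesis .
qed

lemma powr_neg_tendsto_0:
  assumes "0 < (a::real)"
  shows "(\<lambda>n. real n powr (- a)) \<longlonglongrightarrow> 0"
  using assms by (auto intro!: tendsto_neg_powr filterlim_real_sequentially)

text \<open>A container with many copies of \<open>H\<close> would, by Janson, have an
  \<open>H\<close>-free random subset with probability at most exp(- 2 b n^2 p0). The container
  lemma guarantees more than that.\<close>

lemma graph_containers:
  fixes H :: "'a ugraph" and d m :: real
  assumes H: "simple_graph H" "verts H \<noteq> {}" and m: "0 < m" and d: "0 < d"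
    and dens: "\<And>W F. W \<subseteq> verts H \<Longrightarrow> F \<subseteq> edges H \<Longrightarrow> F \<noteq> {} \<Longrightarrow> \<Union>F \<subseteq> W \<Longrightarrow>
      2 \<le> card W \<and> 1 \<le> card F \<and> real (card F) - 1 \<le> m * (real (card W) - 2)"
  shows "\<exists>K>0. \<forall>\<^sub>F n in sequentially. \<exists>f. \<forall>I\<subseteq>all_pairs {..<n}. emb H ({..<n}, I) = {} \<longrightarrow>
     (\<exists>S\<subseteq>I. I \<subseteq> f S \<union> S \<and> f S \<subseteq> all_pairs {..<n} \<and> real (card S) \<le> K * real n powr (- (1 / m)) * (real n)\<^sup>2 \<and>
        real (card (emb H ({..<n}, f S))) < d * real n ^ card (verts H))"
proof -
  let ?h = "card (verts H)" and ?k = "card (edges H)"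
  define C where "C = overlap_const H H"
  have C: "0 < C" using H by (simp add: C_def overlap_const_pos)
  \<comment> \<open>Chosen so that Janson's exponent \<open>(d * s)\<^sup>2 / (2 * D)\<close> below
    equals \<open>2 * b * ((real n)\<^sup>2 * p0)\<close>.\<close>
  define b where "b = d\<^sup>2 / (4 * C)"
  have b: "0 < b" using d C by (simp add: b_def)
  from container_lemma[OF b, where 'a = "nat set"] obtain K0 where K0: "0 < K0"
    "\<forall>(ind :: nat set set \<Rightarrow> bool) V (lam :: real). (\<forall>I J. ind I \<longrightarrow> J \<subseteq> I \<longrightarrow> ind J) \<and> finite V \<and> 0 < lam \<longrightarrow>
     (\<exists>f. \<forall>I. ind I \<and> I \<subseteq> V \<longrightarrow>
       (\<exists>S. S \<subseteq> I \<and> I \<subseteq> f S \<union> S \<and> f S \<subseteq> V \<and> card S \<le> K0 * lam * card V \<and>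
          exp (- b * lam * card V) \<le> pexp (lam / (1 + lam)) (f S) (\<lambda>R. of_bool (ind R))))"
    by (elim exE conjE)
  have "\<forall>\<^sub>F n in sequentially. real n powr (- (1 / m)) < 1 / 2"
    using m by (intro order_tendstoD(2)[OF powr_neg_tendsto_0]) auto
  then have ev: "\<forall>\<^sub>F n in sequentially. \<exists>f. \<forall>I\<subseteq>all_pairs {..<n}. emb H ({..<n}, I) = {} \<longrightarrow>
     (\<exists>S\<subseteq>I. I \<subseteq> f S \<union> S \<and> f S \<subseteq> all_pairs {..<n} \<and> real (card S) \<le> 2 * K0 * real n powr (- (1 / m)) * (real n)\<^sup>2 \<and>
        real (card (emb H ({..<n}, f S))) < d * real n ^ ?h)"
    using eventually_gt_at_top[of 0]
  proof eventually_elim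
    case (elim n)
    let ?P = "all_pairs {..<n}"
    define q where "q = real n powr (- (1 / m))"
    \<comment> \<open>The factor 2 compensates for the denominator \<open>1 + lam\<close>, which is
      at most 2, and ensures p0 \<ge> q, as \<open>dense_two_density\<close> requires.\<close>
    define lam where "lam = 2 * q"
    define p0 where "p0 = lam / (1 + lam)"
    have q: "0 < q" "q < 1 / 2" using elim by (simp_all add: q_def)
    have lam: "0 < lam" "lam \<le> 1" using q by (simp_all add: lam_def)
    have p0: "lam / 2 \<le> p0" "0 < p0" "p0 \<le> 1" using lam by (simp_all add: p0_def field_simps)
    define ind where "ind = (\<lambda>I. emb H ({..<n}, I) = {})"
    have indmono: "\<forall>I J. ind I \<longrightarrow> J \<subseteq> I \<longrightarrow> ind J"
    proof (intro allI impI)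
      fix I J assume "ind I" "J \<subseteq> I"
      then show "ind J" using emb_mono[of "({..<n}, J)" "({..<n}, I)" H] by (simp add: ind_def)
    qed
    have finP: "finite ?P" by simp
    have N: "real (card ?P) < (real n)\<^sup>2"
      using card_all_pairs_less[of n] elim by (metis of_nat_less_iff of_nat_power)
    from K0(2)[rule_format, OF conjI[OF indmono conjI[OF finP lam(1)]]]
    obtain f where f: "\<forall>I. ind I \<and> I \<subseteq> ?P \<longrightarrow>
       (\<exists>S. S \<subseteq> I \<and> I \<subseteq> f S \<union> S \<and> f S \<subseteq> ?P \<and> card S \<le> K0 * lam * card ?P \<and>
          exp (- b * lam * card ?P) \<le> pexp (lam / (1 + lam)) (f S) (\<lambda>R. of_bool (ind R)))"
      by (elim exE)
    show ?case
    proof (intro exI[of _ f] allI impI)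
      fix I assume I: "I \<subseteq> ?P" "emb H ({..<n}, I) = {}"
      then have "ind I \<and> I \<subseteq> ?P" by (simp add: ind_def)
      from f[rule_format, OF this] obtain S where S: "S \<subseteq> I" "I \<subseteq> f S \<union> S" "f S \<subseteq> ?P" "card S \<le> K0 * lam * card ?P"
        "exp (- b * lam * card ?P) \<le> pexp p0 (f S) (\<lambda>R. of_bool (ind R))"
        unfolding p0_def by (elim exE conjE)
      have "K0 * lam * card ?P \<le> K0 * lam * (real n)\<^sup>2"
        using N K0(1) lam by (intro mult_left_mono) auto
      then have size: "real (card S) \<le> 2 * K0 * real n powr (- (1 / m)) * (real n)\<^sup>2"
        using S(4) by (simp add: lam_def q_def mult_ac)
      have few: "real (card (emb H ({..<n}, f S))) < d * real n ^ ?h"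
      proof (rule ccontr)
        let ?E = "emb H ({..<n}, f S)"
        assume "\<not> ?thesis"
        then have x: "d * real n ^ ?h \<le> card ?E" by simp
        have sub: "?E \<subseteq> emb H (complete_ugraph n)"
          using S(3) by (intro emb_mono) (auto simp: complete_ugraph_def)
        have finS: "finite (f S)" using S(3) finP by (rule finite_subset)
        have img: "edge_image H \<phi> \<subseteq> f S" if "\<phi> \<in> ?E" for \<phi>
          using that by (auto simp: emb_def edge_image_def)
        have fam: "set_family (f S) ?E (edge_image H) p0"
          "set_family.mu ?E (edge_image H) p0 = card ?E * p0 ^ ?k"
          using p0 img by (auto intro!: family_emb[OF H(1) _ _ sub finS])
        define s where "s = real n ^ ?h * p0 ^ ?k"
        have s: "0 < s" using elim p0 by (simp add: s_def)
        define D where "D = C * s\<^sup>2 / ((real n)\<^sup>2 * p0)"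
        have D: "0 < D" using C s elim p0 by (simp add: D_def)
        have ov: "overlap p0 ?E (edge_image H) ?E (edge_image H) \<le> D"
          unfolding C_def D_def s_def
        proof (intro overlap_family_le H p0 sub)
          show "0 < (real n)\<^sup>2 * p0" "0 < n" using elim p0 by auto
          fix W F assume WF: "W \<subseteq> verts H" "F \<subseteq> edges H" "F \<noteq> {}" "\<Union>F \<subseteq> W"
          show "(real n)\<^sup>2 * p0 \<le> real n ^ card W * p0 ^ card F"
            using dens[OF WF] elim m p0 by (intro dense_two_density[of n m]) (auto simp: lam_def q_def)
        qed
        have mu: "d * s \<le> card ?E * p0 ^ ?k"
          using x p0 by (simp add: s_def mult_right_mono flip: mult.assoc)
        have ds: "0 \<le> d * s" using d s by simp
        \<comment> \<open>Being \<open>H\<close>-free means that the count is zero, the lower tail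
          with deviation equal to the whole mean.\<close>
        have "pexp p0 (f S) (\<lambda>R. of_bool (ind R))
           \<le> pexp p0 (f S) (\<lambda>R. of_bool (count_in ?E (edge_image H) R \<le> card ?E * p0 ^ ?k - card ?E * p0 ^ ?k))"
        proof (intro pexp_mono)
          fix R assume R: "R \<subseteq> f S"
          have "count_in ?E (edge_image H) R = card (emb H ({..<n}, f S \<inter> R))"
            by (rule count_in_emb[OF H(1) S(3) subset_refl])
          moreover have "f S \<inter> R = R" using R by auto
          ultimately show "of_bool (ind R) \<le> (of_bool (count_in ?E (edge_image H) R \<le> card ?E * p0 ^ ?k - card ?E * p0 ^ ?k) :: real)"
            by (simp add: ind_def)
        qed (use p0 in auto)
        also have "\<dots> \<le> exp (- ((card ?E * p0 ^ ?k)\<^sup>2 / (2 * D)))"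
          using set_family.janson[OF fam(1) _ D ov, of "card ?E * p0 ^ ?k", unfolded fam(2)] p0 by simp
        also have "\<dots> \<le> exp (- ((d * s)\<^sup>2 / (2 * D)))"
          using mu ds D by (simp add: divide_right_mono power_mono)
        also have "(d * s)\<^sup>2 / (2 * D) = 2 * b * ((real n)\<^sup>2 * p0)"
          using s C elim p0 by (simp add: D_def b_def power_mult_distrib field_simps)
        finally have "exp (- b * lam * card ?P) \<le> exp (- (2 * b * ((real n)\<^sup>2 * p0)))" using S(5) by linarith
        then have "2 * b * ((real n)\<^sup>2 * p0) \<le> b * lam * card ?P" by simp
        moreover have "2 * b * ((real n)\<^sup>2 * (lam / 2)) \<le> 2 * b * ((real n)\<^sup>2 * p0)"
          using b p0 by (intro mult_left_mono) auto
        moreover have "b * lam * card ?P < b * lam * (real n)\<^sup>2"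
          using N b lam by (intro mult_strict_left_mono) auto
        ultimately show False by (simp add: mult_ac)
      qed
      show "\<exists>S\<subseteq>I. I \<subseteq> f S \<union> S \<and> f S \<subseteq> ?P \<and> real (card S) \<le> 2 * K0 * real n powr (- (1 / m)) * (real n)\<^sup>2 \<and>
        real (card (emb H ({..<n}, f S))) < d * real n ^ ?h"
        using S(1,2,3) size few by blast
    qed
  qed
  show ?thesis using ev K0(1) by (intro exI[of _ "2 * K0"] conjI) auto
qed

text \<open>Exponential tilting: on sets of size at most s the weight (1/y)^|S| is at most (1/y)^s,
  and the sum of (p y)^|S| over all sets is at most exp(p y |P|). For a small constant y and s =
  o(n^2 p), both exponents are small multiples of n^2 p.\<close>

lemma sum_small_subsets_le:
  fixes p y s :: real
  assumes P: "finite P" and p: "0 \<le> p" and y: "0 < y" "y \<le> 1"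
  shows "(\<Sum>S | S \<subseteq> P \<and> real (card S) \<le> s. p ^ card S) \<le> exp (s * ln (1 / y) + p * y * card P)"
proof -
  \<comment> \<open>With no constraint the hard-core sum runs over all subsets, and
    \<open>Z_le_exp\<close> bounds it.\<close>
  interpret down_closed "\<lambda>_ :: 'a set. True" by unfold_locales
  have L: "0 \<le> ln (1 / y)" using y by simp
  have "(\<Sum>S | S \<subseteq> P \<and> real (card S) \<le> s. p ^ card S)
     \<le> (\<Sum>S | S \<subseteq> P \<and> real (card S) \<le> s. exp (s * ln (1 / y)) * (p * y) ^ card S)"
  proof (intro sum_mono)
    fix S assume "S \<in> {S. S \<subseteq> P \<and> real (card S) \<le> s}"
    then have "exp (card S * ln (1 / y)) \<le> exp (s * ln (1 / y))" using L by (auto intro: mult_right_mono)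
    moreover have "exp (card S * ln (1 / y)) = (1 / y) ^ card S" using y by (simp add: exp_of_nat_mult)
    ultimately have "(1 / y) ^ card S * (p * y) ^ card S \<le> exp (s * ln (1 / y)) * (p * y) ^ card S"
      using p y by (intro mult_right_mono) auto
    then show "p ^ card S \<le> exp (s * ln (1 / y)) * (p * y) ^ card S"
      using y by (simp add: power_mult_distrib[symmetric])
  qed
  also have "\<dots> \<le> (\<Sum>S | S \<subseteq> P \<and> True. exp (s * ln (1 / y)) * (p * y) ^ card S)"
    using P p y by (intro sum_mono2) auto
  also have "\<dots> = exp (s * ln (1 / y)) * hard_core_sum (\<lambda>_. True) (p * y) P {}"
    by (simp add: hard_core_sum_def sum_distrib_left)
  also have "\<dots> \<le> exp (s * ln (1 / y)) * exp (p * y * card P)"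
    using P p y by (intro mult_left_mono Z_le_exp) auto
  finally show ?thesis by (simp add: exp_add)
qed

text \<open>Choose the edge of \<open>T\<close> and the edge of \<open>S\<close> it hits: the two
  ends have at most 4 placements, the other vertices at most n each. The factor n^2 stands on the
  left to avoid a subtraction in the exponent.\<close>

lemma card_emb_meeting_le:
  assumes T: "simple_graph T" and S: "S \<subseteq> all_pairs {..<n}"
  shows "card {\<phi> \<in> emb T (complete_ugraph n). edge_image T \<phi> \<inter> S \<noteq> {}} * n\<^sup>2
    \<le> 4 * card (edges T) * card S * n ^ card (verts T)"
proof -
  let ?V = "verts T"
  let ?B = "\<lambda>e s. PiE ?V (\<lambda>x. if x \<in> e then s else {..<n})"
  note sT = simple_graphD[OF T]
  have finS: "finite S" by (rule finite_subset[OF S]) simp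
  have s: "card s = 2" "finite s" if "s \<in> S" for s
    using S that by (auto simp: all_pairs_def card_ge_0_finite)
  have "{\<phi> \<in> emb T (complete_ugraph n). edge_image T \<phi> \<inter> S \<noteq> {}} \<subseteq> (\<Union>e\<in>edges T. \<Union>s\<in>S. ?B e s)"
  proof
    fix \<phi> assume "\<phi> \<in> {\<phi> \<in> emb T (complete_ugraph n). edge_image T \<phi> \<inter> S \<noteq> {}}"
    then obtain e where e: "\<phi> \<in> emb T (complete_ugraph n)" "e \<in> edges T" "\<phi> ` e \<in> S"
      by (auto simp: edge_image_def)
    then have "\<phi> \<in> ?B e (\<phi> ` e)"
      by (auto simp: emb_def complete_ugraph_def PiE_iff extensional_def)
    then show "\<phi> \<in> (\<Union>e\<in>edges T. \<Union>s\<in>S. ?B e s)" using e by blast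
  qed
  moreover have "finite (\<Union>e\<in>edges T. \<Union>s\<in>S. ?B e s)"
    using sT(1,2) finS s(2) by (intro finite_UN_I finite_PiE) auto
  ultimately have "card {\<phi> \<in> emb T (complete_ugraph n). edge_image T \<phi> \<inter> S \<noteq> {}} \<le> card (\<Union>e\<in>edges T. \<Union>s\<in>S. ?B e s)"
    by (intro card_mono)
  also have "\<dots> \<le> (\<Sum>e\<in>edges T. \<Sum>s\<in>S. card (?B e s))"
    using sT(2) finS by (intro order_trans[OF card_UN_le] sum_mono card_UN_le)
  finally have "card {\<phi> \<in> emb T (complete_ugraph n). edge_image T \<phi> \<inter> S \<noteq> {}} * n\<^sup>2
     \<le> (\<Sum>e\<in>edges T. \<Sum>s\<in>S. card (?B e s)) * n\<^sup>2" by (rule mult_le_mono1)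
  also have "\<dots> = (\<Sum>e\<in>edges T. \<Sum>s\<in>S. card (?B e s) * n\<^sup>2)" by (simp add: sum_distrib_right)
  also have "\<dots> = (\<Sum>e\<in>edges T. \<Sum>s\<in>S. 4 * n ^ card ?V)"
  proof (intro sum.cong refl)
    fix e s assume e: "e \<in> edges T" and sS: "s \<in> S"
    have "card (?B e s) = (\<Prod>x\<in>?V. if x \<in> e then 2 else n)"
      using sT(1) s(1)[OF sS] by (subst card_PiE) (auto intro!: prod.cong)
    also have "\<dots> = 2 ^ card e * n ^ card (?V - e)"
      using sT(1) sT(3)[OF e] by (simp add: prod.If_cases Int_absorb1 Diff_eq)
    finally have "card (?B e s) = 4 * n ^ card (?V - e)" using sT(4)[OF e] by simp
    moreover have "card (?V - e) + 2 = card ?V"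
      using card_Diff_subset[OF sT(5)[OF e] sT(3)[OF e]] card_mono[OF sT(1) sT(3)[OF e]] sT(4)[OF e] by simp
    then have "n ^ card (?V - e) * n\<^sup>2 = n ^ card ?V" by (metis power_add)
    ultimately show "card (?B e s) * n\<^sup>2 = 4 * n ^ card ?V" by simp
  qed
  finally show ?thesis by (simp add: mult_ac)
qed

text \<open>Since the sets counted for S are disjoint from S, adding S to R leaves the count
  unchanged. The event for S and the event S \<subseteq> R therefore factor, and Janson's bound is
  summed with weights p^|S|.\<close>

lemma fingerprint_union_bound:
  fixes T :: "'a ugraph" and p y s t D :: real and I :: "nat set set \<Rightarrow> ('a \<Rightarrow> nat) set"
  assumes T: "simple_graph T" and p: "0 \<le> p" "p \<le> 1" and y: "0 < y" "y \<le> 1" and t: "0 \<le> t" and D: "0 < D"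
    and I: "\<And>S. I S \<subseteq> emb T (complete_ugraph n)" "\<And>S \<phi>. \<phi> \<in> I S \<Longrightarrow> edge_image T \<phi> \<inter> S = {}"
    and ov: "\<And>S. overlap p (I S) (edge_image T) (I S) (edge_image T) \<le> D"
  shows "pexp p (all_pairs {..<n}) (\<lambda>R. of_bool (\<exists>S\<subseteq>R. real (card S) \<le> s \<and>
      count_in (I S) (edge_image T) R \<le> card (I S) * p ^ card (edges T) - t))
    \<le> exp (s * ln (1 / y) + p * y * card (all_pairs {..<n})) * exp (- (t\<^sup>2 / (2 * D)))"
proof -
  let ?P = "all_pairs {..<n}"
  let ?Q = "\<lambda>S R. count_in (I S) (edge_image T) R \<le> card (I S) * p ^ card (edges T) - t"
  let ?Ss = "{S. S \<subseteq> ?P \<and> real (card S) \<le> s}"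
  have finP: "finite ?P" by simp
  have finSs: "finite ?Ss" by (rule finite_subset[of _ "Pow ?P"]) auto
  have one: "pexp p ?P (\<lambda>R. of_bool (S \<subseteq> R) * of_bool (?Q S R)) \<le> p ^ card S * exp (- (t\<^sup>2 / (2 * D)))"
    if S: "S \<in> ?Ss" for S
  proof -
    have fam: "set_family ?P (I S) (edge_image T) p"
      "set_family.mu (I S) (edge_image T) p = card (I S) * p ^ card (edges T)"
      using p I(1)[of S] edge_image_sub_pairs[OF T] by (auto intro!: family_emb[OF T _ _ I(1)[of S] finP])
    have c: "count_in (I S) (edge_image T) (R \<union> S) = count_in (I S) (edge_image T) R" for R
      unfolding count_in_def using I(2)[of _ S] by (intro sum.cong refl arg_cong[where f = of_bool]) blast
    have "pexp p ?P (\<lambda>R. of_bool (S \<subseteq> R) * of_bool (?Q S R)) = p ^ card S * pexp p ?P (\<lambda>R. of_bool (?Q S (R \<union> S)))"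
      using S finP by (intro pexp_superset) auto
    also have "\<dots> \<le> p ^ card S * exp (- (t\<^sup>2 / (2 * D)))"
      unfolding c using p set_family.janson[OF fam(1) t D ov, unfolded fam(2)] by (intro mult_left_mono) auto
    finally show ?thesis .
  qed
  have "pexp p ?P (\<lambda>R. of_bool (\<exists>S\<subseteq>R. real (card S) \<le> s \<and> ?Q S R))
     \<le> pexp p ?P (\<lambda>R. \<Sum>S\<in>?Ss. of_bool (S \<subseteq> R) * of_bool (?Q S R))"
  proof (intro pexp_mono p)
    fix R assume R: "R \<subseteq> ?P"
    show "of_bool (\<exists>S\<subseteq>R. real (card S) \<le> s \<and> ?Q S R) \<le> (\<Sum>S\<in>?Ss. of_bool (S \<subseteq> R) * of_bool (?Q S R) :: real)"
    proof (cases "\<exists>S\<subseteq>R. real (card S) \<le> s \<and> ?Q S R")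
      case True
      then obtain S where S: "S \<subseteq> R" "real (card S) \<le> s" "?Q S R" by blast
      have "1 = (of_bool (S \<subseteq> R) * of_bool (?Q S R) :: real)" using S by simp
      also have "\<dots> \<le> (\<Sum>S\<in>?Ss. of_bool (S \<subseteq> R) * of_bool (?Q S R))"
        using S R finSs by (intro member_le_sum) auto
      finally show ?thesis using True by simp
    next
      case False
      then have "of_bool (\<exists>S\<subseteq>R. real (card S) \<le> s \<and> ?Q S R) = (0::real)" by simp
      also have "\<dots> \<le> (\<Sum>S\<in>?Ss. of_bool (S \<subseteq> R) * of_bool (?Q S R))" by (intro sum_nonneg) auto
      finally show ?thesis .
    qed
  qed
  also have "\<dots> = (\<Sum>S\<in>?Ss. pexp p ?P (\<lambda>R. of_bool (S \<subseteq> R) * of_bool (?Q S R)))" by (rule pexp_sum)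
  also have "\<dots> \<le> (\<Sum>S\<in>?Ss. p ^ card S * exp (- (t\<^sup>2 / (2 * D))))" by (intro sum_mono one)
  also have "\<dots> = (\<Sum>S\<in>?Ss. p ^ card S) * exp (- (t\<^sup>2 / (2 * D)))" by (simp add: sum_distrib_right)
  also have "\<dots> \<le> exp (s * ln (1 / y) + p * y * card ?P) * exp (- (t\<^sup>2 / (2 * D)))"
    using p y finP by (intro mult_right_mono sum_small_subsets_le) auto
  finally show ?thesis .
qed

section \<open>Above the threshold\<close>

lemma ex_in_above_threshold:
  fixes T :: "'a ugraph" and H :: "'b ugraph" and p :: "nat \<Rightarrow> real"
  assumes T: "simple_graph T" "card (edges T) \<ge> 2" "two_balanced T"
    and H: "simple_graph H" "card (edges H) \<ge> 2"
    and m: "m2 H > m2 T"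
    and p: "\<And>n. 0 \<le> p n \<and> p n \<le> 1"
    and lo: "(\<lambda>n. real n powr (- (1 / m2 H))) \<in> o(p)"
    and eps: "0 < \<epsilon>"
  shows "whp (\<lambda>n. binomial_random_graph n (p n))
          (\<lambda>n G. \<bar>real (ex_in G T H) - real (ex_num n T H) * p n ^ card (edges T)\<bar>
                  \<le> \<epsilon> * real n ^ card (verts T) * p n ^ card (edges T))"
proof -
  let ?v = "card (verts T)" and ?e = "card (edges T)" and ?q = "\<lambda>n. real n powr (- (1 / m2 H))"
  let ?s = "\<lambda>n. real n ^ ?v * p n ^ ?e"
  let ?P = "\<lambda>n. all_pairs {..<n::nat}"
  define a where "a = real (card (auts T))"
  have a: "0 < a" using card_auts_pos[OF T(1)] by (simp add: a_def)
  \<comment> \<open>The upper bound spends four errors of relative size \<open>e1\<close>: the total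
    count, the lower tail, the container and the copies meeting the fingerprint.\<close>
  define e1 where "e1 = \<epsilon> * a / 8"
  have e1: "0 < e1" using a eps by (simp add: e1_def)
  have mT: "1 / 2 \<le> m2 T" using m2_ge_half[OF T(1,2)] .
  have mH: "0 < m2 H" using mT m by simp
  have vT: "verts T \<noteq> {}"
    using card_verts_gt_2[of "edges T" "verts T"] T simple_graphD(1)[OF T(1)] by (auto simp: simple_graph_def)
  have eH: "edges H \<noteq> {}" using H by auto
  define H0 where "H0 = core H"
  have subH0: "subgraph H0 H" unfolding H0_def by (rule subgraph_core[OF H(1)])
  have sH0: "simple_graph H0" "edges H0 \<noteq> {}" using subH0 eH by (auto simp: subgraph_def H0_def core_def)
  have vH0: "verts H0 \<noteq> {}"
    using sH0 simple_graphD(3,4)[OF sH0(1)] by (metis all_not_in_conv card.empty subset_empty zero_neq_numeral)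

  \<comment> \<open>As 1 / m2 H \<le> 1 / m2 T \<le> v / e, this range lies above the concentration
    threshold for \<open>T\<close>.\<close>
  have lo': "(\<lambda>n. real n powr (- (real ?v / real ?e))) \<in> o(p)"
  proof (rule landau_o.big_small_trans[OF _ lo])
    have "1 / m2 H \<le> 1 / m2 T" using m mT by (simp add: frac_le)
    also have "\<dots> \<le> real ?v / real ?e" using inverse_m2_le_verts_div_edges[OF T] .
    finally have le: "1 / m2 H \<le> real ?v / real ?e" .
    show "(\<lambda>n. real n powr (- (real ?v / real ?e))) \<in> O(?q)"
    proof (rule bigoI[of _ 1], rule eventually_mono[OF eventually_ge_at_top[of 1]])
      fix n :: nat assume "1 \<le> n"
      then have "real n powr (- (real ?v / real ?e)) \<le> ?q n"
        using le by (intro powr_mono) auto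
      then show "norm (real n powr (- (real ?v / real ?e))) \<le> 1 * norm (?q n)" by simp
    qed
  qed
  have dense: "\<forall>\<^sub>F n in sequentially. 0 < p n \<and> (\<forall>W F. W \<subseteq> verts T \<longrightarrow> F \<subseteq> edges T \<longrightarrow> F \<noteq> {} \<longrightarrow> \<Union>F \<subseteq> W \<longrightarrow>
      M \<le> real n ^ card W * p n ^ card F)" for M
    by (rule dense_above_threshold[OF T p lo'])
  \<comment> \<open>n^2 p tends to infinity: apply \<open>dense\<close> to a single edge of
    \<open>T\<close>.\<close>
  have np: "\<forall>\<^sub>F n in sequentially. 0 < p n \<and> M \<le> (real n)\<^sup>2 * p n" for M
    using dense[of M]
  proof eventually_elim
    case (elim n)
    obtain e where e: "e \<in> edges T" using T(2) by fastforce
    then have "M \<le> real n ^ card e * p n ^ card {e}"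
      using elim simple_graphD(3)[OF T(1) e] by (intro elim[THEN conjunct2, rule_format]) auto
    then show ?case using elim simple_graphD(4)[OF T(1) e] by simp
  qed

  obtain d where d: "0 < d" "\<exists>n0. \<forall>n\<ge>n0. \<forall>E\<subseteq>?P n.
     card (emb H0 ({..<n}, E)) < d * real n ^ card (verts H0) \<longrightarrow>
     card (emb T ({..<n}, E)) \<le> max_emb n T H0 + e1 * real n ^ ?v"
    using supersaturation[OF T(1) sH0 e1] by blast
  then have sat: "\<forall>\<^sub>F n in sequentially. \<forall>E\<subseteq>?P n.
     card (emb H0 ({..<n}, E)) < d * real n ^ card (verts H0) \<longrightarrow>
     card (emb T ({..<n}, E)) \<le> max_emb n T H0 + e1 * real n ^ ?v"
    unfolding eventually_sequentially by blast

  have densH0: "2 \<le> card W \<and> 1 \<le> card F \<and> real (card F) - 1 \<le> m2 H * (real (card W) - 2)"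
    if WF: "W \<subseteq> verts H0" "F \<subseteq> edges H0" "F \<noteq> {}" "\<Union>F \<subseteq> W" for W F
  proof -
    have "W \<subseteq> verts H" "F \<subseteq> edges H" using WF subH0 by (auto simp: subgraph_def)
    from edges_le_m2[OF H(1) less_imp_le[OF mH] this WF(3,4)] show ?thesis by blast
  qed
  define good where "good = (\<lambda>K n f. \<forall>I\<subseteq>?P n. emb H0 ({..<n}, I) = {} \<longrightarrow>
     (\<exists>S\<subseteq>I. I \<subseteq> f S \<union> S \<and> f S \<subseteq> ?P n \<and> real (card S) \<le> K * ?q n * (real n)\<^sup>2 \<and>
        real (card (emb H0 ({..<n}, f S))) < d * real n ^ card (verts H0)))"
  have "\<exists>K>0. \<forall>\<^sub>F n in sequentially. \<exists>f. good K n f"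
    unfolding good_def by (rule graph_containers[OF sH0(1) vH0 mH d(1) densH0])
  then obtain K where K: "0 < K" "\<forall>\<^sub>F n in sequentially. \<exists>f. good K n f" by blast
  \<comment> \<open>The container function is fixed before \<open>R\<close> is drawn, so that the
    family attached to a fingerprint is deterministic and Janson's inequality applies to it.\<close>
  define fn where "fn = (\<lambda>n. SOME f. good K n f)"
  have good: "\<forall>\<^sub>F n in sequentially. good K n (fn n)"
    using K(2) by (rule eventually_mono) (simp add: fn_def someI_ex)
  \<comment> \<open>Copies not inside the container; those meeting \<open>S\<close> are excluded to
    make the event independent of S \<subseteq> R.\<close>
  define I where "I = (\<lambda>n S. {\<phi> \<in> emb T (complete_ugraph n). edge_image T \<phi> \<inter> S = {} \<and> \<not> edge_image T \<phi> \<subseteq> fn n S})"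
  define s where "s = (\<lambda>n. K * ?q n * (real n)\<^sup>2)"

  have "\<exists>F. subgraph F (complete_ugraph n) \<and> free_of H F \<and> num_copies T F = ex_num n T H" for n
    unfolding ex_num_def using ex_in_attained[OF simple_complete H(1) eH] by metis
  then obtain Fx where Fx: "\<And>n. subgraph (Fx n) (complete_ugraph n)" "\<And>n. free_of H (Fx n)"
    "\<And>n. num_copies T (Fx n) = ex_num n T H" by metis
  have Fx_sub: "verts (Fx n) \<subseteq> {..<n}" "edges (Fx n) \<subseteq> ?P n" for n
    using Fx(1)[of n] by (auto simp: subgraph_def complete_ugraph_def)

  have B1: "negligible p (\<lambda>n R. e1 * real n ^ ?v * p n ^ ?e
      \<le> \<bar>count_in (emb T (complete_ugraph n)) (edge_image T) R - card (emb T (complete_ugraph n)) * p n ^ ?e\<bar>)"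
    by (intro concentration[OF T(1) vT p subset_refl e1] dense)
  have B2: "negligible p (\<lambda>n R. e1 * real n ^ ?v * p n ^ ?e
      \<le> \<bar>count_in (emb T (Fx n)) (edge_image T) R - card (emb T (Fx n)) * p n ^ ?e\<bar>)"
    using Fx(1) by (intro concentration[OF T(1) vT p _ e1] dense emb_mono) (auto simp: subgraph_def)
  have B3: "negligible p (\<lambda>n R. \<exists>S\<subseteq>R. real (card S) \<le> s n \<and>
      count_in (I n S) (edge_image T) R \<le> card (I n S) * p n ^ ?e - e1 * ?s n)"
  proof (rule negligibleI[OF p])
    fix \<delta> :: real assume \<delta>: "0 < \<delta>"
    define C where "C = overlap_const T T"
    have C: "0 < C" using T vT by (simp add: C_def overlap_const_pos)
    define c where "c = e1\<^sup>2 / (2 * C)"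
    have c: "0 < c" using e1 C by (simp add: c_def)
    \<comment> \<open>Janson contributes the exponent \<open>c * x\<close> with x = n^2 p. The bound
      y \<le> c / 4 and, by \<open>ev1\<close>, the smallness of \<open>s n * L\<close> make the two
      terms of the union bound at most \<open>c / 4 * x\<close> each, so \<open>c / 2 * x\<close>
      remains.\<close>
    define y where "y = min 1 (c / 4)"
    have y: "0 < y" "y \<le> 1" "y \<le> c / 4" using c by (auto simp: y_def)
    define L where "L = ln (1 / y)"
    have L: "0 \<le> L" using y by (simp add: L_def)
    have ev1: "\<forall>\<^sub>F n in sequentially. (K * L * 4 / c + 1) * ?q n \<le> p n"
      using p c L K(1) by (intro smallo_lower[OF lo]) (auto intro!: add_nonneg_pos)
    show "\<forall>\<^sub>F n in sequentially. pexp (p n) (?P n) (\<lambda>R. of_bool (\<exists>S\<subseteq>R. real (card S) \<le> s n \<and>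
      count_in (I n S) (edge_image T) R \<le> card (I n S) * p n ^ ?e - e1 * ?s n)) \<le> \<delta>"
      using ev1 np[of "max 1 (2 / c * ln (1 / \<delta>))"] eventually_gt_at_top[of 0]
    proof eventually_elim
      case (elim n)
      have n: "1 \<le> n" and pn: "0 < p n" "p n \<le> 1" using elim p by auto
      define x where "x = (real n)\<^sup>2 * p n"
      have x: "0 < x" using n pn by (simp add: x_def)
      have xd: "2 / c * ln (1 / \<delta>) \<le> x" using elim by (simp add: x_def)
      have q0: "0 \<le> ?q n" by simp
      have "0 \<le> K * L * 4 / c" using K(1) L c by simp
      then have "?q n \<le> (K * L * 4 / c + 1) * ?q n" "K * L * 4 / c * ?q n \<le> (K * L * 4 / c + 1) * ?q n"
        using mult_right_mono[OF _ q0, of 1 "K * L * 4 / c + 1"] mult_right_mono[OF _ q0, of "K * L * 4 / c" "K * L * 4 / c + 1"] by auto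
      then have qp: "?q n \<le> p n" and KL: "K * L * 4 / c * ?q n \<le> p n" using elim by linarith+
      have sn: "0 < ?s n" using n pn by simp
      define D where "D = C * (?s n)\<^sup>2 / x"
      have D: "0 < D" unfolding D_def using C n pn x by (intro divide_pos_pos mult_pos_pos zero_less_power) auto
      have ov: "overlap (p n) (I n S) (edge_image T) (I n S) (edge_image T) \<le> D" for S
        unfolding D_def C_def
      proof (intro overlap_family_le T vT pn x)
        show "0 < n" using n by simp
        show "I n S \<subseteq> emb T (complete_ugraph n)" by (auto simp: I_def)
        fix W F assume WF: "W \<subseteq> verts T" "F \<subseteq> edges T" "F \<noteq> {}" "\<Union>F \<subseteq> W"
        have "0 \<le> m2 T" using mT by simp
        note ed = edges_le_m2[OF T(1) this WF]
        have "1 / m2 H \<le> 1 / m2 T" using m mT by (simp add: frac_le)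
        then have "real n powr (- (1 / m2 T)) \<le> ?q n" using n by (intro powr_mono) auto
        then show "x \<le> real n ^ card W * p n ^ card F"
          unfolding x_def using ed n mT qp by (intro dense_two_density[of n "m2 T"]) auto
      qed
      have "pexp (p n) (?P n) (\<lambda>R. of_bool (\<exists>S\<subseteq>R. real (card S) \<le> s n \<and>
          count_in (I n S) (edge_image T) R \<le> card (I n S) * p n ^ ?e - e1 * ?s n))
        \<le> exp (s n * ln (1 / y) + p n * y * card (?P n)) * exp (- ((e1 * ?s n)\<^sup>2 / (2 * D)))"
        using p pn y e1 sn D ov by (intro fingerprint_union_bound[OF T(1)]) (auto simp: I_def)
      also have "(e1 * ?s n)\<^sup>2 / (2 * D) = c * x"
        using n pn C x by (simp add: D_def c_def power_mult_distrib field_simps)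
      also have "exp (s n * ln (1 / y) + p n * y * card (?P n)) * exp (- (c * x)) \<le> exp (- (c / 2 * x))"
      proof -
        have "s n * L = c / 4 * ((K * L * 4 / c * ?q n) * (real n)\<^sup>2)"
          using c by (simp add: s_def)
        also have "\<dots> \<le> c / 4 * (p n * (real n)\<^sup>2)"
          using KL c by (intro mult_left_mono mult_right_mono) auto
        finally have 1: "s n * L \<le> c / 4 * x" by (simp add: x_def mult_ac)
        have "real (card (?P n)) \<le> (real n)\<^sup>2"
          using card_all_pairs_less[of n] n by (simp flip: of_nat_power)
        then have "p n * y * card (?P n) \<le> p n * (c / 4) * (real n)\<^sup>2"
          using y pn c by (intro mult_mono) auto
        then have 2: "p n * y * card (?P n) \<le> c / 4 * x" by (simp add: x_def mult_ac)
        show ?thesis unfolding exp_add[symmetric] using 1 2 by (simp add: L_def)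
      qed
      also have "\<dots> \<le> \<delta>"
      proof -
        have "ln (1 / \<delta>) \<le> c / 2 * x" using xd c by (simp add: field_simps)
        then have "- (c / 2 * x) \<le> ln \<delta>" using \<delta> by (simp add: ln_div)
        then have "exp (- (c / 2 * x)) \<le> exp (ln \<delta>)" by simp
        then show ?thesis using \<delta> by simp
      qed
      finally show ?case .
    qed
  qed
  \<comment> \<open>Makes the number of copies of \<open>T\<close> meeting a fingerprint at most
    \<open>e1\<close> times n^v.\<close>
  have ev_q: "\<forall>\<^sub>F n in sequentially. ?q n < e1 / (4 * ?e * K + 1)"
    using mH e1 K(1) by (intro order_tendstoD(2)[OF powr_neg_tendsto_0]) (auto intro!: divide_pos_pos add_nonneg_pos)
  have "negligible p (\<lambda>n R. \<not> \<bar>real (ex_in ({..<n}, R) T H) - real (ex_num n T H) * p n ^ ?e\<bar>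
                  \<le> \<epsilon> * real n ^ ?v * p n ^ ?e)"
  proof (rule negligible_mono[OF p negligible_disj[OF p B1 negligible_disj[OF p B2 B3]]])
    show "\<forall>\<^sub>F n in sequentially. \<forall>R\<subseteq>?P n.
        \<not> \<bar>real (ex_in ({..<n}, R) T H) - real (ex_num n T H) * p n ^ ?e\<bar> \<le> \<epsilon> * real n ^ ?v * p n ^ ?e \<longrightarrow>
        e1 * real n ^ ?v * p n ^ ?e \<le> \<bar>count_in (emb T (complete_ugraph n)) (edge_image T) R - card (emb T (complete_ugraph n)) * p n ^ ?e\<bar> \<or>
        e1 * real n ^ ?v * p n ^ ?e \<le> \<bar>count_in (emb T (Fx n)) (edge_image T) R - card (emb T (Fx n)) * p n ^ ?e\<bar> \<or>
        (\<exists>S\<subseteq>R. real (card S) \<le> s n \<and> count_in (I n S) (edge_image T) R \<le> card (I n S) * p n ^ ?e - e1 * ?s n)"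
      using sat good dense[of "card (verts H) ^ ?v / e1"] ev_q eventually_gt_at_top[of 0]
    proof eventually_elim
      case 1: (elim n)
      note n = 1(5)
      show ?case
      proof (intro allI impI, rule ccontr)
        fix R assume R: "R \<subseteq> ?P n"
          and bad: "\<not> \<bar>real (ex_in ({..<n}, R) T H) - real (ex_num n T H) * p n ^ ?e\<bar> \<le> \<epsilon> * real n ^ ?v * p n ^ ?e"
          and fine: "\<not> (e1 * real n ^ ?v * p n ^ ?e \<le> \<bar>count_in (emb T (complete_ugraph n)) (edge_image T) R - card (emb T (complete_ugraph n)) * p n ^ ?e\<bar> \<or>
          e1 * real n ^ ?v * p n ^ ?e \<le> \<bar>count_in (emb T (Fx n)) (edge_image T) R - card (emb T (Fx n)) * p n ^ ?e\<bar> \<or>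
          (\<exists>S\<subseteq>R. real (card S) \<le> s n \<and> count_in (I n S) (edge_image T) R \<le> card (I n S) * p n ^ ?e - e1 * ?s n))"
        let ?G = "({..<n}, R)" and ?K = "complete_ugraph n"
        have pn: "0 < p n" using 1 by blast
        have sn: "0 < ?s n" using pn n by simp
        have sG: "simple_graph ?G" using R by (rule simple_spanning)
        have finK: "finite (emb T ?K)" using T by (intro finite_emb) (auto simp: complete_ugraph_def)
        have cnt: "count_in (emb T ?K) (edge_image T) R = card (emb T ?G)"
          using count_in_emb[OF T(1), of "?P n" n "{..<n}" R] R
          by (simp add: complete_ugraph_def Int_absorb1)
        have cntF: "count_in (emb T (Fx n)) (edge_image T) R = card (emb T (verts (Fx n), edges (Fx n) \<inter> R))"
          using count_in_emb[OF T(1) Fx_sub(2,1), of n R] by simp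
        have cF: "real (card (emb T (Fx n))) = a * ex_num n T H"
          using card_emb[OF T(1), of "Fx n"] Fx(1,3)[of n] by (simp add: a_def subgraph_def)
        show False
        proof -
          have as: "e1 * real n ^ ?v * p n ^ ?e = e1 * ?s n" by simp
          have g1: "\<bar>card (emb T ?G) - card (emb T ?K) * p n ^ ?e\<bar> < e1 * ?s n"
            and g2: "\<bar>card (emb T (verts (Fx n), edges (Fx n) \<inter> R)) - a * ex_num n T H * p n ^ ?e\<bar> < e1 * ?s n"
            using fine unfolding cnt cntF cF as de_Morgan_disj not_le by blast+
          have g3: "card (I n S) * p n ^ ?e - e1 * ?s n < count_in (I n S) (edge_image T) R"
            if "S \<subseteq> R" "real (card S) \<le> s n" for S
            using fine that by (meson linorder_not_le)
          have low: "a * ex_num n T H * p n ^ ?e - e1 * ?s n \<le> a * ex_in ?G T H"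
          proof -
            let ?F = "(verts (Fx n), edges (Fx n) \<inter> R)"
            have sF: "simple_graph (Fx n)" using Fx(1) by (simp add: subgraph_def)
            then have sF': "simple_graph ?F" by (auto simp: simple_graph_def)
            have "emb H ?F \<subseteq> emb H (Fx n)" by (intro emb_mono) auto
            then have "free_of H ?F" using Fx(2)[of n] free_of_iff[OF H(1) sF] free_of_iff[OF H(1) sF'] by auto
            then have "num_copies T ?F \<le> ex_in ?G T H"
              using Fx_sub[of n] sF' sG by (intro ex_in_ge) (auto simp: subgraph_def)
            then have "card (emb T ?F) \<le> a * ex_in ?G T H"
              using card_emb[OF T(1) sF'] a by (simp add: a_def)
            then show ?thesis using g2 by linarith
          qed
          have up: "a * ex_in ?G T H \<le> a * ex_num n T H * p n ^ ?e + 4 * e1 * ?s n"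
          proof -
            obtain F where F: "subgraph F ?G" "free_of H F" "num_copies T F = ex_in ?G T H"
              using ex_in_attained[OF sG H(1) eH] by metis
            have sF: "simple_graph F" "verts F \<subseteq> {..<n}" "edges F \<subseteq> R" using F(1) by (auto simp: subgraph_def)
            have aF: "a * ex_in ?G T H = card (emb T F)"
              using card_emb[OF T(1) sF(1)] F(3) by (simp add: a_def)
            have finF: "finite (verts F)" using simple_graphD(1)[OF sF(1)] .
            have nn: "0 \<le> a * ex_num n T H * p n ^ ?e" using a pn by simp
            have "card (emb T F) \<le> a * ex_num n T H * p n ^ ?e + 4 * e1 * ?s n"
            \<comment> \<open>A graph \<open>F\<close> with fewer vertices than \<open>H\<close> may
              contain the core yet be \<open>H\<close>-free for lack of room for isolated vertices.
              It has boundedly many copies of \<open>T\<close>, whereas \<open>?s n\<close> tends to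
              infinity.\<close>
            proof (cases "card (verts F) < card (verts H)")
              case True
              have "card (emb T F) \<le> card (verts F) ^ ?v" by (rule card_emb_le[OF T(1) finF])
              also have "\<dots> \<le> card (verts H) ^ ?v" using True by (intro power_mono) auto
              finally have "real (card (emb T F)) \<le> card (verts H) ^ ?v" by simp
              moreover have "card (verts H) ^ ?v / e1 \<le> ?s n"
              proof -
                have "card (verts H) ^ ?v / e1 \<le> real n ^ card (verts T) * p n ^ card (edges T)"
                  using T(2) simple_graphD(3)[OF T(1)] 1(3) by (intro 1(3)[THEN conjunct2, rule_format]) auto
                then show ?thesis .
              qed
              then have "card (verts H) ^ ?v \<le> e1 * ?s n" using e1 by (simp add: field_simps)
              moreover have "0 \<le> e1 * ?s n" using e1 sn by simp
              ultimately show ?thesis using nn by linarith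
            next
              case False
              have "emb H0 F = {}"
                using emb_core_extend[OF H(1) finF] False F(2) free_of_iff[OF H(1) sF(1)] by (auto simp: H0_def)
              \<comment> \<open>Adding the missing vertices to \<open>F\<close> creates no copy of
                the core, each of whose vertices lies on an edge.\<close>
              have freeE: "emb H0 ({..<n}, edges F) = {}"
              proof (rule ccontr)
                assume "emb H0 ({..<n}, edges F) \<noteq> {}"
                then obtain \<phi> where \<phi>: "\<phi> \<in> emb H0 ({..<n}, edges F)" by blast
                have "\<phi> x \<in> verts F" if x: "x \<in> verts H0" for x
                proof -
                  obtain e where "e \<in> edges H0" "x \<in> e" using x by (auto simp: H0_def core_def)
                  then have "\<phi> ` e \<in> edges F" "\<phi> x \<in> \<phi> ` e" using \<phi> by (auto simp: emb_def)
                  then show ?thesis using simple_graphD(3)[OF sF(1)] by blast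
                qed
                then have "\<phi> \<in> emb H0 F" using \<phi> by (auto simp: emb_def PiE_iff)
                then show False using \<open>emb H0 F = {}\<close> by simp
              qed
              have EP: "edges F \<subseteq> ?P n" using sF R by blast
              from 1(2)[unfolded good_def, rule_format, OF EP freeE] obtain S where S: "S \<subseteq> edges F" "edges F \<subseteq> fn n S \<union> S" "fn n S \<subseteq> ?P n"
                "real (card S) \<le> s n" "real (card (emb H0 ({..<n}, fn n S))) < d * real n ^ card (verts H0)"
                unfolding s_def by (elim exE conjE)
              have SP: "S \<subseteq> ?P n" using S(1) EP by blast
              have container: "card (emb T ({..<n}, fn n S)) \<le> max_emb n T H0 + e1 * real n ^ ?v"
                using 1(1)[rule_format, OF S(3)] S(5) by simp
              \<comment> \<open>Graphs free of the core are \<open>H\<close>-free, so the labelled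
                maximum for the core is bounded by the extremal number of \<open>H\<close>.\<close>
              have maxe: "real (max_emb n T H0) \<le> a * ex_num n T H"
              proof -
                obtain E where E: "E \<subseteq> ?P n" "emb H0 ({..<n}, E) = {}" "card (emb T ({..<n}, E)) = max_emb n T H0"
                  using max_emb_attained[OF sH0(2)] by metis
                have sE: "simple_graph ({..<n}, E)" using E(1) by (rule simple_spanning)
                have "emb H ({..<n}, E) = {}" using emb_subgraph_nonempty[OF H(1) subH0] E(2) by blast
                then have "num_copies T ({..<n}, E) \<le> ex_num n T H"
                  unfolding ex_num_def using sE E(1) H(1)
                  by (intro ex_in_ge) (auto simp: subgraph_def complete_ugraph_def free_of_iff simple_graph_def)
                then show ?thesis using card_emb[OF T(1) sE] E(3) a by (simp add: a_def)
              qed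
              define M where "M = {\<phi> \<in> emb T ?K. edge_image T \<phi> \<inter> S \<noteq> {}}"
              have finM: "finite M" using finK by (simp add: M_def)
              have meet: "card M \<le> e1 * real n ^ ?v"
              proof -
                have "real (card M * n\<^sup>2) \<le> real (4 * ?e * card S * n ^ ?v)"
                  unfolding of_nat_le_iff M_def by (rule card_emb_meeting_le[OF T(1) SP])
                also have "\<dots> = 4 * ?e * real n ^ ?v * card S" by simp
                also have "\<dots> \<le> 4 * ?e * real n ^ ?v * s n" using S(4) by (intro mult_left_mono) auto
                also have "\<dots> = (4 * ?e * K * ?q n) * real n ^ ?v * (real n)\<^sup>2" by (simp add: s_def)
                also have "\<dots> \<le> e1 * real n ^ ?v * (real n)\<^sup>2"
                proof -
                  have pos: "0 < 4 * real ?e * K + 1" using K(1) by (intro add_nonneg_pos) auto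
                  have "4 * ?e * K * ?q n \<le> (4 * ?e * K + 1) * ?q n" by (intro mult_right_mono) auto
                  also have "\<dots> \<le> e1" using 1(4) pos by (simp add: field_simps)
                  finally show ?thesis by (intro mult_right_mono) auto
                qed
                finally have "card M * (real n)\<^sup>2 \<le> (e1 * real n ^ ?v) * (real n)\<^sup>2" by simp
                then show ?thesis using n by simp
              qed
              have cover: "card (emb T ?K) \<le> card (I n S) + card (emb T ({..<n}, fn n S)) + card M"
              proof -
                have "emb T ?K \<subseteq> I n S \<union> emb T ({..<n}, fn n S) \<union> M"
                  by (auto simp: I_def M_def emb_def edge_image_def complete_ugraph_def)
                moreover have "finite (I n S \<union> emb T ({..<n}, fn n S) \<union> M)"
                  using finK finM T by (auto simp: I_def intro!: finite_emb)
                ultimately have "card (emb T ?K) \<le> card (I n S \<union> emb T ({..<n}, fn n S) \<union> M)" by (rule card_mono[rotated])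
                also have "\<dots> \<le> card (I n S) + card (emb T ({..<n}, fn n S)) + card M"
                  by (meson add_le_mono1 card_Un_le order_trans)
                finally show ?thesis .
              qed
              \<comment> \<open>All edges of \<open>F\<close> lie in the container or in
                \<open>S\<close>, so a copy in \<open>F\<close> that avoids \<open>S\<close> lies
                inside the container. The copies counted by \<open>I n S\<close> are therefore
                further copies of the random graph, and their lower tail bounds those in
                \<open>F\<close> from above.\<close>
              have split: "card (emb T F) + count_in (I n S) (edge_image T) R \<le> card (emb T ?G)"
              proof -
                have finI: "finite (I n S)" using finK by (simp add: I_def)
                let ?J = "{\<phi> \<in> I n S. edge_image T \<phi> \<subseteq> R}"
                have "emb T F \<inter> ?J = {}"
                proof (rule ccontr)
                  assume "emb T F \<inter> ?J \<noteq> {}"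
                  then obtain \<phi> where \<phi>: "\<phi> \<in> emb T F" "\<phi> \<in> I n S" by blast
                  have "edge_image T \<phi> \<subseteq> edges F" using \<phi>(1) by (auto simp: emb_def edge_image_def)
                  then show False using \<phi>(2) S(2) by (auto simp: I_def)
                qed
                moreover have fin1: "finite (emb T F)" "finite ?J" using finI T finF by (auto intro!: finite_emb)
                ultimately have "card (emb T F) + card ?J = card (emb T F \<union> ?J)" by (simp add: card_Un_disjoint)
                also have "\<dots> \<le> card (emb T ?G)"
                proof (rule card_mono)
                  show "finite (emb T ?G)" using T by (intro finite_emb) auto
                  have "emb T F \<subseteq> emb T ?G" using sF by (intro emb_mono) auto
                  moreover have "?J \<subseteq> emb T ?G" by (auto simp: I_def emb_def edge_image_def complete_ugraph_def)
                  ultimately show "emb T F \<union> ?J \<subseteq> emb T ?G" by blast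
                qed
                finally show ?thesis unfolding count_in_card[OF finI] by simp
              qed
              have "S \<subseteq> R" using S(1) sF by blast
              from g3[OF this S(4)] have Y: "card (I n S) * p n ^ ?e - e1 * ?s n < count_in (I n S) (edge_image T) R" .
              have "card (emb T ?K) - a * ex_num n T H - 2 * (e1 * real n ^ ?v) \<le> card (I n S)"
                using cover container maxe meet by linarith
              then have "(card (emb T ?K) - a * ex_num n T H - 2 * (e1 * real n ^ ?v)) * p n ^ ?e \<le> card (I n S) * p n ^ ?e"
                using pn by (intro mult_right_mono) auto
              then have "card (emb T ?K) * p n ^ ?e - a * ex_num n T H * p n ^ ?e - 2 * (e1 * ?s n) \<le> card (I n S) * p n ^ ?e"
                by (simp add: left_diff_distrib mult.assoc)
              then show ?thesis using Y split g1 by linarith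
            qed
            then show ?thesis unfolding aF .
          qed
          have "\<bar>a * ex_in ?G T H - a * (ex_num n T H * p n ^ ?e)\<bar> \<le> a * (\<epsilon> * ?s n)"
          proof -
            have "a * (\<epsilon> * ?s n) = 8 * (e1 * ?s n)" by (simp add: e1_def)
            moreover have "0 \<le> e1 * ?s n" using e1 sn by simp
            moreover have "a * (ex_num n T H * p n ^ ?e) = a * ex_num n T H * p n ^ ?e" by simp
            ultimately show ?thesis using low up by linarith
          qed
          from abs_diff_le_scaled[OF a this] show False using bad by (simp add: mult_ac)
        qed
      qed
    qed
  qed
  then show ?thesis by (rule whp_if_negligible[OF p])
qed

theorem theorem1p6:
  fixes T :: "'a ugraph" and H :: "'b ugraph" and p :: "nat \<Rightarrow> real"
  assumes "simple_graph T" and "card (edges T) \<ge> 2"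
    and "simple_graph H" and "card (edges H) \<ge> 2"
    and "two_balanced T"
    and "m2 H > m2 T"
    and "\<And>n. 0 \<le> p n \<and> p n \<le> 1"
  shows
    "((\<lambda>n. real n powr (- (real (card (verts T)) / real (card (edges T))))) \<in> o(p) \<and>
      p \<in> o(\<lambda>n. real n powr (- (1 / m2 H))) \<longrightarrow>
        (\<forall>\<epsilon>>0. whp (\<lambda>n. binomial_random_graph n (p n))
          (\<lambda>n G. \<bar>real (ex_in G T H) - real (num_copies T (complete_ugraph n)) * p n ^ card (edges T)\<bar>
                  \<le> \<epsilon> * real n ^ card (verts T) * p n ^ card (edges T)))) \<and>
     ((\<lambda>n. real n powr (- (1 / m2 H))) \<in> o(p) \<longrightarrow>
        (\<forall>\<epsilon>>0. whp (\<lambda>n. binomial_random_graph n (p n))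
          (\<lambda>n G. \<bar>real (ex_in G T H) - real (ex_num n T H) * p n ^ card (edges T)\<bar>
                  \<le> \<epsilon> * real n ^ card (verts T) * p n ^ card (edges T))))"
proof (intro conjI impI allI, elim conjE)
  fix \<epsilon> :: real assume "0 < \<epsilon>"
    and "(\<lambda>n. real n powr (- (real (card (verts T)) / real (card (edges T))))) \<in> o(p)"
    and "p \<in> o(\<lambda>n. real n powr (- (1 / m2 H)))"
  then show "whp (\<lambda>n. binomial_random_graph n (p n))
      (\<lambda>n G. \<bar>real (ex_in G T H) - real (num_copies T (complete_ugraph n)) * p n ^ card (edges T)\<bar>
              \<le> \<epsilon> * real n ^ card (verts T) * p n ^ card (edges T))"
    by (intro ex_in_below_threshold assms)
next
  fix \<epsilon> :: real assume "(\<lambda>n. real n powr (- (1 / m2 H))) \<in> o(p)" and "0 < \<epsilon>"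
  then show "whp (\<lambda>n. binomial_random_graph n (p n))
      (\<lambda>n G. \<bar>real (ex_in G T H) - real (ex_num n T H) * p n ^ card (edges T)\<bar>
              \<le> \<epsilon> * real n ^ card (verts T) * p n ^ card (edges T))"
    by (intro ex_in_above_threshold assms)
qed

end
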